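(* Let $N\ge3$, $\mu\ge0$, and let $K$ satisfy (K0) and $f$ satisfy (F0). Assume $p_S(\alpha)<p<p_{JL}(\alpha)$. If $(E_\mu)$ has a singular solution $u^*$, then $(E_\mu)$ has infinitely many bounded solutions $\{u_j\}_{j=0}^\infty$ such that $\|u_j\|_{L^\infty}\to\infty$ as $j\to\infty$.
   Context: Throughout, $N\ge3$. $K:(0,\infty)\to(0,\infty)$ is continuous and satisfies (K0): $K(r)=(k_0+o(1))r^{\alpha}$ as $r\to0$ for some $\alpha>-2$ and $k_0>0$. $f:(0,\infty)\to[0,\infty)$ is continuous, not identically zero, and satisfies (F0): $f(r)=O(r^{\nu})$ as $r\to0$ for some $\nu>-2$. For $\mu\ge0$, equation $(E_\mu)$ is $u''+\frac{N-1}{r}u'+K(r)u^p+\mu f(r)=0$, $u>0$ for $r>0$. A bounded solution of $(E_\mu)$ is $u\in C^2(0,\infty)$ satisfying $(E_\mu)$ pointwise on $(0,\infty)$ with $\lim_{r\to0}u(r)$ finite. A singular solution is $u\in C^2(0,\infty)$ satisfying $(E_\mu)$ pointwise on $(0,\infty)$ with $\lim_{r\to0}u(r)=\infty$. $p_S(\alpha):=\frac{N+2+2\alpha}{N-2}$; $p_{JL}(\alpha):=1+\frac{2(2+\alpha)}{N-4-\alpha-\sqrt{(2+\alpha)(2N-2+\alpha)}}$ if $N>10+4\alpha$, and $p_{JL}(\alpha):=\infty$ if $N\le 10+4\alpha$. *)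

theory Defs
  imports "HOL-Analysis.Analysis" "HOL-Library.Landau_Symbols"
begin

definition p_S :: "nat \<Rightarrow> real \<Rightarrow> real" where
  "p_S N \<alpha> = (real N + 2 + 2 * \<alpha>) / (real N - 2)"

definition p_JL :: "nat \<Rightarrow> real \<Rightarrow> ereal" where
  "p_JL N \<alpha> = (if real N > 10 + 4 * \<alpha>
     then ereal (1 + 2 * (2 + \<alpha>) /
            (real N - 4 - \<alpha> - sqrt ((2 + \<alpha>) * (2 * real N - 2 + \<alpha>))))
     else \<infinity>)"

definition cond_K0 :: "(real \<Rightarrow> real) \<Rightarrow> real \<Rightarrow> real \<Rightarrow> bool" where
  "cond_K0 K \<alpha> k0 \<longleftrightarrow> \<alpha> > -2 \<and> k0 > 0 \<and>
     ((\<lambda>r. K r / r powr \<alpha>) \<longlongrightarrow> k0) (at_right 0)"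

definition cond_F0 :: "(real \<Rightarrow> real) \<Rightarrow> real \<Rightarrow> bool" where
  "cond_F0 f \<nu> \<longleftrightarrow> \<nu> > -2 \<and> f \<in> O[at_right 0](\<lambda>r. r powr \<nu>)"

definition solves_E :: "nat \<Rightarrow> (real \<Rightarrow> real) \<Rightarrow> (real \<Rightarrow> real) \<Rightarrow> real \<Rightarrow> real
    \<Rightarrow> (real \<Rightarrow> real) \<Rightarrow> bool" where
  "solves_E N K f p \<mu> u \<longleftrightarrow>
     (\<exists>u' u''. continuous_on {0<..} u'' \<and>
        (\<forall>r>0. (u has_real_derivative u' r) (at r) \<and>
               (u' has_real_derivative u'' r) (at r) \<and>
               u r > 0 \<and>
               u'' r + (real N - 1) / r * u' r + K r * u r powr p + \<mu> * f r = 0))"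

definition bounded_solution where
  "bounded_solution N K f p \<mu> u \<longleftrightarrow>
     solves_E N K f p \<mu> u \<and> (\<exists>L. (u \<longlongrightarrow> L) (at_right 0))"

definition singular_solution where
  "singular_solution N K f p \<mu> u \<longleftrightarrow>
     solves_E N K f p \<mu> u \<and> filterlim u at_top (at_right 0)"

definition Linf_norm :: "(real \<Rightarrow> real) \<Rightarrow> ereal" where
  "Linf_norm u = (SUP r\<in>{0<..}. ereal \<bar>u r\<bar>)"

end

theory Submission
  imports Defs
begin

text \<open>
  In the variable \<open>t = ln r\<close> the equation reads \<open>u'' + n u' + \<kappa> u\<^sup>p + \<phi> = 0\<close> with \<open>n = N - 2\<close>,
  \<open>\<kappa> = e\<^bsup>2t\<^esup> K(e\<^bsup>t\<^esup>)\<close> and \<open>\<phi> = \<mu> e\<^bsup>2t\<^esup> f(e\<^bsup>t\<^esup>)\<close>. Replacing \<open>u\<^sup>p\<close> by \<open>(max u 0)\<^sup>p\<close>, there is for each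
  \<open>\<zeta> > 0\<close> a solution \<open>u(\<cdot>, \<zeta>)\<close> on the whole line with limit \<open>\<zeta>\<close> at \<open>-\<infinity>\<close>, and it depends continuously on \<open>\<zeta>\<close>.
  Put \<open>\<theta> = (2 + \<alpha>) / (p - 1)\<close> and \<open>A = (b / k0)\<^bsup>1/(p-1)\<^esup>\<close> with \<open>b = \<theta> (n - \<theta>)\<close>. A Lyapunov function for
  \<open>w = e\<^bsup>\<theta>t\<^esup> u\<close> shows that \<open>w\<close> stays near \<open>A\<close> on arbitrarily long intervals arbitrarily far back for the singular
  solution; by rescaling the same holds for \<open>u(\<cdot>, \<zeta>)\<close> on a common interval if \<open>\<zeta>\<close> is chosen suitably. Below the
  Joseph--Lundgren exponent the linearization at \<open>A\<close> oscillates, so the number of zeros of \<open>u(\<cdot>, \<zeta>) - u\<^sup>*\<close> is unbounded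
  as \<open>\<zeta> \<rightarrow> \<infinity>\<close>. These zeros are simple; if no \<open>u(\<cdot>, \<zeta>)\<close> with \<open>\<zeta> \<ge> \<zeta>\<^sub>0\<close> were positive everywhere, they would stay in
  compact sets locally uniformly in \<open>\<zeta>\<close> and their number would be constant, a contradiction. Hence \<open>u(\<cdot>, \<zeta>)\<close> is
  a bounded solution for arbitrarily large \<open>\<zeta>\<close>.
\<close>

section \<open>Calculus on half-lines\<close>

text \<open>The condition \<open>p_S N \<alpha> < p\<close> makes the damping coefficient
  \<open>a = n - 2 * \<theta>\<close> positive, so that energy is lost as t grows. The condition
  \<open>p < p_JL N \<alpha>\<close> gives a^2 < 4 (p - 1) b, so that the characteristic roots at
  \<open>A\<close> are not real.

  K / r^\<alpha> has a limit at 0 but comes with no rate, so the argument does not aim at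
  convergence of \<open>w\<close> to \<open>A\<close> along the singular solution. Windows are
  enough: on any interval of length pi / \<omega> where both solutions are close to \<open>A\<close>
  their difference has a zero, so one long window yields any prescribed number of zeros.

  The truncated power keeps u(., \<zeta>) defined after it has lost its sign; from then on it
  decreases and cannot meet the positive singular solution again. Far to the left the singular
  solution exceeds \<zeta>. Since zeros are simple, they can get lost only through +infinity, and
  only at a \<zeta> for which u(., \<zeta>) never becomes nonpositive. This is how a jump of the
  number of zeros produces positive solutions.\<close>

definition ppow :: "real \<Rightarrow> real \<Rightarrow> real" where
  "ppow p x = max x 0 powr p"

lemma ppow_nonneg [simp]: "0 \<le> ppow p x"
  by (simp add: ppow_def)

lemma ppow_eq_powr: "0 \<le> x \<Longrightarrow> ppow p x = x powr p"
  by (simp add: ppow_def)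

lemma continuous_on_ppow [continuous_intros]:
  assumes "0 < p" "continuous_on S f"
  shows "continuous_on S (\<lambda>x. ppow p (f x))"
  unfolding ppow_def using assms by (intro continuous_on_powr' continuous_intros) auto

lemma ppow_mono: "0 < p \<Longrightarrow> x \<le> y \<Longrightarrow> ppow p x \<le> ppow p y"
  unfolding ppow_def by (intro powr_mono2) auto

lemma powr_lipschitz:
  fixes p M x y :: real
  assumes "1 < p" "0 \<le> x" "x \<le> y" "y \<le> M"
  shows "\<bar>y powr p - x powr p\<bar> \<le> p * M powr (p - 1) * (y - x)"
proof (cases "x = y")
  case False
  then have "x < y" using assms by auto
  have "\<exists>l z. x < z \<and> z < y \<and> DERIV (\<lambda>x. x powr p) z :> l \<and> y powr p - x powr p = (y - x) * l"
  proof (rule MVT[OF \<open>x < y\<close>])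
    show "continuous_on {x..y} (\<lambda>x. x powr p)"
      using assms by (intro continuous_on_powr' continuous_intros) auto
    show "(\<lambda>x. x powr p) differentiable at z" if "x < z" "z < y" for z
      unfolding real_differentiable_def using that assms
      by (intro exI[of _ "p * z powr (p - 1)"]) (auto intro!: derivative_eq_intros)
  qed
  then obtain l z where z: "x < z" "z < y" "DERIV (\<lambda>x. x powr p) z :> l"
    and eq: "y powr p - x powr p = (y - x) * l" by blast
  have "DERIV (\<lambda>x. x powr p) z :> p * z powr (p - 1)"
    using z(1) assms by (auto intro!: derivative_eq_intros)
  then have l: "l = p * z powr (p - 1)" using z(3) DERIV_unique by blast
  have "z powr (p - 1) \<le> M powr (p - 1)"
    using z assms by (intro powr_mono2) auto
  then have "l \<le> p * M powr (p - 1)" unfolding l using assms by simp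
  moreover have "0 \<le> l" unfolding l using assms by simp
  ultimately show ?thesis unfolding eq using \<open>x < y\<close>
    by (simp add: abs_mult mult.commute mult_right_mono)
qed simp

text \<open>The truncated power vanishes on the negative axis, so an upper bound \<open>M\<close>
  alone yields a Lipschitz constant. This suits regular solutions, which are bounded above by their
  value at -infinity but come with no lower bound.\<close>

lemma ppow_lipschitz:
  assumes "1 < p" "x \<le> M" "y \<le> M" "0 \<le> M"
  shows "\<bar>ppow p x - ppow p y\<bar> \<le> p * M powr (p - 1) * \<bar>x - y\<bar>"
proof -
  have *: "\<bar>ppow p x - ppow p y\<bar> \<le> p * M powr (p - 1) * \<bar>x - y\<bar>"
    if "x \<le> y" "y \<le> M" for x y
  proof -
    have "\<bar>max y 0 powr p - max x 0 powr p\<bar> \<le> p * M powr (p - 1) * (max y 0 - max x 0)"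
      by (rule powr_lipschitz) (use assms that in auto)
    also have "\<dots> \<le> p * M powr (p - 1) * \<bar>x - y\<bar>"
      by (rule mult_left_mono) (use assms that in auto)
    finally show ?thesis by (simp add: ppow_def abs_minus_commute)
  qed
  show ?thesis
    using *[of x y] *[of y x] assms by (cases "x \<le> y") (auto simp: abs_minus_commute)
qed

section \<open>Comparison and integration with data at minus infinity\<close>

lemma DERIV_mono_le:
  fixes X :: "real \<Rightarrow> real"
  assumes "s \<le> t" "\<And>r. s \<le> r \<Longrightarrow> r \<le> t \<Longrightarrow> (X has_real_derivative X' r) (at r)"
    and "\<And>r. s \<le> r \<Longrightarrow> r \<le> t \<Longrightarrow> X' r \<le> 0"
  shows "X t \<le> X s"
  using DERIV_nonpos_imp_nonincreasing[of s t X] assms by blast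

lemma continuous_on_of_DERIV:
  fixes f :: "real \<Rightarrow> real"
  shows "(\<And>t. (f has_real_derivative f' t) (at t)) \<Longrightarrow> continuous_on S f"
  by (meson DERIV_isCont continuous_at_imp_continuous_on)

text \<open>Replaces integration from -infinity. The majorant \<open>Y\<close> serves the cases
  where no limit of \<open>X\<close> itself is known; otherwise \<open>Y\<close> is
  \<open>X\<close>.\<close>

lemma decreasing_le_limit:
  fixes X Y :: "real \<Rightarrow> real"
  assumes "\<And>r. r \<le> t \<Longrightarrow> (X has_real_derivative X' r) (at r)"
    and "\<And>r. r \<le> t \<Longrightarrow> X' r \<le> 0"
    and "(Y \<longlongrightarrow> l) at_bot" "eventually (\<lambda>r. X r \<le> Y r) at_bot"
  shows "X t \<le> l"
proof (rule tendsto_lowerbound[OF assms(3)])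
  have "eventually (\<lambda>r. r \<le> t) at_bot" by (rule eventually_le_at_bot)
  then show "eventually (\<lambda>r. X t \<le> Y r) at_bot"
    using assms(4)
  proof eventually_elim
    case (elim r)
    have "X t \<le> X r" by (rule DERIV_mono_le[where X' = X']) (use elim assms in auto)
    then show ?case using elim by simp
  qed
qed simp

lemma tendsto_exp_at_bot: "0 < d \<Longrightarrow> ((\<lambda>t::real. exp (d * t)) \<longlongrightarrow> 0) at_bot"
  by (rule filterlim_compose[OF exp_at_bot]) (simp add: filterlim_tendsto_pos_mult_at_bot[OF tendsto_const] filterlim_ident)

lemma decreasing_has_limit_at_bot:
  fixes X :: "real \<Rightarrow> real"
  assumes mono: "\<And>s t. s \<le> t \<Longrightarrow> t \<le> T \<Longrightarrow> X t \<le> X s" and bd: "\<And>t. t \<le> T \<Longrightarrow> X t \<le> B"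
  shows "\<exists>l. (X \<longlongrightarrow> l) at_bot"
proof -
  let ?l = "SUP t\<in>{..T}. X t"
  have bdd: "bdd_above (X ` {..T})" using bd by (auto intro!: bdd_aboveI)
  have "(X \<longlongrightarrow> ?l) at_bot"
  proof (rule order_tendstoI)
    fix a assume "a < ?l"
    then obtain s where s: "s \<le> T" "a < X s"
      using less_cSUP_iff[OF _ bdd] by auto
    have "X s \<le> X t" if "t \<le> s" for t using mono[OF that] s by auto
    then show "eventually (\<lambda>t. a < X t) at_bot"
      unfolding eventually_at_bot_linorder using s(2) by (intro exI[of _ s]) fastforce
  next
    fix a assume "?l < a"
    moreover have "X t \<le> ?l" if "t \<le> T" for t using bdd that by (intro cSUP_upper) auto
    ultimately show "eventually (\<lambda>t. X t < a) at_bot"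
      unfolding eventually_at_bot_linorder by (intro exI[of _ T]) fastforce
  qed
  then show ?thesis by blast
qed

lemma antiderivative_exists:
  fixes J :: "real \<Rightarrow> real"
  assumes "continuous_on UNIV J"
  shows "\<exists>P. \<forall>t. (P has_real_derivative J t) (at t)"
proof -
  have "\<exists>P. \<forall>x::real. -\<infinity> < ereal x \<longrightarrow> ereal x < \<infinity> \<longrightarrow> (P has_vector_derivative J x) (at x)"
    by (rule einterval_antiderivative) (use assms in \<open>auto simp: continuous_on_eq_continuous_at\<close>)
  then show ?thesis by (auto simp: has_real_derivative_iff_has_vector_derivative)
qed

text \<open>An antiderivative minus the primitive of the bound is nonincreasing, and the same
  argument for its negative bounds it above. The limit at -infinity therefore exists by
  monotonicity, without improper integrals.\<close>

lemma primitive_exists: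
  fixes J :: "real \<Rightarrow> real"
  assumes cont: "continuous_on UNIV J" and d: "0 < d"
    and bd: "\<And>t. t \<le> 0 \<Longrightarrow> \<bar>J t\<bar> \<le> C * exp (d * t)"
  shows "\<exists>P. (\<forall>t. (P has_real_derivative J t) (at t)) \<and> (P \<longlongrightarrow> 0) at_bot"
proof -
  obtain P where P: "\<And>t. (P has_real_derivative J t) (at t)"
    using antiderivative_exists[OF cont] by blast
  have C: "0 \<le> C" using bd[of 0] by simp
  define X where "X = (\<lambda>t. P t - C / d * exp (d * t))"
  have dX: "(X has_real_derivative J t - C * exp (d * t)) (at t)" for t
    unfolding X_def using d by (auto intro!: derivative_eq_intros P)
  have dY: "((\<lambda>t. - P t - C / d * exp (d * t)) has_real_derivative - J t - C * exp (d * t)) (at t)" for t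
    using d by (auto intro!: derivative_eq_intros P)
  have "\<exists>l. (X \<longlongrightarrow> l) at_bot"
  proof (rule decreasing_has_limit_at_bot)
    fix s t :: real assume "s \<le> t" "t \<le> 0"
    then show "X t \<le> X s"
      using bd by (intro DERIV_mono_le[OF _ dX]) (force simp: abs_le_iff)+
  next
    fix t :: real assume t: "t \<le> 0"
    have "- P 0 - C / d * exp (d * 0) \<le> - P t - C / d * exp (d * t)"
      using t bd by (intro DERIV_mono_le[OF _ dY]) (force simp: abs_le_iff)+
    moreover have "0 \<le> C / d * exp (d * t)" using C d by simp
    ultimately show "X t \<le> P 0 + C / d" unfolding X_def by simp
  qed
  then obtain l where l: "(X \<longlongrightarrow> l) at_bot" by blast
  have "((\<lambda>t. X t + C / d * exp (d * t)) \<longlongrightarrow> l + C / d * 0) at_bot"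
    by (intro tendsto_intros l tendsto_exp_at_bot d)
  then have "(P \<longlongrightarrow> l) at_bot" by (simp add: X_def)
  then have "((\<lambda>t. P t - l) \<longlongrightarrow> 0) at_bot" by (simp add: LIM_zero)
  moreover have "((\<lambda>t. P t - l) has_real_derivative J t) (at t)" for t
    by (auto intro!: derivative_eq_intros P)
  ultimately show ?thesis by blast
qed

text \<open>Plays the role of the integral of \<open>J\<close> over (-infinity, t]; the choice is
  meaningful under the hypotheses of \<open>primitive_exists\<close>.\<close>

definition primitive :: "(real \<Rightarrow> real) \<Rightarrow> real \<Rightarrow> real" where
  "primitive J = (SOME P. (\<forall>t. (P has_real_derivative J t) (at t)) \<and> (P \<longlongrightarrow> 0) at_bot)"

lemma primitive:
  fixes J :: "real \<Rightarrow> real"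
  assumes "continuous_on UNIV J" "0 < d" "\<And>t. t \<le> 0 \<Longrightarrow> \<bar>J t\<bar> \<le> C * exp (d * t)"
  shows "(primitive J has_real_derivative J t) (at t)" "(primitive J \<longlongrightarrow> 0) at_bot"
  using someI_ex[OF primitive_exists[of J d C]] assms unfolding primitive_def by blast+

lemma abs_le_of_deriv_le:
  fixes X Y :: "real \<Rightarrow> real"
  assumes X: "\<And>r. r \<le> t \<Longrightarrow> (X has_real_derivative X' r) (at r)"
    and Y: "\<And>r. r \<le> t \<Longrightarrow> (Y has_real_derivative Y' r) (at r)"
    and le: "\<And>r. r \<le> t \<Longrightarrow> \<bar>X' r\<bar> \<le> Y' r"
    and lim: "(X \<longlongrightarrow> x) at_bot" "(Y \<longlongrightarrow> y) at_bot"
  shows "\<bar>X t - x\<bar> \<le> Y t - y"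
proof -
  have "X t - Y t \<le> x - y"
    by (rule decreasing_le_limit[where X' = "\<lambda>r. X' r - Y' r" and Y = "\<lambda>r. X r - Y r"])
      (use le in \<open>force intro!: derivative_eq_intros X Y tendsto_intros lim simp: abs_le_iff\<close>)+
  moreover have "- X t - Y t \<le> - x - y"
    by (rule decreasing_le_limit[where X' = "\<lambda>r. - X' r - Y' r" and Y = "\<lambda>r. - X r - Y r"])
      (use le in \<open>force intro!: derivative_eq_intros X Y tendsto_intros lim simp: abs_le_iff\<close>)+
  ultimately show ?thesis by (simp add: abs_le_iff)
qed

section \<open>Regular solutions\<close>

text \<open>By variation of constants, v t is minus the integral of exp (- n (t - r)) j r over r
  \<le> t. The kernel is at most 1, so the damping may be dropped from the estimate. At -infinity
  only exp (n t) v has to vanish.\<close>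

lemma flux_bound:
  fixes v Y :: "real \<Rightarrow> real"
  assumes n: "0 < n"
    and v: "\<And>r. r \<le> t \<Longrightarrow> (v has_real_derivative - n * v r - j r) (at r)"
    and Y: "\<And>r. r \<le> t \<Longrightarrow> (Y has_real_derivative Y' r) (at r)"
    and le: "\<And>r. r \<le> t \<Longrightarrow> \<bar>j r\<bar> \<le> Y' r"
    and lim: "((\<lambda>r. exp (n * r) * v r) \<longlongrightarrow> 0) at_bot" "(Y \<longlongrightarrow> 0) at_bot"
  shows "\<bar>v t\<bar> \<le> Y t"
proof -
  have Y0: "0 \<le> Y r" if "r \<le> t" for r
  proof -
    have "- Y r \<le> 0"
    proof (rule decreasing_le_limit[where X = "\<lambda>r. - Y r" and t = r and X' = "\<lambda>r. - Y' r"])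
      show "((\<lambda>r. - Y r) \<longlongrightarrow> 0) at_bot" using tendsto_minus[OF lim(2)] by simp
      show "- Y' s \<le> 0" if "s \<le> r" for s
        using le[of s] that \<open>r \<le> t\<close> by linarith
    qed (use that in \<open>auto intro!: derivative_eq_intros Y\<close>)
    then show ?thesis by simp
  qed
  have eY: "((\<lambda>r. exp (n * r) * Y r) \<longlongrightarrow> 0) at_bot"
    using tendsto_mult[OF tendsto_exp_at_bot[OF n] lim(2)] by simp
  have upper: "v t \<le> Y t"
    if v: "\<And>r. r \<le> t \<Longrightarrow> (v has_real_derivative - n * v r - j r) (at r)"
      and le: "\<And>r. r \<le> t \<Longrightarrow> \<bar>j r\<bar> \<le> Y' r"
      and lim: "((\<lambda>r. exp (n * r) * v r) \<longlongrightarrow> 0) at_bot" for v j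
  proof -
    have "exp (n * t) * v t - exp (n * t) * Y t \<le> 0"
    proof (rule decreasing_le_limit[where X = "\<lambda>r. exp (n * r) * v r - exp (n * r) * Y r" and t = t
          and X' = "\<lambda>r. - exp (n * r) * j r - n * exp (n * r) * Y r - exp (n * r) * Y' r"])
      fix r assume r: "r \<le> t"
      show "((\<lambda>r. exp (n * r) * v r - exp (n * r) * Y r) has_real_derivative
          - exp (n * r) * j r - n * exp (n * r) * Y r - exp (n * r) * Y' r) (at r)"
        using r by (auto intro!: derivative_eq_intros v Y simp: algebra_simps)
      have "0 \<le> exp (n * r) * (j r + Y' r) + n * exp (n * r) * Y r"
        by (rule add_nonneg_nonneg; intro mult_nonneg_nonneg) (use le[OF r] Y0[OF r] n in auto)
      then show "- exp (n * r) * j r - n * exp (n * r) * Y r - exp (n * r) * Y' r \<le> 0"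
        by (simp add: algebra_simps)
    next
      show "((\<lambda>r. exp (n * r) * v r - exp (n * r) * Y r) \<longlongrightarrow> 0) at_bot"
        using tendsto_diff[OF lim eY] by simp
    qed auto
    then show ?thesis by simp
  qed
  have "v t \<le> Y t" by (rule upper[OF v le lim(1)])
  moreover have "- v t \<le> Y t"
    by (rule upper[where v = "\<lambda>r. - v r" and j = "\<lambda>r. - j r"])
      (use v le tendsto_minus[OF lim(1)] in \<open>force intro!: derivative_eq_intros\<close>)+
  ultimately show ?thesis by simp
qed

text \<open>Here \<open>v\<close> is the derivative with respect to t = ln r, that is, r u'(r). No
  sign is imposed on \<open>u\<close>: its positivity for suitable large \<zeta> is the goal of the
  whole proof.\<close>

definition regular :: "real \<Rightarrow> real \<Rightarrow> (real \<Rightarrow> real) \<Rightarrow> (real \<Rightarrow> real) \<Rightarrow> real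
    \<Rightarrow> (real \<Rightarrow> real) \<Rightarrow> (real \<Rightarrow> real) \<Rightarrow> bool" where
  "regular n p \<kappa> \<phi> \<zeta> u v \<longleftrightarrow>
     (\<forall>t. (u has_real_derivative v t) (at t)) \<and>
     (\<forall>t. (v has_real_derivative - n * v t - (\<kappa> t * ppow p (u t) + \<phi> t)) (at t)) \<and>
     (u \<longlongrightarrow> \<zeta>) at_bot \<and> (v \<longlongrightarrow> 0) at_bot"

lemma nonneg_of_deriv_nonneg:
  fixes P :: "real \<Rightarrow> real"
  assumes "\<And>t. (P has_real_derivative J t) (at t)" "\<And>t. 0 \<le> J t" "(P \<longlongrightarrow> 0) at_bot"
  shows "0 \<le> P t"
proof -
  have "- P t \<le> 0"
    by (rule decreasing_le_limit[where X = "\<lambda>t. - P t" and t = t and X' = "\<lambda>t. - J t" and Y = "\<lambda>t. - P t"])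
      (use assms tendsto_minus[OF assms(3)] in \<open>auto intro!: derivative_eq_intros\<close>)
  then show ?thesis by simp
qed

text \<open>Picard iteration started at -infinity. Since v + n u has derivative - (\<kappa> ppow p u
  + \<phi>), the next iterate is \<zeta> - (A + v) / n with \<open>A\<close> and \<open>v\<close>
  obtained from primitives. In the sup norm weighted by exp (- q \<Phi>) the map is a contraction on
  the whole line at once.\<close>

lemma regular_exists:
  fixes \<kappa> \<phi> :: "real \<Rightarrow> real"
  assumes n: "0 < n" and p: "1 < p" and \<zeta>: "0 < \<zeta>" and d: "0 < d"
    and cont: "continuous_on UNIV \<kappa>" "continuous_on UNIV \<phi>"
    and nonneg: "\<And>t. 0 \<le> \<kappa> t" "\<And>t. 0 \<le> \<phi> t"
    and bd: "\<And>t. t \<le> 0 \<Longrightarrow> \<kappa> t \<le> C * exp (d * t)" "\<And>t. t \<le> 0 \<Longrightarrow> \<phi> t \<le> C * exp (d * t)"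
  shows "\<exists>u v. regular n p \<kappa> \<phi> \<zeta> u v"
proof -
  \<comment> \<open>Cutting off above \<zeta> makes the nonlinearity bounded and globally Lipschitz.
    The cut is harmless in the end, because the fixed point is nonincreasing and hence stays below
    \<zeta>.\<close>
  define F where "F = (\<lambda>x. ppow p (min x \<zeta>))"
  define m where "m = \<zeta> powr p"
  define L where "L = p * \<zeta> powr (p - 1)"
  \<comment> \<open>The difference of two iterates is at most 2 Y / n, and \<open>Y\<close> carries
    the factor L / q; this value of q makes the contraction factor 1/2.\<close>
  define q where "q = 4 * L / n"
  define \<rho> where "\<rho> = (\<lambda>t. \<kappa> t + \<phi> t)"
  define \<Phi> where "\<Phi> = primitive \<rho>"
  have L0: "0 < L" using p \<zeta> by (simp add: L_def)
  then have q0: "0 < q" using n by (simp add: q_def)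
  have m0: "0 \<le> m" by (simp add: m_def)
  have F0: "0 \<le> F x" for x by (simp add: F_def)
  have Fm: "F x \<le> m" for x
    using ppow_mono[of p "min x \<zeta>" \<zeta>] p \<zeta> by (simp add: F_def m_def ppow_eq_powr)
  have FL: "\<bar>F x - F y\<bar> \<le> L * \<bar>x - y\<bar>" for x y
  proof -
    have "\<bar>F x - F y\<bar> \<le> L * \<bar>min x \<zeta> - min y \<zeta>\<bar>"
      unfolding F_def L_def by (rule ppow_lipschitz) (use p \<zeta> in auto)
    also have "\<dots> \<le> L * \<bar>x - y\<bar>" by (rule mult_left_mono) (use L0 in auto)
    finally show ?thesis .
  qed
  have cF: "continuous_on UNIV (\<lambda>t. F (g t))" if "continuous_on UNIV g" for g :: "real \<Rightarrow> real"
    unfolding F_def using p that by (intro continuous_intros) auto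
  have \<rho>0: "0 \<le> \<rho> t" for t using nonneg[of t] by (simp add: \<rho>_def)
  have \<rho>b: "\<rho> t \<le> 2 * C * exp (d * t)" if "t \<le> 0" for t
    using bd[OF that] by (simp add: \<rho>_def)
  have d\<Phi>: "(\<Phi> has_real_derivative \<rho> t) (at t)" and lim\<Phi>: "(\<Phi> \<longlongrightarrow> 0) at_bot" for t
    unfolding \<Phi>_def
    by (rule primitive[of _ d "2 * C"]; use d \<rho>0 \<rho>b cont in \<open>auto simp: \<rho>_def intro!: continuous_intros\<close>)+
  have \<Phi>0: "0 \<le> \<Phi> t" for t using nonneg_of_deriv_nonneg[OF d\<Phi> \<rho>0 lim\<Phi>] .
  have c\<Phi>: "continuous_on UNIV \<Phi>"
    by (rule continuous_on_of_DERIV[OF d\<Phi>])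
  \<comment> \<open>The argument \<open>b\<close> is the weighted unknown exp (- q \<Phi>) u, which
    lives in the space of bounded continuous functions even if u is unbounded.\<close>
  define J where "J = (\<lambda>(b :: real \<Rightarrow>\<^sub>C real) t. \<kappa> t * F (exp (q * \<Phi> t) * b t) + \<phi> t)"
  have cJ: "continuous_on UNIV (J b)" for b
    unfolding J_def by (intro continuous_intros cF cont c\<Phi>) auto
  have J0: "0 \<le> J b t" for b t using nonneg F0 by (simp add: J_def)
  have J\<rho>: "J b t \<le> (m + 1) * \<rho> t" for b t
  proof -
    have "\<kappa> t * F (exp (q * \<Phi> t) * b t) \<le> \<kappa> t * m" using Fm nonneg by (intro mult_left_mono) auto
    moreover have "(m + 1) * \<rho> t = \<kappa> t * m + m * \<phi> t + \<kappa> t + \<phi> t"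
      by (simp add: \<rho>_def algebra_simps)
    ultimately show ?thesis
      unfolding J_def using nonneg[of t] mult_nonneg_nonneg[OF m0 nonneg(2)[of t]] by linarith
  qed
  have Jb: "\<bar>J b t\<bar> \<le> (m + 1) * (2 * C) * exp (d * t)" if "t \<le> 0" for b t
  proof -
    have "(m + 1) * \<rho> t \<le> (m + 1) * (2 * C * exp (d * t))"
      using \<rho>b[OF that] m0 by (intro mult_left_mono) auto
    then show ?thesis using J0[of b t] J\<rho>[of b t] by (simp add: mult.assoc)
  qed
  define A where "A = (\<lambda>b. primitive (J b))"
  define B where "B = (\<lambda>b. primitive (\<lambda>t. exp (n * t) * J b t))"
  have dA: "(A b has_real_derivative J b t) (at t)" and limA: "(A b \<longlongrightarrow> 0) at_bot" for b t
    unfolding A_def by (rule primitive[OF cJ d Jb]; assumption)+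
  have eJb: "\<bar>exp (n * t) * J b t\<bar> \<le> (m + 1) * (2 * C) * exp (d * t)" if "t \<le> 0" for b t
  proof -
    have "exp (n * t) \<le> 1" using that n by (simp add: mult_nonneg_nonpos)
    then have "exp (n * t) * \<bar>J b t\<bar> \<le> 1 * \<bar>J b t\<bar>" by (intro mult_right_mono) auto
    then show ?thesis using Jb[OF that, of b] by (simp add: abs_mult)
  qed
  have ceJ: "continuous_on UNIV (\<lambda>t. exp (n * t) * J b t)" for b
    by (intro continuous_intros cJ)
  have dB: "(B b has_real_derivative exp (n * t) * J b t) (at t)" and limB: "(B b \<longlongrightarrow> 0) at_bot" for b t
    unfolding B_def by (rule primitive[OF ceJ d eJb]; assumption)+
  define v where "v = (\<lambda>b t. - exp (- n * t) * B b t)"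
  have dv: "(v b has_real_derivative - n * v b t - J b t) (at t)" for b t
    unfolding v_def
    by (auto intro!: derivative_eq_intros dB simp: algebra_simps simp flip: exp_add)
  have ev: "exp (n * t) * v b t = - B b t" for b t
    unfolding v_def by (simp add: mult.assoc[symmetric] flip: exp_add)
  have limev: "((\<lambda>t. exp (n * t) * v b t) \<longlongrightarrow> 0) at_bot" for b
    unfolding ev using tendsto_minus[OF limB[of b]] by simp
  have vA: "\<bar>v b t\<bar> \<le> A b t" for b t
    by (rule flux_bound[OF n dv dA _ limev limA]) (use J0 in auto)
  have A\<Phi>: "A b t \<le> (m + 1) * \<Phi> t" for b t
  proof -
    have "\<bar>A b t - 0\<bar> \<le> (m + 1) * \<Phi> t - (m + 1) * 0"
      by (rule abs_le_of_deriv_le[OF dA DERIV_cmult[OF d\<Phi>] _ limA tendsto_mult[OF tendsto_const lim\<Phi>]])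
        (use J0 J\<rho> in auto)
    then show ?thesis by simp
  qed
  define U where "U = (\<lambda>b t. \<zeta> - (A b t + v b t) / n)"
  have dU: "(U b has_real_derivative v b t) (at t)" for b t
    unfolding U_def using n by (auto intro!: derivative_eq_intros dA dv simp: field_simps)
  define T where "T = (\<lambda>b t. exp (- q * \<Phi> t) * U b t)"
  have expT: "exp (q * \<Phi> t) * T b t = U b t" for b t
    unfolding T_def by (simp add: mult.assoc[symmetric] flip: exp_add)
  have TU: "T b t = U b t / exp (q * \<Phi> t)" for b t
    unfolding T_def by (simp add: exp_minus divide_inverse mult.commute)
  have T_bcont: "T b \<in> bcontfun" for b
  proof (rule bcontfun_normI)
    show "continuous_on UNIV (T b)"
      unfolding T_def by (intro continuous_intros c\<Phi> continuous_on_of_DERIV[OF dU])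
    fix t
    have "\<bar>U b t\<bar> \<le> \<zeta> + \<bar>A b t + v b t\<bar> / n"
      unfolding U_def using \<zeta> n abs_triangle_ineq4[of \<zeta> "(A b t + v b t) / n"] by simp
    also have "\<dots> \<le> \<zeta> + 2 * (m + 1) * \<Phi> t / n"
    proof -
      have "\<bar>A b t + v b t\<bar> \<le> 2 * ((m + 1) * \<Phi> t)" using vA[of b t] A\<Phi>[of b t] by linarith
      then show ?thesis using n by (intro add_left_mono divide_right_mono) (auto simp: algebra_simps)
    qed
    also have "\<dots> \<le> (\<zeta> + 2 * (m + 1) / (n * q)) * exp (q * \<Phi> t)"
    proof -
      have "q * \<Phi> t \<le> exp (q * \<Phi> t)" using exp_ge_add_one_self[of "q * \<Phi> t"] by linarith
      then have "\<Phi> t \<le> exp (q * \<Phi> t) / q" using q0 by (simp add: field_simps)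
      then have "2 * (m + 1) / n * \<Phi> t \<le> 2 * (m + 1) / n * (exp (q * \<Phi> t) / q)"
        using m0 n by (intro mult_left_mono) auto
      moreover have "\<zeta> * 1 \<le> \<zeta> * exp (q * \<Phi> t)" using \<zeta> q0 \<Phi>0[of t] by (intro mult_left_mono) auto
      ultimately show ?thesis by (simp add: field_simps)
    qed
    finally have "\<bar>U b t\<bar> / exp (q * \<Phi> t) \<le> \<zeta> + 2 * (m + 1) / (n * q)"
      by (simp only: pos_divide_le_eq[OF exp_gt_zero])
    then show "norm (T b t) \<le> \<zeta> + 2 * (m + 1) / (n * q)"
      by (simp add: TU)
  qed
  define G where "G = (\<lambda>b. Bcontfun (T b))"
  have G: "apply_bcontfun (G b) = T b" for b
    unfolding G_def using T_bcont by (simp add: Bcontfun_inverse)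
  have "\<exists>!b. G b = b"
  proof (rule banach_fix_type[of "1/2"])
    show "\<forall>b c. dist (G b) (G c) \<le> 1 / 2 * dist b c"
    proof (intro allI dist_bound)
      fix b c :: "real \<Rightarrow>\<^sub>C real" and t :: real
      define D where "D = dist b c"
      define Y where "Y = (\<lambda>t. L * D / q * (exp (q * \<Phi> t) - 1))"
      have dY: "(Y has_real_derivative L * D * exp (q * \<Phi> t) * \<rho> t) (at t)" for t
        unfolding Y_def using q0 by (auto intro!: derivative_eq_intros d\<Phi>)
      have e1: "((\<lambda>t. exp (q * \<Phi> t)) \<longlongrightarrow> exp (q * 0)) at_bot"
        by (intro tendsto_intros lim\<Phi>)
      have limY: "(Y \<longlongrightarrow> 0) at_bot"
        unfolding Y_def
        using tendsto_mult[OF tendsto_const[of "L * D / q"] tendsto_diff[OF e1 tendsto_const[of 1]]] by simp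
      have le: "\<bar>J b t - J c t\<bar> \<le> L * D * exp (q * \<Phi> t) * \<rho> t" for t
      proof -
        have "\<bar>J b t - J c t\<bar> = \<kappa> t * \<bar>F (exp (q * \<Phi> t) * b t) - F (exp (q * \<Phi> t) * c t)\<bar>"
          unfolding J_def using nonneg(1)[of t] by (simp add: abs_mult flip: right_diff_distrib)
        also have "\<dots> \<le> \<kappa> t * (L * (exp (q * \<Phi> t) * \<bar>b t - c t\<bar>))"
          using FL[of "exp (q * \<Phi> t) * b t" "exp (q * \<Phi> t) * c t"] nonneg(1)[of t]
          by (intro mult_left_mono) (auto simp: abs_mult simp flip: right_diff_distrib)
        also have "\<dots> \<le> \<rho> t * (L * (exp (q * \<Phi> t) * D))"
          using dist_bounded[of b t c] L0 nonneg[of t] unfolding D_def dist_real_def \<rho>_def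
          by (intro mult_mono mult_left_mono mult_nonneg_nonneg) auto
        finally show ?thesis by (simp add: mult_ac)
      qed
      have dA': "((\<lambda>t. A b t - A c t) has_real_derivative J b t - J c t) (at t)" for t
        by (intro derivative_intros dA)
      have "\<bar>(A b t - A c t) - (0 - 0)\<bar> \<le> Y t - 0"
        by (rule abs_le_of_deriv_le[OF dA' dY le]) (intro tendsto_intros limA limY)+
      moreover have "\<bar>v b t - v c t\<bar> \<le> Y t"
      proof (rule flux_bound[OF n _ dY le _ limY])
        show "((\<lambda>t. v b t - v c t) has_real_derivative - n * (v b r - v c r) - (J b r - J c r)) (at r)" for r
          by (auto intro!: derivative_eq_intros dv simp: algebra_simps)
        show "((\<lambda>t. exp (n * t) * (v b t - v c t)) \<longlongrightarrow> 0) at_bot"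
          using tendsto_diff[OF limev[of b] limev[of c]] by (simp add: algebra_simps)
      qed
      ultimately have "\<bar>(A b t - A c t) + (v b t - v c t)\<bar> \<le> 2 * Y t" by linarith
      moreover have "U b t - U c t = - ((A b t - A c t) + (v b t - v c t)) / n"
        unfolding U_def using n by (simp add: field_simps)
      ultimately have "\<bar>U b t - U c t\<bar> \<le> 2 * Y t / n"
        using n by (simp add: divide_right_mono)
      also have "\<dots> \<le> D / 2 * exp (q * \<Phi> t)"
        unfolding Y_def q_def using L0 n by (simp add: D_def field_simps)
      finally have "\<bar>U b t - U c t\<bar> / exp (q * \<Phi> t) \<le> D / 2"
        by (simp only: pos_divide_le_eq[OF exp_gt_zero])
      moreover have "dist (T b t) (T c t) = \<bar>U b t - U c t\<bar> / exp (q * \<Phi> t)"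
        by (simp add: TU dist_real_def flip: diff_divide_distrib)
      ultimately show "dist (apply_bcontfun (G b) t) (apply_bcontfun (G c) t) \<le> 1 / 2 * dist b c"
        unfolding G D_def by simp
    qed
  qed auto
  then obtain b where "G b = b" by blast
  then have "apply_bcontfun b = T b" using G by metis
  then have fix_U: "exp (q * \<Phi> t) * b t = U b t" for t using expT by simp
  have v0: "v b t \<le> 0" for t
  proof -
    have "0 \<le> B b t" by (rule nonneg_of_deriv_nonneg[OF dB _ limB]) (use J0 in auto)
    then show ?thesis by (simp add: v_def)
  qed
  have limv: "(v b \<longlongrightarrow> 0) at_bot"
    by (rule tendsto_rabs_zero_cancel, rule tendsto_sandwich[OF _ _ tendsto_const limA[of b]])
      (use vA in auto)
  have limU: "(U b \<longlongrightarrow> \<zeta>) at_bot"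
    unfolding U_def using n by (auto intro!: tendsto_eq_intros limA limv)
  have U\<zeta>: "U b t \<le> \<zeta>" for t
    by (rule decreasing_le_limit[where X' = "v b" and X = "U b" and Y = "U b"])
      (use dU v0 limU in auto)
  have "J b t = \<kappa> t * ppow p (U b t) + \<phi> t" for t
    unfolding J_def fix_U F_def using U\<zeta> by (simp add: min_absorb1)
  then have "regular n p \<kappa> \<phi> \<zeta> (U b) (v b)"
    unfolding regular_def using dU dv[of b] limU limv by simp
  then show ?thesis by blast
qed

section \<open>Continuous dependence\<close>

lemma first_hit:
  fixes X :: "real \<Rightarrow> real"
  assumes cont: "continuous_on UNIV X" and neg: "\<And>r. r \<le> T \<Longrightarrow> X r < 0" and t: "0 \<le> X t"
  obtains s where "s \<le> t" "X s = 0" "\<And>r. r < s \<Longrightarrow> X r < 0"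
proof -
  have Tt: "T < t" using neg[of t] t by force
  let ?A = "{T..t} \<inter> {r. 0 \<le> X r}"
  have "closed {r. 0 \<le> X r}"
    by (intro closed_Collect_le continuous_intros cont)
  then have "compact ?A" by (intro compact_Int_closed) auto
  moreover have "t \<in> ?A" using Tt t by auto
  ultimately obtain s where s: "s \<in> ?A" "\<And>r. r \<in> ?A \<Longrightarrow> s \<le> r"
    using compact_attains_inf[of ?A] by blast
  have lt: "X r < 0" if "r < s" for r
  proof (cases "r \<le> T")
    case False
    then show ?thesis using s(2)[of r] that s(1) by force
  qed (use neg in auto)
  have "X s = 0"
  proof -
    have "X T < 0" using neg by simp
    then obtain r where "T \<le> r" "r \<le> s" "X r = 0"
      using IVT'[of X T 0 s] s(1) continuous_on_subset[OF cont] by auto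
    then show ?thesis using lt[of r] by (cases "r = s") auto
  qed
  then show ?thesis using that s(1) lt by auto
qed

text \<open>Both v and v + n d - n d0 are controlled by the same function \<open>Q\<close>, hence
  the factor 2 / n. The bound holds by continuity in t: as long as it is true weakly it is true
  strictly, because \<open>c\<close> exceeds the data strictly, so there is no first time at which
  it fails.\<close>

lemma gronwall:
  fixes d v j \<kappa> \<rho> \<Phi> R :: "real \<Rightarrow> real"
  assumes n: "0 < n" and L: "0 \<le> L"
    and d: "\<And>t. (d has_real_derivative v t) (at t)"
    and v: "\<And>t. (v has_real_derivative - n * v t - j t) (at t)"
    and j: "\<And>t. t \<le> S \<Longrightarrow> \<bar>j t\<bar> \<le> L * \<kappa> t * \<bar>d t\<bar> + \<rho> t"
    and \<Phi>: "\<And>t. (\<Phi> has_real_derivative \<kappa> t) (at t)" "\<And>t. 0 \<le> \<kappa> t" "(\<Phi> \<longlongrightarrow> 0) at_bot"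
    and R: "\<And>t. (R has_real_derivative \<rho> t) (at t)" "\<And>t. 0 \<le> \<rho> t" "(R \<longlongrightarrow> 0) at_bot"
    and lim: "(d \<longlongrightarrow> d0) at_bot" "(v \<longlongrightarrow> 0) at_bot"
    and c: "\<bar>d0\<bar> + 2 / n * R S < c" and t: "t \<le> S"
  shows "\<bar>d t\<bar> < c * exp (2 * L / n * \<Phi> t)"
    and "\<bar>v t\<bar> \<le> n / 2 * (c * exp (2 * L / n * \<Phi> t) - c) + R t"
proof -
  define E where "E = (\<lambda>t. c * exp (2 * L / n * \<Phi> t))"
  define Q where "Q = (\<lambda>t. n / 2 * (E t - c) + R t)"
  have \<Phi>0: "0 \<le> \<Phi> t" for t using nonneg_of_deriv_nonneg[OF \<Phi>] .
  have R0: "0 \<le> R t" for t using nonneg_of_deriv_nonneg[OF R] .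
  have c0: "0 < c" "\<bar>d0\<bar> < c" using c R0[of S] n by (auto intro: le_less_trans[OF _ c])
  have Ec: "c \<le> E t" for t unfolding E_def using c0 \<Phi>0[of t] L n by simp
  have dE: "(E has_real_derivative 2 * L / n * \<kappa> t * E t) (at t)" for t
    unfolding E_def using n by (auto intro!: derivative_eq_intros \<Phi>(1))
  have dQ: "(Q has_real_derivative L * \<kappa> t * E t + \<rho> t) (at t)" for t
    unfolding Q_def using n by (auto intro!: derivative_eq_intros dE R(1))
  have "((\<lambda>t. c * exp (2 * L / n * \<Phi> t)) \<longlongrightarrow> c * exp (2 * L / n * 0)) at_bot"
    by (intro tendsto_intros \<Phi>(3))
  then have limE: "(E \<longlongrightarrow> c) at_bot" by (simp add: E_def)
  then have "((\<lambda>t. n / 2 * (E t - c) + R t) \<longlongrightarrow> n / 2 * (c - c) + 0) at_bot"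
    by (intro tendsto_intros R(3))
  then have limQ: "(Q \<longlongrightarrow> 0) at_bot" by (simp add: Q_def)
  have "((\<lambda>r. exp (n * r) * v r) \<longlongrightarrow> 0 * 0) at_bot"
    by (intro tendsto_mult tendsto_exp_at_bot n lim(2))
  then have limev: "((\<lambda>r. exp (n * r) * v r) \<longlongrightarrow> 0) at_bot" by simp
  have dX: "((\<lambda>t. v t + n * d t) has_real_derivative - j t) (at t)" for t
    by (auto intro!: derivative_eq_intros d v)
  have limX: "((\<lambda>t. v t + n * d t) \<longlongrightarrow> 0 + n * d0) at_bot"
    by (intro tendsto_intros lim)
  have jQ: "\<bar>j r\<bar> \<le> L * \<kappa> r * E r + \<rho> r" if "r \<le> S" "\<bar>d r\<bar> \<le> E r" for r
    using j[OF that(1)] mult_left_mono[OF that(2), of "L * \<kappa> r"] L \<Phi>(2)[of r] by simp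
  have strict: "\<bar>d s\<bar> < E s" if s: "s \<le> S" "\<And>r. r \<le> s \<Longrightarrow> \<bar>d r\<bar> \<le> E r" for s
  proof -
    have j': "\<bar>j r\<bar> \<le> L * \<kappa> r * E r + \<rho> r" if "r \<le> s" for r using jQ that s by force
    have "\<bar>v s\<bar> \<le> Q s" by (rule flux_bound[OF n v dQ j' limev limQ]) auto
    moreover have "\<bar>(v s + n * d s) - (0 + n * d0)\<bar> \<le> Q s - 0"
      by (rule abs_le_of_deriv_le[OF dX dQ _ limX limQ]) (use j' in auto)
    ultimately have "\<bar>n * d s - n * d0\<bar> \<le> 2 * Q s" by linarith
    then have "n * \<bar>d s - d0\<bar> \<le> 2 * Q s" using n by (simp add: abs_mult flip: right_diff_distrib)
    then have "\<bar>d s - d0\<bar> \<le> 2 * Q s / n" using n by (simp add: field_simps)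
    also have "\<dots> = E s - c + 2 / n * R s" unfolding Q_def using n by (simp add: field_simps)
    also have "\<dots> \<le> E s - c + 2 / n * R S"
    proof -
      have "- R S \<le> - R s"
        by (rule DERIV_mono_le[where X' = "\<lambda>r. - \<rho> r"])
          (use s R in \<open>auto intro!: derivative_eq_intros R(1)\<close>)
      then show ?thesis using n by (simp add: divide_right_mono)
    qed
    finally show ?thesis using c by linarith
  qed
  have bound: "\<bar>d s\<bar> < E s" if "s \<le> S" for s
  proof (rule ccontr)
    assume "\<not> \<bar>d s\<bar> < E s"
    then have ge: "0 \<le> \<bar>d s\<bar> - E s" by simp
    have "eventually (\<lambda>r. \<bar>d r\<bar> < c) at_bot"
      by (rule order_tendstoD(2)[OF tendsto_rabs[OF lim(1)] c0(2)])
    then obtain T where T: "\<And>r. r \<le> T \<Longrightarrow> \<bar>d r\<bar> < c"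
      unfolding eventually_at_bot_linorder by blast
    have cont: "continuous_on UNIV (\<lambda>r. \<bar>d r\<bar> - E r)"
      by (intro continuous_intros continuous_on_of_DERIV[OF d] continuous_on_of_DERIV[OF dE])
    have neg: "\<bar>d r\<bar> - E r < 0" if "r \<le> T" for r
      using T[OF that] Ec[of r] by linarith
    obtain s1 where s1: "s1 \<le> s" "\<bar>d s1\<bar> - E s1 = 0" "\<And>r. r < s1 \<Longrightarrow> \<bar>d r\<bar> - E r < 0"
      using first_hit[of "\<lambda>r. \<bar>d r\<bar> - E r" T s] cont neg ge by metis
    have le: "\<bar>d r\<bar> \<le> E r" if "r \<le> s1" for r
      using s1(2) s1(3)[of r] that by (cases "r = s1") auto
    have "s1 \<le> S" using s1(1) \<open>s \<le> S\<close> by simp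
    from strict[OF this le] s1(2) show False by simp
  qed
  show "\<bar>d t\<bar> < c * exp (2 * L / n * \<Phi> t)" using bound[OF t] by (simp add: E_def)
  have "\<bar>v t\<bar> \<le> Q t"
    by (rule flux_bound[OF n v dQ jQ limev limQ]) (use t bound in \<open>force simp: less_imp_le\<close>)+
  then show "\<bar>v t\<bar> \<le> n / 2 * (c * exp (2 * L / n * \<Phi> t) - c) + R t"
    by (simp add: Q_def E_def)
qed

lemma regularD:
  assumes "regular n p \<kappa> \<phi> \<zeta> u v"
  shows "(u has_real_derivative v t) (at t)"
    "(v has_real_derivative - n * v t - (\<kappa> t * ppow p (u t) + \<phi> t)) (at t)"
    "(u \<longlongrightarrow> \<zeta>) at_bot" "(v \<longlongrightarrow> 0) at_bot"
  using assms unfolding regular_def by auto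

text \<open>exp (n t) v is nonincreasing and vanishes at -infinity, so it is nonpositive.\<close>

lemma regular_nonincreasing:
  assumes reg: "regular n p \<kappa> \<phi> \<zeta> u v" and n: "0 < n"
    and nonneg: "\<And>t. 0 \<le> \<kappa> t" "\<And>t. 0 \<le> \<phi> t"
  shows "v t \<le> 0" and "u t \<le> \<zeta>" and "s \<le> t \<Longrightarrow> u t \<le> u s"
proof -
  note r = regularD[OF reg]
  have v0: "v t \<le> 0" for t
  proof -
    have "exp (n * t) * v t \<le> 0"
    proof (rule decreasing_le_limit[where X = "\<lambda>t. exp (n * t) * v t" and t = t
          and X' = "\<lambda>t. - exp (n * t) * (\<kappa> t * ppow p (u t) + \<phi> t)"])
      show "((\<lambda>t. exp (n * t) * v t) has_real_derivative
          - exp (n * t) * (\<kappa> t * ppow p (u t) + \<phi> t)) (at t)" for t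
        by (auto intro!: derivative_eq_intros r simp: algebra_simps)
      show "- exp (n * t) * (\<kappa> t * ppow p (u t) + \<phi> t) \<le> 0" for t
        using nonneg[of t] by (simp add: mult_nonpos_nonneg)
      show "((\<lambda>r. exp (n * r) * v r) \<longlongrightarrow> 0) at_bot"
        using tendsto_mult[OF tendsto_exp_at_bot[OF n] r(4)] by simp
    qed auto
    then show ?thesis by (simp add: mult_le_0_iff)
  qed
  show "v t \<le> 0" by (rule v0)
  show "u t \<le> \<zeta>"
    by (rule decreasing_le_limit[where X' = v and X = u and Y = u]) (use r v0 in auto)
  show "u t \<le> u s" if "s \<le> t"
    by (rule DERIV_mono_le[OF that r(1)]) (use v0 in auto)
qed

text \<open>The difference of two regular solutions obeys \<open>gronwall\<close> without
  inhomogeneous part, with the gap \<zeta> - \<eta> at -infinity. The estimate for \<open>v\<close>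
  is needed because zeros are followed through their slopes.\<close>

lemma regular_C1_dependence:
  fixes u v :: "real \<Rightarrow> real \<Rightarrow> real"
  assumes n: "0 < n" and p: "1 < p"
    and nonneg: "\<And>t. 0 \<le> \<kappa> t" "\<And>t. 0 \<le> \<phi> t"
    and \<Phi>: "\<And>t. (\<Phi> has_real_derivative \<kappa> t) (at t)" "(\<Phi> \<longlongrightarrow> 0) at_bot"
    and reg: "\<And>\<zeta>. 0 < \<zeta> \<Longrightarrow> regular n p \<kappa> \<phi> \<zeta> (u \<zeta>) (v \<zeta>)"
    and \<eta>: "0 < \<eta>" and e: "0 < e"
  shows "\<exists>\<delta>>0. \<forall>\<zeta>>0. \<bar>\<zeta> - \<eta>\<bar> < \<delta> \<longrightarrow>
           (\<forall>t\<le>S. \<bar>u \<zeta> t - u \<eta> t\<bar> < e \<and> \<bar>v \<zeta> t - v \<eta> t\<bar> < e)"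
proof -
  define L where "L = p * (2 * \<eta>) powr (p - 1)"
  define G where "G = exp (2 * L / n * \<Phi> S)"
  \<comment> \<open>The first bound keeps both solutions below 2 \<eta>, where \<open>L\<close> is a
    Lipschitz constant. The second makes \<delta> G as well as n \<delta> G / 2 smaller than
    e.\<close>
  define \<delta> where "\<delta> = min \<eta> (e / ((1 + n) * G))"
  have L0: "0 \<le> L" using p by (simp add: L_def)
  have G0: "0 < G" by (simp add: G_def)
  have d0: "0 < \<delta>" using \<eta> e n G0 by (simp add: \<delta>_def)
  have "\<bar>u \<zeta> t - u \<eta> t\<bar> < e \<and> \<bar>v \<zeta> t - v \<eta> t\<bar> < e" if \<zeta>: "0 < \<zeta>" "\<bar>\<zeta> - \<eta>\<bar> < \<delta>" and t: "t \<le> S" for \<zeta> t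
  proof -
    note r1 = regularD[OF reg[OF \<zeta>(1)]] and r2 = regularD[OF reg[OF \<eta>]]
    have le: "u \<zeta> t \<le> 2 * \<eta>" "u \<eta> t \<le> 2 * \<eta>" for t
      using regular_nonincreasing(2)[OF reg[OF \<zeta>(1)] n nonneg, of t]
        regular_nonincreasing(2)[OF reg[OF \<eta>] n nonneg, of t] \<zeta> \<eta>
      by (auto simp: \<delta>_def)
    have dd: "((\<lambda>t. u \<zeta> t - u \<eta> t) has_real_derivative v \<zeta> t - v \<eta> t) (at t)" for t
      by (intro derivative_intros r1 r2)
    have dv: "((\<lambda>t. v \<zeta> t - v \<eta> t) has_real_derivative
        - n * (v \<zeta> t - v \<eta> t) - \<kappa> t * (ppow p (u \<zeta> t) - ppow p (u \<eta> t))) (at t)" for t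
      by (auto intro!: derivative_eq_intros r1 r2 simp: algebra_simps)
    have j: "\<bar>\<kappa> t * (ppow p (u \<zeta> t) - ppow p (u \<eta> t))\<bar> \<le> L * \<kappa> t * \<bar>u \<zeta> t - u \<eta> t\<bar> + 0" for t
      using mult_left_mono[OF ppow_lipschitz[OF p le[of t]] nonneg(1)[of t]] \<eta> nonneg(1)[of t]
      by (simp add: abs_mult L_def mult_ac)
    have c: "\<bar>\<zeta> - \<eta>\<bar> + 2 / n * 0 < \<delta>" using \<zeta> by simp
    have lims: "((\<lambda>t. u \<zeta> t - u \<eta> t) \<longlongrightarrow> \<zeta> - \<eta>) at_bot" "((\<lambda>t. v \<zeta> t - v \<eta> t) \<longlongrightarrow> 0) at_bot"
      using tendsto_diff[OF r1(3) r2(3)] tendsto_diff[OF r1(4) r2(4)] by simp_all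
    have "\<bar>u \<zeta> t - u \<eta> t\<bar> < \<delta> * exp (2 * L / n * \<Phi> t)"
      "\<bar>v \<zeta> t - v \<eta> t\<bar> \<le> n / 2 * (\<delta> * exp (2 * L / n * \<Phi> t) - \<delta>) + 0"
      using gronwall[where R = "\<lambda>_. 0" and \<rho> = "\<lambda>_. 0", OF n L0 dd dv j \<Phi>(1) nonneg(1) \<Phi>(2) _ _ _ lims c t]
      by auto
    moreover have "exp (2 * L / n * \<Phi> t) \<le> G"
    proof -
      have "- \<Phi> S \<le> - \<Phi> t"
        by (rule DERIV_mono_le[where X' = "\<lambda>r. - \<kappa> r"])
          (use t nonneg in \<open>auto intro!: derivative_eq_intros \<Phi>(1)\<close>)
      then show ?thesis unfolding G_def using L0 n by (auto intro!: mult_left_mono divide_right_mono)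
    qed
    then have "\<delta> * exp (2 * L / n * \<Phi> t) \<le> \<delta> * G" using d0 by (intro mult_left_mono) auto
    moreover have dG: "\<delta> * G * (1 + n) \<le> e"
    proof -
      have "\<delta> \<le> e / ((1 + n) * G)" by (simp add: \<delta>_def)
      moreover have "0 < (1 + n) * G" using n G0 by simp
      ultimately show ?thesis using pos_le_divide_eq[of "(1 + n) * G" \<delta> e] by (simp add: mult_ac)
    qed
    moreover have "0 < \<delta> * G * n" "0 < \<delta> * G" using d0 G0 n by auto
    ultimately have 1: "\<bar>u \<zeta> t - u \<eta> t\<bar> < e" and
      2: "\<bar>v \<zeta> t - v \<eta> t\<bar> \<le> n / 2 * (\<delta> * exp (2 * L / n * \<Phi> t) - \<delta>)"
      by (auto simp: distrib_left)
    have "n / 2 * (\<delta> * exp (2 * L / n * \<Phi> t) - \<delta>) \<le> n / 2 * (\<delta> * G)"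
      using \<open>\<delta> * exp (2 * L / n * \<Phi> t) \<le> \<delta> * G\<close> d0 n by (intro mult_left_mono; linarith)
    also have "\<dots> < e"
    proof -
      have "\<delta> * G + \<delta> * G * n \<le> e" using dG by (simp only: distrib_left mult_1_right)
      moreover have "n / 2 * (\<delta> * G) = \<delta> * G * n / 2" by simp
      ultimately show ?thesis using \<open>0 < \<delta> * G * n\<close> \<open>0 < \<delta> * G\<close> by linarith
    qed
    finally show ?thesis using 1 2 by simp
  qed
  then show ?thesis using d0 by blast
qed

section \<open>Simple zeros and oscillation\<close>

lemma zero_of_deriv_ge:
  fixes h h' :: "real \<Rightarrow> real"
  assumes h: "\<And>t. (h has_real_derivative h' t) (at t)" and r: "0 < r"
    and ge: "\<And>t. \<bar>t - \<sigma>\<bar> \<le> r \<Longrightarrow> c \<le> h' t" and small: "\<bar>h \<sigma>\<bar> < c * r"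
  shows "\<exists>\<tau>. \<bar>\<tau> - \<sigma>\<bar> \<le> r \<and> h \<tau> = 0"
proof -
  have "c * (\<sigma> + r) - h (\<sigma> + r) \<le> c * \<sigma> - h \<sigma>"
    by (rule DERIV_mono_le[where X = "\<lambda>t. c * t - h t" and X' = "\<lambda>t. c - h' t"])
      (use r ge in \<open>auto intro!: derivative_eq_intros h\<close>)
  moreover have "c * \<sigma> - h \<sigma> \<le> c * (\<sigma> - r) - h (\<sigma> - r)"
    by (rule DERIV_mono_le[where X = "\<lambda>t. c * t - h t" and X' = "\<lambda>t. c - h' t"])
      (use r ge in \<open>auto intro!: derivative_eq_intros h\<close>)
  ultimately have "h (\<sigma> - r) \<le> 0" "0 \<le> h (\<sigma> + r)"
    using small by (auto simp: algebra_simps)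
  then obtain \<tau> where "\<sigma> - r \<le> \<tau>" "\<tau> \<le> \<sigma> + r" "h \<tau> = 0"
    using IVT'[of h "\<sigma> - r" 0 "\<sigma> + r"] r continuous_on_of_DERIV[OF h] by auto
  then show ?thesis by (intro exI[of _ \<tau>]) auto
qed

lemma zero_of_abs_deriv_ge:
  fixes h h' :: "real \<Rightarrow> real"
  assumes h: "\<And>t. (h has_real_derivative h' t) (at t)" and r: "0 < r"
    and ge: "(\<forall>t. \<bar>t - \<sigma>\<bar> \<le> r \<longrightarrow> c \<le> h' t) \<or> (\<forall>t. \<bar>t - \<sigma>\<bar> \<le> r \<longrightarrow> h' t \<le> - c)"
    and small: "\<bar>h \<sigma>\<bar> < c * r"
  shows "\<exists>\<tau>. \<bar>\<tau> - \<sigma>\<bar> \<le> r \<and> h \<tau> = 0"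
  using ge
proof
  assume "\<forall>t. \<bar>t - \<sigma>\<bar> \<le> r \<longrightarrow> c \<le> h' t"
  then show ?thesis by (intro zero_of_deriv_ge[OF h r _ small]) auto
next
  assume *: "\<forall>t. \<bar>t - \<sigma>\<bar> \<le> r \<longrightarrow> h' t \<le> - c"
  have "\<exists>\<tau>. \<bar>\<tau> - \<sigma>\<bar> \<le> r \<and> - h \<tau> = 0"
    by (rule zero_of_deriv_ge[where h' = "\<lambda>t. - h' t" and c = c])
      (use r small * in \<open>auto intro!: derivative_eq_intros h\<close>)
  then show ?thesis by simp
qed

lemma finite_of_separated:
  fixes Z :: "real set"
  assumes "0 < \<rho>" "Z \<subseteq> {a..b}" and sep: "\<And>x y. x \<in> Z \<Longrightarrow> y \<in> Z \<Longrightarrow> x < y \<Longrightarrow> \<rho> \<le> y - x"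
  shows "finite Z"
proof (rule inj_on_finite)
  show "inj_on (\<lambda>x. \<lfloor>x / \<rho>\<rfloor>) Z"
  proof (rule linorder_inj_onI)
    fix x y assume xy: "x < y" "x \<in> Z" "y \<in> Z"
    have "(x + \<rho>) / \<rho> \<le> y / \<rho>"
      using sep[OF xy(2,3,1)] assms(1) by (intro divide_right_mono) auto
    then have "x / \<rho> + 1 \<le> y / \<rho>" using assms(1) by (simp add: add_divide_distrib)
    then show "\<lfloor>x / \<rho>\<rfloor> \<noteq> \<lfloor>y / \<rho>\<rfloor>" by linarith
  qed auto
  show "(\<lambda>x. \<lfloor>x / \<rho>\<rfloor>) ` Z \<subseteq> {\<lfloor>a / \<rho>\<rfloor>..\<lfloor>b / \<rho>\<rfloor>}"
  proof safe
    fix x assume "x \<in> Z"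
    then have "a \<le> x" "x \<le> b" using assms(2) by auto
    then show "\<lfloor>x / \<rho>\<rfloor> \<in> {\<lfloor>a / \<rho>\<rfloor>..\<lfloor>b / \<rho>\<rfloor>}"
      using assms(1) by (auto intro!: floor_mono divide_right_mono)
  qed
qed auto

text \<open>Simplicity gives a positive lower bound \<eta> of max |f| |f'| on a compact interval. So
  every function C1-close to f has, around each zero of any other such function, a slope of fixed
  sign and size at least \<eta> / 4. The relation \<open>near\<close> treats all these functions
  alike, f included, so one inequality between the counts suffices.\<close>

lemma simple_zeros_stable:
  fixes f f' :: "real \<Rightarrow> real"
  assumes f: "\<And>t. (f has_real_derivative f' t) (at t)" and cont: "continuous_on UNIV f'"
    and simple: "\<And>t. f t = 0 \<Longrightarrow> f' t \<noteq> 0"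
    and fz: "{t. f t = 0} \<subseteq> {a..b}" and ab: "a \<le> b"
  shows "\<exists>e>0. \<forall>g g'. (\<forall>t. (g has_real_derivative g' t) (at t)) \<longrightarrow>
     (\<forall>t\<in>{a - 1..b + 1}. \<bar>g t - f t\<bar> < e \<and> \<bar>g' t - f' t\<bar> < e) \<longrightarrow> {t. g t = 0} \<subseteq> {a..b} \<longrightarrow>
     finite {t. g t = 0} \<and> card {t. g t = 0} = card {t. f t = 0}"
proof -
  \<comment> \<open>The extra unit on both sides keeps the \<rho>-neighbourhood of every zero inside
    the interval, as \<rho> \<le> 1.\<close>
  let ?I = "{a - 1..b + 1}"
  have "continuous_on ?I (\<lambda>t. max \<bar>f t\<bar> \<bar>f' t\<bar>)"
    by (intro continuous_intros continuous_on_of_DERIV[OF f] continuous_on_subset[OF cont]) auto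
  then obtain s where s: "s \<in> ?I" "\<And>t. t \<in> ?I \<Longrightarrow> max \<bar>f s\<bar> \<bar>f' s\<bar> \<le> max \<bar>f t\<bar> \<bar>f' t\<bar>"
    using continuous_attains_inf[of ?I "\<lambda>t. max \<bar>f t\<bar> \<bar>f' t\<bar>"] ab by auto
  define \<eta> where "\<eta> = max \<bar>f s\<bar> \<bar>f' s\<bar>"
  have \<eta>: "0 < \<eta>" using simple[of s] by (auto simp: \<eta>_def max_def)
  have "uniformly_continuous_on ?I f'"
    by (intro compact_uniformly_continuous continuous_on_subset[OF cont]) auto
  then obtain \<rho>0 where \<rho>0: "0 < \<rho>0"
    "\<And>x y. x \<in> ?I \<Longrightarrow> y \<in> ?I \<Longrightarrow> dist x y < \<rho>0 \<Longrightarrow> dist (f' x) (f' y) < \<eta> / 2"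
    unfolding uniformly_continuous_on_def using \<eta> by (metis half_gt_zero)
  define \<rho> where "\<rho> = min \<rho>0 1"
  have \<rho>: "0 < \<rho>" "\<rho> \<le> 1" using \<rho>0 by (auto simp: \<rho>_def)
  \<comment> \<open>The first bound keeps slopes within 3 \<eta> / 4 of f' at the zero. The second
    makes |h| at a zero of g less than 2 e \<le> (\<eta> / 4) (\<rho> / 4), the rise that slope
    \<eta> / 4 achieves over the distance \<rho> / 4.\<close>
  define e where "e = min (\<eta> / 4) (\<eta> * \<rho> / 32)"
  have e: "0 < e" "e \<le> \<eta> / 4" "e \<le> \<eta> * \<rho> / 32" using \<eta> \<rho> by (auto simp: e_def)
  define near where "near = (\<lambda>g g'. (\<forall>t. (g has_real_derivative g' t) (at t)) \<and>
     (\<forall>t\<in>?I. \<bar>g t - f t\<bar> < e \<and> \<bar>g' t - f' t\<bar> < e) \<and> {t. g t = 0} \<subseteq> {a..b})"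
  have sgn: "(\<forall>t. \<bar>t - \<sigma>\<bar> < \<rho> \<longrightarrow> \<eta> / 4 \<le> h' t) \<or> (\<forall>t. \<bar>t - \<sigma>\<bar> < \<rho> \<longrightarrow> h' t \<le> - (\<eta> / 4))"
    if g: "near g g'" "g \<sigma> = 0" and h: "near h h'" for g g' h h' \<sigma>
  proof -
    have \<sigma>: "\<sigma> \<in> {a..b}" using g unfolding near_def by auto
    then have "\<bar>g \<sigma> - f \<sigma>\<bar> < e" using g(1) unfolding near_def by auto
    then have "\<bar>f \<sigma>\<bar> < e" using g(2) by simp
    then have large: "\<eta> \<le> \<bar>f' \<sigma>\<bar>" using s(2)[of \<sigma>] \<sigma> e \<eta> unfolding \<eta>_def[symmetric] by auto
    have close: "\<bar>h' t - f' \<sigma>\<bar> < 3 * \<eta> / 4" if "\<bar>t - \<sigma>\<bar> < \<rho>" for t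
    proof -
      have t: "t \<in> ?I" using that \<sigma> \<rho> by auto
      have "\<bar>f' t - f' \<sigma>\<bar> < \<eta> / 2"
        using \<rho>0(2)[of t \<sigma>] t \<sigma> that by (auto simp: dist_real_def \<rho>_def)
      moreover have "\<bar>h' t - f' t\<bar> < e" using h t unfolding near_def by auto
      ultimately show ?thesis using e by linarith
    qed
    show ?thesis
    proof (cases "0 \<le> f' \<sigma>")
      case True
      have "\<eta> / 4 \<le> h' t" if "\<bar>t - \<sigma>\<bar> < \<rho>" for t
        using close[OF that] large True by linarith
      then show ?thesis by blast
    next
      case False
      have "h' t \<le> - (\<eta> / 4)" if "\<bar>t - \<sigma>\<bar> < \<rho>" for t
        using close[OF that] large False by linarith
      then show ?thesis by blast
    qed
  qed
  have sep: "\<rho> \<le> y - x" if g: "near g g'" "g x = 0" "g y = 0" "x < y" for g g' x y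
  proof (rule ccontr)
    assume "\<not> \<rho> \<le> y - x"
    have dg: "\<And>t. (g has_real_derivative g' t) (at t)" using g unfolding near_def by auto
    obtain z where "x < z" "z < y" "g y - g x = (y - x) * g' z"
      using MVT2[OF \<open>x < y\<close>, of g g'] dg by blast
    then have "g' z = 0" "\<bar>z - x\<bar> < \<rho>" using g \<open>\<not> \<rho> \<le> y - x\<close> by auto
    then show False using sgn[OF g(1,2) g(1)] \<eta> by force
  qed
  have fin: "finite {t. g t = 0}" if g: "near g g'" for g g'
    by (rule finite_of_separated[OF \<rho>(1), of _ a b]) (use g sep[OF g] in \<open>auto simp: near_def\<close>)
  have le: "card {t. g t = 0} \<le> card {t. h t = 0}" if g: "near g g'" and h: "near h h'" for g g' h h'
  proof -
    have "\<exists>\<tau>. \<bar>\<tau> - \<sigma>\<bar> \<le> \<rho> / 4 \<and> h \<tau> = 0" if \<sigma>: "g \<sigma> = 0" for \<sigma>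
    proof (rule zero_of_abs_deriv_ge[where c = "\<eta> / 4" and h' = h'])
      have "\<sigma> \<in> {a..b}" using g \<sigma> unfolding near_def by auto
      then have "\<bar>g \<sigma> - f \<sigma>\<bar> < e" "\<bar>h \<sigma> - f \<sigma>\<bar> < e" using g h unfolding near_def by auto
      then have "\<bar>h \<sigma>\<bar> < 2 * e" using \<sigma> by linarith
      then show "\<bar>h \<sigma>\<bar> < \<eta> / 4 * (\<rho> / 4)" using e by simp
      show "(\<forall>t. \<bar>t - \<sigma>\<bar> \<le> \<rho> / 4 \<longrightarrow> \<eta> / 4 \<le> h' t) \<or> (\<forall>t. \<bar>t - \<sigma>\<bar> \<le> \<rho> / 4 \<longrightarrow> h' t \<le> - (\<eta> / 4))"
        using sgn[OF g \<sigma> h] \<rho> by force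
    qed (use h \<rho> in \<open>auto simp: near_def\<close>)
    then obtain c where c: "\<And>\<sigma>. g \<sigma> = 0 \<Longrightarrow> \<bar>c \<sigma> - \<sigma>\<bar> \<le> \<rho> / 4 \<and> h (c \<sigma>) = 0"
      by metis
    \<comment> \<open>Zeros of g are at least \<rho> apart and each is moved by at most \<rho> / 4,
      so no two of them collide.\<close>
    have "inj_on c {t. g t = 0}"
    proof (rule linorder_inj_onI)
      fix x y assume xy: "x < y" "x \<in> {t. g t = 0}" "y \<in> {t. g t = 0}"
      then have "\<rho> \<le> y - x" using sep[OF g] by auto
      moreover have "\<bar>c x - x\<bar> \<le> \<rho> / 4" "\<bar>c y - y\<bar> \<le> \<rho> / 4" using c xy by auto
      ultimately show "c x \<noteq> c y" using \<rho> xy by linarith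
    qed auto
    then show ?thesis by (rule card_inj_on_le) (use c fin[OF h] in auto)
  qed
  have nf: "near f f'" unfolding near_def using f e fz by auto
  have "finite {t. g t = 0} \<and> card {t. g t = 0} = card {t. f t = 0}" if "near g g'" for g g'
    using fin[OF that] le[OF that nf] le[OF nf that] by simp
  then show ?thesis using e(1) unfolding near_def by blast
qed

text \<open>Simple zeros persist under C1-small changes, and \<open>bd\<close> keeps them from
  escaping to infinity; so the count is locally constant, hence constant on a connected parameter
  set.\<close>

lemma zero_count_constant:
  fixes Z Z' :: "real \<Rightarrow> real \<Rightarrow> real"
  assumes I: "connected I"
    and Z: "\<And>\<zeta> t. \<zeta> \<in> I \<Longrightarrow> (Z \<zeta> has_real_derivative Z' \<zeta> t) (at t)"
    and cont: "\<And>\<zeta>. \<zeta> \<in> I \<Longrightarrow> continuous_on UNIV (Z' \<zeta>)"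
    and simple: "\<And>\<zeta> t. \<zeta> \<in> I \<Longrightarrow> Z \<zeta> t = 0 \<Longrightarrow> Z' \<zeta> t \<noteq> 0"
    and C1: "\<And>\<eta> S e. \<eta> \<in> I \<Longrightarrow> 0 < e \<Longrightarrow> \<exists>\<delta>>0. \<forall>\<zeta>\<in>I. \<bar>\<zeta> - \<eta>\<bar> < \<delta> \<longrightarrow>
        (\<forall>t\<le>S. \<bar>Z \<zeta> t - Z \<eta> t\<bar> < e \<and> \<bar>Z' \<zeta> t - Z' \<eta> t\<bar> < e)"
    and bd: "\<And>\<eta>. \<eta> \<in> I \<Longrightarrow> \<exists>a b. \<exists>\<delta>>0. \<forall>\<zeta>\<in>I. \<bar>\<zeta> - \<eta>\<bar> < \<delta> \<longrightarrow> {t. Z \<zeta> t = 0} \<subseteq> {a..b}"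
    and \<zeta>: "\<zeta> \<in> I" "\<eta> \<in> I"
  shows "finite {t. Z \<zeta> t = 0}" "card {t. Z \<zeta> t = 0} = card {t. Z \<eta> t = 0}"
proof -
  have loc: "\<exists>\<delta>>0. \<forall>\<zeta>\<in>I. \<bar>\<zeta> - \<eta>\<bar> < \<delta> \<longrightarrow> finite {t. Z \<zeta> t = 0} \<and> card {t. Z \<zeta> t = 0} = card {t. Z \<eta> t = 0}"
    if \<eta>: "\<eta> \<in> I" for \<eta>
  proof -
    obtain a b \<delta>1 where d1: "0 < \<delta>1" "\<And>\<zeta>. \<zeta> \<in> I \<Longrightarrow> \<bar>\<zeta> - \<eta>\<bar> < \<delta>1 \<Longrightarrow> {t. Z \<zeta> t = 0} \<subseteq> {a..b}"
      using bd[OF \<eta>] by blast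
    define b' where "b' = max a b"
    have sub: "{t. Z \<zeta> t = 0} \<subseteq> {a..b'}" if "\<zeta> \<in> I" "\<bar>\<zeta> - \<eta>\<bar> < \<delta>1" for \<zeta>
      using d1(2)[OF that] by (auto simp: b'_def)
    have "\<exists>e>0. \<forall>g g'. (\<forall>t. (g has_real_derivative g' t) (at t)) \<longrightarrow>
     (\<forall>t\<in>{a - 1..b' + 1}. \<bar>g t - Z \<eta> t\<bar> < e \<and> \<bar>g' t - Z' \<eta> t\<bar> < e) \<longrightarrow> {t. g t = 0} \<subseteq> {a..b'} \<longrightarrow>
     finite {t. g t = 0} \<and> card {t. g t = 0} = card {t. Z \<eta> t = 0}"
      by (rule simple_zeros_stable) (use Z cont simple \<eta> sub[OF \<eta>] d1 in \<open>auto simp: b'_def\<close>)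
    then obtain e where e: "0 < e" "\<And>g g'. (\<forall>t. (g has_real_derivative g' t) (at t)) \<Longrightarrow>
     (\<forall>t\<in>{a - 1..b' + 1}. \<bar>g t - Z \<eta> t\<bar> < e \<and> \<bar>g' t - Z' \<eta> t\<bar> < e) \<Longrightarrow> {t. g t = 0} \<subseteq> {a..b'} \<Longrightarrow>
     finite {t. g t = 0} \<and> card {t. g t = 0} = card {t. Z \<eta> t = 0}"
      by blast
    obtain \<delta>2 where d2: "0 < \<delta>2" "\<And>\<zeta> t. \<zeta> \<in> I \<Longrightarrow> \<bar>\<zeta> - \<eta>\<bar> < \<delta>2 \<Longrightarrow> t \<le> b' + 1 \<Longrightarrow>
        \<bar>Z \<zeta> t - Z \<eta> t\<bar> < e \<and> \<bar>Z' \<zeta> t - Z' \<eta> t\<bar> < e"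
      using C1[OF \<eta> e(1), of "b' + 1"] by blast
    have "finite {t. Z \<zeta> t = 0} \<and> card {t. Z \<zeta> t = 0} = card {t. Z \<eta> t = 0}"
      if "\<zeta> \<in> I" "\<bar>\<zeta> - \<eta>\<bar> < min \<delta>1 \<delta>2" for \<zeta>
      by (rule e(2)[of "Z \<zeta>" "Z' \<zeta>"]) (use Z sub d2(2) that in auto)
    then show ?thesis using d1(1) d2(1) by (intro exI[of _ "min \<delta>1 \<delta>2"]) auto
  qed
  show "finite {t. Z \<zeta> t = 0}" using loc[OF \<zeta>(1)] \<zeta>(1) by (metis abs_zero diff_self)
  show "card {t. Z \<zeta> t = 0} = card {t. Z \<eta> t = 0}"
  proof (rule connected_local_const[OF I \<zeta>])
    show "\<forall>x\<in>I. \<forall>\<^sub>F y in at x within I. card {t. Z x t = 0} = card {t. Z y t = 0}"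
    proof
      fix x assume "x \<in> I"
      then obtain \<delta> where "0 < \<delta>" "\<And>y. y \<in> I \<Longrightarrow> \<bar>y - x\<bar> < \<delta> \<Longrightarrow> card {t. Z y t = 0} = card {t. Z x t = 0}"
        using loc by blast
      then show "\<forall>\<^sub>F y in at x within I. card {t. Z x t = 0} = card {t. Z y t = 0}"
        unfolding eventually_at by (intro exI[of _ \<delta>]) (auto simp: dist_real_def)
    qed
  qed
qed

text \<open>The factor exp (a t / 2) removes the damping; what remains is Sturm's comparison with
  y'' + \<omega>^2 y = 0 on one half-wave.\<close>

lemma sturm_oscillation:
  fixes z z1 z2 :: "real \<Rightarrow> real"
  assumes w: "0 < \<omega>"
    and z: "\<And>t. (z has_real_derivative z1 t) (at t)" "\<And>t. (z1 has_real_derivative z2 t) (at t)"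
    and le: "\<And>t. s \<le> t \<Longrightarrow> t \<le> s + pi / \<omega> \<Longrightarrow> 0 < z t \<Longrightarrow> z2 t \<le> - a * z1 t - (\<omega>\<^sup>2 + a\<^sup>2 / 4) * z t"
  shows "\<exists>t. s \<le> t \<and> t \<le> s + pi / \<omega> \<and> z t \<le> 0"
proof (rule ccontr)
  assume "\<not> ?thesis"
  then have pos: "0 < z t" if "s \<le> t" "t \<le> s + pi / \<omega>" for t using that by force
  \<comment> \<open>The Wronskian of exp (a t / 2) z and sin (\<omega> (t - s)), up to sign. While z
    is positive it cannot increase, yet it is negative at the left end of the half-wave and positive
    at the right end.\<close>
  define X where "X = (\<lambda>t. exp (a / 2 * t) * ((z1 t + a / 2 * z t) * sin (\<omega> * (t - s)) - \<omega> * z t * cos (\<omega> * (t - s))))"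
  define X' where "X' = (\<lambda>t. exp (a / 2 * t) * sin (\<omega> * (t - s)) * (z2 t + a * z1 t + (\<omega>\<^sup>2 + a\<^sup>2 / 4) * z t))"
  have dX: "(X has_real_derivative X' t) (at t)" for t
    unfolding X_def X'_def
    by (auto intro!: derivative_eq_intros z simp: field_simps power2_eq_square)
  have pw: "0 < pi / \<omega>" using w by simp
  have "X (s + pi / \<omega>) \<le> X s"
  proof (rule DERIV_mono_le[OF _ dX])
    fix t assume t: "s \<le> t" "t \<le> s + pi / \<omega>"
    have "0 \<le> \<omega> * (t - s)" "\<omega> * (t - s) \<le> pi" using t w by (auto simp: field_simps)
    then have "0 \<le> sin (\<omega> * (t - s))" by (rule sin_ge_zero)
    moreover have "z2 t + a * z1 t + (\<omega>\<^sup>2 + a\<^sup>2 / 4) * z t \<le> 0" using le[OF t pos[OF t]] by simp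
    ultimately show "X' t \<le> 0" unfolding X'_def by (intro mult_nonneg_nonpos) auto
  qed (use pw in auto)
  moreover have "X s < 0" unfolding X_def using pos[of s] pw w by (auto intro!: mult_pos_pos)
  moreover have "0 < X (s + pi / \<omega>)"
    unfolding X_def using pos[of "s + pi / \<omega>"] pw w by (auto intro!: mult_pos_pos)
  ultimately show False by linarith
qed

section \<open>A Lyapunov function for the Emden--Fowler equation\<close>

lemma compact_pos_min:
  fixes f :: "'a::topological_space \<Rightarrow> real"
  assumes "compact C" "continuous_on C f" "\<And>x. x \<in> C \<Longrightarrow> 0 < f x"
  shows "\<exists>\<eta>>0. \<forall>x\<in>C. \<eta> \<le> f x"
proof (cases "C = {}")
  case False
  then obtain x where "x \<in> C" "\<And>y. y \<in> C \<Longrightarrow> f x \<le> f y"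
    using continuous_attains_inf[OF assms(1) _ assms(2)] by blast
  then show ?thesis using assms(3) by blast
qed (auto intro: exI[of _ 1])

locale emden_fowler =
  fixes a b k0 p W0 W1 :: real
  assumes pos: "0 < a" "0 < b" "0 < k0" "1 < p" "0 < W0" "0 < W1"
begin

text \<open>\<open>h\<close> is the nonlinearity of \<open>w'' + a w' + h(w) = 0\<close>, \<open>A\<close> its positive zero and \<open>V\<close> its potential. The cross
  term \<open>c x h(w)\<close> makes the energy \<open>L\<close> decrease at rate at least a multiple of \<open>D\<close>, which vanishes only at equilibria.\<close>

definition "h w = k0 * w powr p - b * w"
definition "V w = k0 * w powr (p + 1) / (p + 1) - b * w\<^sup>2 / 2"
definition "A = (b / k0) powr (1 / (p - 1))"
text \<open>Bounds on the region 0 < w \<le> W0, |x| \<le> W1: \<open>H0\<close> for |h|,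
  \<open>H1\<close> for h' + b, \<open>KE\<close> for the factor of the error term in the derivative
  of \<open>L\<close>, and \<open>KD\<close> for the speed of \<open>D\<close> when the error is at
  most 1.\<close>

definition "H0 = k0 * W0 powr p + b * W0"
definition "H1 = p * k0 * W0 powr (p - 1)"
definition "c = a / (2 * H1 + a\<^sup>2)"
definition "L w x = x\<^sup>2 / 2 + V w + c * x * h w"
definition "D w x = x\<^sup>2 + (h w)\<^sup>2"
definition "rate = min (a / 2) (c / 2)"
definition "KE = W1 + c * H0"
definition "KD = 2 * W1 * (a * W1 + H0 + 1) + 2 * H0 * (H1 + b) * W1"

text \<open>The force \<open>e\<close> collects what separates the actual equation from the
  autonomous one. For t < s the condition is empty, which is why \<open>s\<close> can be left
  unrestricted in statements about all early times.\<close>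

definition traj :: "real \<Rightarrow> real \<Rightarrow> real \<Rightarrow> (real \<Rightarrow> real) \<Rightarrow> (real \<Rightarrow> real) \<Rightarrow> (real \<Rightarrow> real) \<Rightarrow> bool" where
  "traj eps s t w x e \<longleftrightarrow> (\<forall>r\<in>{s..t}. (w has_real_derivative x r) (at r) \<and>
     (x has_real_derivative - a * x r - h (w r) + e r) (at r) \<and>
     0 < w r \<and> w r \<le> W0 \<and> \<bar>x r\<bar> \<le> W1 \<and> \<bar>e r\<bar> \<le> eps)"

lemma A_pos: "0 < A"
  using pos by (simp add: A_def)

lemma A_powr: "k0 * A powr (p - 1) = b"
  using pos by (simp add: A_def powr_powr)

lemma h_zero: "0 \<le> w \<Longrightarrow> h w = 0 \<Longrightarrow> w = 0 \<or> w = A"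
proof -
  assume w: "0 \<le> w" "h w = 0"
  show ?thesis
  proof (cases "w = 0")
    case False
    then have w0: "0 < w" using w by simp
    have "w powr p = w powr (p - 1) * w powr 1"
      unfolding powr_add[symmetric] by simp
    then have "w * (k0 * w powr (p - 1) - b) = 0"
      using w w0 unfolding h_def by (simp add: algebra_simps)
    then have "w powr (p - 1) = b / k0" using w0 pos by (simp add: field_simps)
    then have "(w powr (p - 1)) powr (1 / (p - 1)) = A" by (simp add: A_def)
    then have "w = A" using w0 pos by (simp add: powr_powr)
    then show ?thesis by simp
  qed simp
qed

text \<open>\<open>L\<close> is 0 at the equilibrium (0, 0) and \<open>V A\<close> at (A, 0), so the
  sign of \<open>L\<close> tells the two equilibria apart.\<close>

lemma V_A: "V A < 0"
proof -
  have "A powr (p + 1) = A powr (p - 1) * A powr 2"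
    unfolding powr_add[symmetric] by (simp add: add.commute)
  also have "\<dots> = A powr (p - 1) * A\<^sup>2" using A_pos by (simp add: powr_numeral)
  finally have "V A = (k0 * A powr (p - 1)) * A\<^sup>2 / (p + 1) - b * A\<^sup>2 / 2"
    by (simp add: V_def)
  also have "\<dots> = b * A\<^sup>2 * (1 / (p + 1) - 1 / 2)"
    by (simp add: A_powr algebra_simps)
  also have "\<dots> < 0"
    using pos A_pos by (intro mult_pos_neg) (auto simp: field_simps)
  finally show ?thesis .
qed

lemma V_0 [simp]: "V 0 = 0" and h_0 [simp]: "h 0 = 0"
  using pos by (auto simp: V_def h_def)

lemma H_pos: "0 < H0" "0 < H1" "0 < c" "0 < rate" "0 < KE" "0 < KD"
proof -
  show H0: "0 < H0" using pos by (auto simp: H0_def intro!: add_pos_pos)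
  show H1: "0 < H1" using pos by (auto simp: H1_def)
  show c: "0 < c" using pos H1 by (auto simp: c_def intro!: divide_pos_pos add_pos_pos)
  show "0 < rate" using pos c by (auto simp: rate_def)
  show "0 < KE" using pos c H0 by (auto simp: KE_def intro!: add_pos_pos)
  show "0 < KD" using pos H0 H1 by (auto simp: KD_def intro!: add_pos_pos mult_pos_pos)
qed

section \<open>Continuity and compactness estimates on the phase box\<close>

lemma cont_h: "continuous_on S f \<Longrightarrow> (\<And>z. z \<in> S \<Longrightarrow> 0 \<le> f z) \<Longrightarrow> continuous_on S (\<lambda>z. h (f z))"
  unfolding h_def using pos by (intro continuous_intros continuous_on_powr') auto

lemma cont_L:
  assumes "continuous_on S f" "continuous_on S g" "\<And>z. z \<in> S \<Longrightarrow> 0 \<le> f z"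
  shows "continuous_on S (\<lambda>z. L (f z) (g z))"
  unfolding L_def V_def using pos assms
  by (intro continuous_intros continuous_on_powr' cont_h) auto

lemma cont_D:
  assumes "continuous_on S f" "continuous_on S g" "\<And>z. z \<in> S \<Longrightarrow> 0 \<le> f z"
  shows "continuous_on S (\<lambda>z. D (f z) (g z))"
  unfolding D_def using assms by (intro continuous_intros cont_h) auto

text \<open>Closed at w = 0, unlike the range of a trajectory, to gain compactness; the price is
  that (0, 0) is among its equilibria.\<close>

definition "phase_box = {0..W0} \<times> {-W1..W1}"

lemma compact_box: "compact phase_box"
  unfolding phase_box_def by (intro compact_Times) auto

lemma phase_box_cont:
  "continuous_on phase_box (\<lambda>z. L (fst z) (snd z))" "continuous_on phase_box (\<lambda>z. D (fst z) (snd z))"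
  by (intro cont_L cont_D continuous_intros; auto simp: phase_box_def)+

lemma D_zero: "0 \<le> w \<Longrightarrow> D w x \<le> 0 \<Longrightarrow> x = 0 \<and> (w = 0 \<or> w = A)"
proof -
  assume w: "0 \<le> w" "D w x \<le> 0"
  then have "x\<^sup>2 + (h w)\<^sup>2 = 0"
    unfolding D_def by (intro order_antisym) auto
  then have "x = 0" "h w = 0" by (simp_all add: add_nonneg_eq_0_iff)
  then show ?thesis using h_zero[OF w(1)] by simp
qed

lemma D_nonneg: "0 \<le> D w x"
  by (simp add: D_def)

lemma compact_sublevel:
  assumes "continuous_on phase_box f"
  shows "compact (phase_box \<inter> {z. f z \<le> (d::real)})"
proof -
  have "closedin (top_of_set phase_box) {z \<in> phase_box. f z \<le> d}"
    using continuous_closedin_preimage[OF assms closed_atMost[of d]]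
    by (simp add: vimage_def Int_def conj_commute)
  then have "compact {z \<in> phase_box. f z \<le> d}"
    using compact_box closedin_compact by blast
  then show ?thesis by (simp add: Int_def)
qed

text \<open>\<open>D\<close> vanishes only at equilibria, so it has a positive minimum on a compact
  set that avoids both of them. The function \<open>g\<close> describes such a set as {g \<le>
  0}.\<close>

lemma D_ge_off_equilibria:
  fixes g :: "real \<times> real \<Rightarrow> real"
  assumes "continuous_on phase_box g" "0 < g (0, 0)" "0 < g (A, 0)"
  shows "\<exists>\<eta>>0. \<forall>w x. (w, x) \<in> phase_box \<longrightarrow> g (w, x) \<le> 0 \<longrightarrow> \<eta> \<le> D w x"
proof -
  let ?C = "phase_box \<inter> {z. g z \<le> 0}"
  have "\<exists>\<eta>>0. \<forall>z\<in>?C. \<eta> \<le> D (fst z) (snd z)"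
  proof (rule compact_pos_min)
    show "compact ?C" by (rule compact_sublevel[OF assms(1)])
    show "continuous_on ?C (\<lambda>z. D (fst z) (snd z))"
      using continuous_on_subset[OF phase_box_cont(2)] by blast
    fix z assume z: "z \<in> ?C"
    then have w: "0 \<le> fst z" by (auto simp: phase_box_def)
    have "\<not> D (fst z) (snd z) \<le> 0"
    proof
      assume "D (fst z) (snd z) \<le> 0"
      from D_zero[OF w this] have "z = (0, 0) \<or> z = (A, 0)" by (auto simp: prod_eq_iff)
      then show False using z assms by auto
    qed
    then show "0 < D (fst z) (snd z)" by simp
  qed
  then obtain \<eta> where \<eta>: "0 < \<eta>" "\<forall>z\<in>?C. \<eta> \<le> D (fst z) (snd z)" by blast
  have "\<eta> \<le> D w x" if "(w, x) \<in> phase_box" "g (w, x) \<le> 0" for w x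
    using bspec[OF \<eta>(2), of "(w, x)"] that by simp
  then show ?thesis using \<eta>(1) by blast
qed

text \<open>On the set where L \<le> - \<delta> and |w - A| \<ge> eps, the first condition excludes
  (0, 0) and the second excludes (A, 0); so \<open>D\<close> is bounded below there.\<close>

lemma near_A:
  assumes "0 < eps" "0 < \<delta>"
  shows "\<exists>\<eta>>0. \<forall>w x. (w, x) \<in> phase_box \<longrightarrow> L w x \<le> - \<delta> \<longrightarrow> D w x < \<eta> \<longrightarrow> \<bar>w - A\<bar> < eps"
proof -
  have c: "continuous_on phase_box (\<lambda>z. max (L (fst z) (snd z) + \<delta>) (eps - \<bar>fst z - A\<bar>))"
    by (intro continuous_intros phase_box_cont)
  obtain \<eta> where \<eta>: "0 < \<eta>" "\<forall>w x. (w, x) \<in> phase_box \<longrightarrow>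
      max (L (fst (w, x)) (snd (w, x)) + \<delta>) (eps - \<bar>fst (w, x) - A\<bar>) \<le> 0 \<longrightarrow> \<eta> \<le> D w x"
  proof -
    have "0 < max (L (fst (0, 0)) (snd (0, 0)) + \<delta>) (eps - \<bar>fst (0, 0) - A\<bar>)"
      "0 < max (L (fst (A, 0)) (snd (A, 0)) + \<delta>) (eps - \<bar>fst (A, 0) - A\<bar>)"
      using assms by (auto simp: L_def less_max_iff_disj)
    from D_ge_off_equilibria[OF c this] show ?thesis using that by blast
  qed
  have "\<bar>w - A\<bar> < eps" if "(w, x) \<in> phase_box" "L w x \<le> - \<delta>" "D w x < \<eta>" for w x
    using \<eta>(2)[rule_format, of w x] that by force
  then show ?thesis using \<eta>(1) by blast
qed

lemma D_ge_if_L_pos: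
  assumes "0 < \<delta>"
  shows "\<exists>\<eta>>0. \<forall>w x. (w, x) \<in> phase_box \<longrightarrow> \<delta> \<le> L w x \<longrightarrow> \<eta> \<le> D w x"
proof -
  have c: "continuous_on phase_box (\<lambda>z. \<delta> - L (fst z) (snd z))"
    by (intro continuous_intros phase_box_cont)
  show ?thesis using D_ge_off_equilibria[OF c] assms V_A by (auto simp: L_def)
qed

text \<open>The only equilibrium that w \<ge> eps admits is (A, 0), and there \<open>L\<close> is
  negative.\<close>

lemma D_ge_or_L_neg:
  assumes "0 < eps"
  shows "\<exists>\<eta>>0. \<forall>w x. (w, x) \<in> phase_box \<longrightarrow> eps \<le> w \<longrightarrow> \<eta> \<le> D w x \<or> L w x \<le> - \<eta>"
proof -
  let ?C = "phase_box \<inter> {z. eps - fst z \<le> 0}"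
  have "\<exists>\<eta>>0. \<forall>z\<in>?C. \<eta> \<le> max (D (fst z) (snd z)) (- L (fst z) (snd z))"
  proof (rule compact_pos_min)
    show "compact ?C" by (intro compact_sublevel continuous_intros)
    show "continuous_on ?C (\<lambda>z. max (D (fst z) (snd z)) (- L (fst z) (snd z)))"
      by (intro continuous_intros continuous_on_subset[OF phase_box_cont(1)] continuous_on_subset[OF phase_box_cont(2)]) auto
    fix z assume z: "z \<in> ?C"
    then have w: "0 \<le> fst z" by (auto simp: phase_box_def)
    have "0 < - L (fst z) (snd z)" if "D (fst z) (snd z) \<le> 0"
      using D_zero[OF w that] z assms V_A by (auto simp: L_def)
    then show "0 < max (D (fst z) (snd z)) (- L (fst z) (snd z))"
      unfolding less_max_iff_disj by linarith
  qed
  then obtain \<eta> where \<eta>: "0 < \<eta>" "\<And>z. z \<in> ?C \<Longrightarrow> \<eta> \<le> max (D (fst z) (snd z)) (- L (fst z) (snd z))" by blast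
  have "\<eta> \<le> D w x \<or> L w x \<le> - \<eta>" if "(w, x) \<in> phase_box" "eps \<le> w" for w x
    using \<eta>(2)[of "(w, x)"] that by (auto simp: le_max_iff_disj)
  then show ?thesis using \<eta>(1) by blast
qed

lemma L_bounded: "\<exists>B. \<forall>w x. (w, x) \<in> phase_box \<longrightarrow> \<bar>L w x\<bar> \<le> B"
proof -
  have "compact ((\<lambda>z. L (fst z) (snd z)) ` phase_box)"
    by (rule compact_continuous_image[OF phase_box_cont(1) compact_box])
  then have "bounded ((\<lambda>z. L (fst z) (snd z)) ` phase_box)" by (rule compact_imp_bounded)
  then obtain B where "\<And>y. y \<in> (\<lambda>z. L (fst z) (snd z)) ` phase_box \<Longrightarrow> \<bar>y\<bar> \<le> B"
    unfolding bounded_iff by auto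
  then show ?thesis by force
qed

section \<open>Differential inequalities along perturbed trajectories\<close>

lemma h_bound: "0 < w \<Longrightarrow> w \<le> W0 \<Longrightarrow> \<bar>h w\<bar> \<le> H0"
proof -
  assume w: "0 < w" "w \<le> W0"
  have "w powr p \<le> W0 powr p" using w pos by (intro powr_mono2) auto
  then have "k0 * w powr p \<le> k0 * W0 powr p" "0 \<le> k0 * w powr p" "b * w \<le> b * W0" "0 \<le> b * w"
    using pos w by auto
  then show ?thesis unfolding h_def H0_def by linarith
qed

lemma h_deriv: "0 < w \<Longrightarrow> (h has_real_derivative p * k0 * w powr (p - 1) - b) (at w)"
  unfolding h_def [abs_def] by (auto intro!: derivative_eq_intros)

lemma h'_bound: "0 < w \<Longrightarrow> w \<le> W0 \<Longrightarrow> 0 \<le> p * k0 * w powr (p - 1) \<and> p * k0 * w powr (p - 1) \<le> H1"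
proof -
  assume w: "0 < w" "w \<le> W0"
  have "w powr (p - 1) \<le> W0 powr (p - 1)" using w pos by (intro powr_mono2) auto
  then show ?thesis unfolding H1_def using pos by auto
qed

lemma V_deriv: "0 < w \<Longrightarrow> (V has_real_derivative h w) (at w)"
proof -
  assume w: "0 < w"
  have "(V has_real_derivative k0 * ((p + 1) * w powr (p + 1 - 1)) / (p + 1) - b * (2 * w) / 2) (at w)"
    unfolding V_def [abs_def] using w pos by (auto intro!: derivative_eq_intros)
  then show ?thesis using pos by (simp add: h_def)
qed

lemma L_deriv:
  assumes tr: "traj eps s t w x e" and r: "r \<in> {s..t}"
  shows "\<exists>l. ((\<lambda>r. L (w r) (x r)) has_real_derivative l) (at r) \<and> l \<le> - rate * D (w r) (x r) + eps * KE"
proof -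
  have d: "(w has_real_derivative x r) (at r)" "(x has_real_derivative - a * x r - h (w r) + e r) (at r)"
    and w: "0 < w r" "w r \<le> W0" and x: "\<bar>x r\<bar> \<le> W1" and e: "\<bar>e r\<bar> \<le> eps"
    using tr r unfolding traj_def by auto
  define h' where "h' = p * k0 * w r powr (p - 1) - b"
  define l where "l = x r * (- a * x r + e r) + c * h (w r) * (- a * x r - h (w r) + e r) + c * (x r)\<^sup>2 * h'"
  have dh: "((\<lambda>r. h (w r)) has_real_derivative h' * x r) (at r)"
    unfolding h'_def by (rule DERIV_chain2[OF h_deriv[OF w(1)] d(1)])
  have dV: "((\<lambda>r. V (w r)) has_real_derivative h (w r) * x r) (at r)"
    by (rule DERIV_chain2[OF V_deriv[OF w(1)] d(1)])
  have "((\<lambda>r. L (w r) (x r)) has_real_derivative l) (at r)"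
    unfolding L_def l_def
    by (auto intro!: derivative_eq_intros d dh dV simp: field_simps power2_eq_square)
  moreover have "l \<le> - rate * D (w r) (x r) + eps * KE"
  proof -
    let ?x = "x r" and ?h = "h (w r)"
    have c0: "0 < c" by (rule H_pos)
    have h': "h' \<le> H1" using h'_bound[OF w] pos unfolding h'_def by auto
    \<comment> \<open>This identity is the reason for the value of \<open>c\<close>: the two cross
      terms c H1 x^2 and c a^2 x^2 / 2 together consume exactly half of the damping a x^2.\<close>
    have cH: "c * H1 + c * a\<^sup>2 / 2 = a / 2"
    proof -
      have "c * (2 * H1 + a\<^sup>2) = a" unfolding c_def using H_pos(2) pos by (simp add: add_pos_pos less_imp_neq[symmetric])
      then show ?thesis by (simp add: algebra_simps)
    qed
    have "c * ?x\<^sup>2 * H1 + c * a\<^sup>2 / 2 * ?x\<^sup>2 = (c * H1 + c * a\<^sup>2 / 2) * ?x\<^sup>2"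
      by (simp add: algebra_simps)
    then have cHx: "c * ?x\<^sup>2 * H1 + c * a\<^sup>2 / 2 * ?x\<^sup>2 = a / 2 * ?x\<^sup>2" unfolding cH .
    have "c * ?x\<^sup>2 * h' \<le> c * ?x\<^sup>2 * H1" using h' c0 by (intro mult_left_mono) auto
    moreover have "- (c * a * ?x * ?h) \<le> c * ?h\<^sup>2 / 2 + c * a\<^sup>2 / 2 * ?x\<^sup>2"
    proof -
      have "0 \<le> c / 2 * (?h + a * ?x)\<^sup>2" using c0 by simp
      then show ?thesis by (simp add: power2_eq_square algebra_simps)
    qed
    moreover have "e r * (?x + c * ?h) \<le> eps * KE"
    proof -
      have "\<bar>e r * (?x + c * ?h)\<bar> \<le> eps * KE"
        unfolding abs_mult KE_def
      proof (rule mult_mono)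
        have "\<bar>?x + c * ?h\<bar> \<le> \<bar>?x\<bar> + c * \<bar>?h\<bar>"
          using c0 abs_triangle_ineq[of ?x "c * ?h"] by (simp add: abs_mult)
        also have "\<dots> \<le> W1 + c * H0" using x h_bound[OF w] c0 by (intro add_mono mult_left_mono) auto
        finally show "\<bar>?x + c * ?h\<bar> \<le> W1 + c * H0" .
      qed (use e in auto)
      then show ?thesis by linarith
    qed
    moreover have "rate * D (w r) ?x \<le> a / 2 * ?x\<^sup>2 + c / 2 * ?h\<^sup>2"
      unfolding D_def distrib_left rate_def by (intro add_mono mult_right_mono) auto
    moreover have "l = - (a * ?x\<^sup>2) + e r * (?x + c * ?h) - c * a * ?x * ?h - c * ?h\<^sup>2 + c * ?x\<^sup>2 * h'"
      unfolding l_def by (simp add: power2_eq_square algebra_simps)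
    ultimately show ?thesis using cHx by linarith
  qed
  ultimately show ?thesis by blast
qed

text \<open>With bounded speed, a value of \<open>D\<close> that is large at one instant stays large
  for a definite time, so that it is felt by \<open>L\<close>.\<close>

lemma D_deriv:
  assumes tr: "traj eps s t w x e" and r: "r \<in> {s..t}" and eps: "eps \<le> 1"
  shows "\<exists>l. ((\<lambda>r. D (w r) (x r)) has_real_derivative l) (at r) \<and> \<bar>l\<bar> \<le> KD"
proof -
  have d: "(w has_real_derivative x r) (at r)" "(x has_real_derivative - a * x r - h (w r) + e r) (at r)"
    and w: "0 < w r" "w r \<le> W0" and x: "\<bar>x r\<bar> \<le> W1" and e: "\<bar>e r\<bar> \<le> eps"
    using tr r unfolding traj_def by auto
  define h' where "h' = p * k0 * w r powr (p - 1) - b"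
  have dh: "((\<lambda>r. h (w r)) has_real_derivative h' * x r) (at r)"
    unfolding h'_def by (rule DERIV_chain2[OF h_deriv[OF w(1)] d(1)])
  define x' where "x' = - a * x r - h (w r) + e r"
  have "((\<lambda>r. D (w r) (x r)) has_real_derivative 2 * x r * x' + 2 * h (w r) * h' * x r) (at r)"
    unfolding D_def x'_def
    by (auto intro!: derivative_eq_intros d dh simp: algebra_simps power2_eq_square)
  moreover have "\<bar>2 * x r * x' + 2 * h (w r) * h' * x r\<bar> \<le> KD"
  proof -
    have "\<bar>a * x r\<bar> \<le> a * W1" using x pos by (simp add: abs_mult)
    then have x': "\<bar>x'\<bar> \<le> a * W1 + H0 + 1" using h_bound[OF w] e eps unfolding x'_def by linarith
    have h': "\<bar>h'\<bar> \<le> H1 + b" using h'_bound[OF w] pos unfolding h'_def by linarith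
    have "\<bar>2 * x r * x'\<bar> \<le> 2 * W1 * (a * W1 + H0 + 1)"
      unfolding abs_mult using x x' pos by (intro mult_mono) auto
    moreover have "\<bar>2 * h (w r) * h' * x r\<bar> \<le> 2 * H0 * (H1 + b) * W1"
      unfolding abs_mult using x h' h_bound[OF w] pos H_pos by (intro mult_mono) auto
    ultimately show ?thesis unfolding KD_def by linarith
  qed
  ultimately show ?thesis by blast
qed

lemma traj_subset: "traj eps s t w x e \<Longrightarrow> s \<le> s' \<Longrightarrow> t' \<le> t \<Longrightarrow> eps \<le> eps' \<Longrightarrow> traj eps' s' t' w x e"
  unfolding traj_def by (meson atLeastAtMost_iff order_trans)

lemma traj_box: "traj eps s t w x e \<Longrightarrow> r \<in> {s..t} \<Longrightarrow> (w r, x r) \<in> phase_box"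
proof -
  assume "traj eps s t w x e" "r \<in> {s..t}"
  then have "0 < w r" "w r \<le> W0" "\<bar>x r\<bar> \<le> W1" unfolding traj_def by auto
  then show ?thesis unfolding phase_box_def by auto
qed

section \<open>Quantitative decrease of \<open>L\<close> and its consequences\<close>

lemma DERIV_le_linear:
  fixes f :: "real \<Rightarrow> real"
  assumes "s \<le> t" "\<And>r. s \<le> r \<Longrightarrow> r \<le> t \<Longrightarrow> \<exists>l. (f has_real_derivative l) (at r) \<and> l \<le> m"
  shows "f t \<le> f s + m * (t - s)"
proof -
  have "f t - m * t \<le> f s - m * s"
  proof (rule DERIV_nonpos_imp_nonincreasing[OF assms(1)])
    fix r assume "s \<le> r" "r \<le> t"
    then obtain l where "(f has_real_derivative l) (at r)" "l \<le> m" using assms(2) by blast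
    then show "\<exists>y. ((\<lambda>r. f r - m * r) has_real_derivative y) (at r) \<and> y \<le> 0"
      by (intro exI[of _ "l - m"]) (auto intro!: derivative_eq_intros)
  qed
  then show ?thesis by (simp add: algebra_simps)
qed

lemma L_growth:
  assumes tr: "traj eps s t w x e" and r: "s \<le> r1" "r1 \<le> r2" "r2 \<le> t"
  shows "L (w r2) (x r2) \<le> L (w r1) (x r1) + eps * KE * (r2 - r1)"
proof (rule DERIV_le_linear[OF r(2)])
  fix r assume "r1 \<le> r" "r \<le> r2"
  moreover have "0 \<le> rate * D (w r) (x r)" using H_pos D_nonneg by simp
  ultimately show "\<exists>l. ((\<lambda>r. L (w r) (x r)) has_real_derivative l) (at r) \<and> l \<le> eps * KE"
    using L_deriv[OF tr, of r] r by force
qed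

text \<open>The extra unit of length after \<open>len\<close> is room for the time during which
  \<open>D\<close> remains large, even if \<open>r\<close> is the last admissible instant.\<close>

definition drops :: "real \<Rightarrow> real \<Rightarrow> real \<Rightarrow> real \<Rightarrow> bool" where
  "drops \<eta> len \<sigma> eps0 \<longleftrightarrow> (\<forall>eps s r w x e. eps \<le> eps0 \<longrightarrow> traj eps s (s + len + 1) w x e \<longrightarrow>
     s \<le> r \<longrightarrow> r \<le> s + len \<longrightarrow> \<eta> \<le> D (w r) (x r) \<longrightarrow>
     L (w (s + len + 1)) (x (s + len + 1)) \<le> L (w s) (x s) - \<sigma>)"

lemma dropsD:
  assumes "drops \<eta> len \<sigma> eps0" "eps \<le> eps0" "traj eps s (s + len + 1) w x e"
    "s \<le> r" "r \<le> s + len" "\<eta> \<le> D (w r) (x r)"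
  shows "L (w (s + len + 1)) (x (s + len + 1)) \<le> L (w s) (x s) - \<sigma>"
  using assms unfolding drops_def by blast

text \<open>The order of quantifiers matters: \<sigma> depends on \<eta> alone, and only the
  admissible force depends on \<open>len\<close>. A long block thus loses at least as much as a
  short one, provided the force is weak.\<close>

lemma L_drop:
  assumes \<eta>: "0 < \<eta>"
  shows "\<exists>\<sigma>>0. \<forall>len>0. \<exists>eps0>0. eps0 \<le> 1 \<and> drops \<eta> len \<sigma> eps0"
proof -
  define q where "q = min 1 (\<eta> / (2 * KD))"
  \<comment> \<open>Over a time \<open>q\<close> in which \<open>D\<close> stays above \<eta> / 2,
    \<open>L\<close> loses rate * \<eta> / 2 * q = 2 \<sigma>; the force gives back at most \<sigma>
    over the whole block.\<close>
  define \<sigma> where "\<sigma> = rate * \<eta> * q / 4"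
  have q: "0 < q" "q \<le> 1" "KD * q \<le> \<eta> / 2"
    using \<eta> H_pos(6) by (auto simp: q_def min_def field_simps)
  have \<sigma>: "0 < \<sigma>" using \<eta> q H_pos by (simp add: \<sigma>_def)
  have "\<exists>eps0>0. eps0 \<le> 1 \<and> drops \<eta> len \<sigma> eps0" if len: "0 < len" for len
  proof -
    define eps0 where "eps0 = min 1 (\<sigma> / (KE * (len + 1)))"
    have eps0: "0 < eps0" "eps0 \<le> 1" using \<sigma> len H_pos by (auto simp: eps0_def)
    have "0 < KE * (len + 1)" using len H_pos by simp
    then have epsK: "eps0 * (KE * (len + 1)) \<le> \<sigma>"
      unfolding eps0_def by (subst pos_le_divide_eq[symmetric]) auto
    have "L (w (s + len + 1)) (x (s + len + 1)) \<le> L (w s) (x s) - \<sigma>"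
      if "eps \<le> eps0" and tr0: "traj eps s (s + len + 1) w x e" and r: "s \<le> r" "r \<le> s + len"
        and D: "\<eta> \<le> D (w r) (x r)" for eps s r w x e
    proof -
      have tr: "traj eps0 s (s + len + 1) w x e" using traj_subset[OF tr0] that(1) by auto
      have D2: "\<eta> / 2 \<le> D (w y) (x y)" if y: "r \<le> y" "y \<le> r + q" for y
      proof -
        have "- D (w y) (x y) \<le> - D (w r) (x r) + KD * (y - r)"
        proof (rule DERIV_le_linear[OF y(1)])
          fix z assume "r \<le> z" "z \<le> y"
          then have "z \<in> {s..s + len + 1}" using r y q by auto
          from D_deriv[OF tr this eps0(2)] obtain l where
            "((\<lambda>r. D (w r) (x r)) has_real_derivative l) (at z)" "\<bar>l\<bar> \<le> KD" by blast
          then show "\<exists>l. ((\<lambda>r. - D (w r) (x r)) has_real_derivative l) (at z) \<and> l \<le> KD"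
            by (intro exI[of _ "- l"]) (auto intro!: derivative_eq_intros)
        qed
        moreover have "KD * (y - r) \<le> KD * q" using y H_pos by (intro mult_left_mono) auto
        ultimately show ?thesis using q D by linarith
      qed
      have 1: "L (w (r + q)) (x (r + q)) \<le> L (w r) (x r) + (eps0 * KE - rate * \<eta> / 2) * ((r + q) - r)"
      proof (rule DERIV_le_linear)
        fix y assume y: "r \<le> y" "y \<le> r + q"
        then have "y \<in> {s..s + len + 1}" using r q by auto
        from L_deriv[OF tr this] obtain l where
          l: "((\<lambda>r. L (w r) (x r)) has_real_derivative l) (at y)" "l \<le> - rate * D (w y) (x y) + eps0 * KE" by blast
        have "rate * (\<eta> / 2) \<le> rate * D (w y) (x y)" using D2[OF y] H_pos by (intro mult_left_mono) auto
        then show "\<exists>l. ((\<lambda>r. L (w r) (x r)) has_real_derivative l) (at y) \<and> l \<le> eps0 * KE - rate * \<eta> / 2"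
          using l by (intro exI[of _ l]) auto
      qed (use q in auto)
      have 2: "L (w r) (x r) \<le> L (w s) (x s) + eps0 * KE * (r - s)"
        by (rule L_growth[OF tr]) (use r in auto)
      have 3: "L (w (s + len + 1)) (x (s + len + 1)) \<le> L (w (r + q)) (x (r + q)) + eps0 * KE * (s + len + 1 - (r + q))"
        by (rule L_growth[OF tr]) (use r q in auto)
      have "eps0 * KE * (r - s) + (eps0 * KE - rate * \<eta> / 2) * ((r + q) - r) + eps0 * KE * (s + len + 1 - (r + q))
        = eps0 * (KE * (len + 1)) - 2 * \<sigma>"
        unfolding \<sigma>_def by (simp add: algebra_simps)
      then show ?thesis using 1 2 3 epsK by linarith
    qed
    then show ?thesis unfolding drops_def using eps0 by blast
  qed
  then show ?thesis using \<sigma> by blast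
qed

text \<open>Cut [s, s + S] into blocks of length len + 1. If the first \<open>len\<close> of a block
  is not spent near \<open>A\<close>, then \<open>D\<close> is large at some instant of it, since
  \<open>L\<close> is still at most - \<delta> / 2, and the block costs \<sigma>. As
  \<open>L\<close> is bounded on the box, not all blocks can be of this kind. The length
  \<open>S\<close> does not depend on the trajectory.\<close>

lemma near_A_interval:
  assumes eps: "0 < eps" and len: "0 < len" and \<delta>: "0 < \<delta>"
  shows "\<exists>eps0>0. \<exists>S>0. \<forall>s w x e. traj eps0 s (s + S) w x e \<longrightarrow> L (w s) (x s) \<le> - \<delta> \<longrightarrow>
     (\<exists>t1\<ge>s. t1 + len \<le> s + S \<and> (\<forall>t\<in>{t1..t1 + len}. \<bar>w t - A\<bar> < eps))"
proof -
  obtain \<eta> where \<eta>: "0 < \<eta>"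
    "\<And>w x. (w, x) \<in> phase_box \<Longrightarrow> L w x \<le> - (\<delta> / 2) \<Longrightarrow> D w x < \<eta> \<Longrightarrow> \<bar>w - A\<bar> < eps"
    using near_A[OF eps, of "\<delta> / 2"] \<delta> by auto
  from L_drop[OF \<eta>(1)] len obtain \<sigma> eps1 where \<sigma>: "0 < \<sigma>" and eps1: "0 < eps1" "eps1 \<le> 1"
    and drop: "drops \<eta> len \<sigma> eps1" by metis
  obtain B where B: "\<And>w x. (w, x) \<in> phase_box \<Longrightarrow> \<bar>L w x\<bar> \<le> B" using L_bounded by blast
  \<comment> \<open>The second bound limits the forced growth of \<open>L\<close> within a stretch
    of length \<open>len\<close> to \<delta> / 2.\<close>
  define eps0 where "eps0 = min eps1 (\<delta> / 2 / (KE * len))"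
  have Klen: "0 < KE * len" using len H_pos by simp
  then have eps0: "0 < eps0" "eps0 \<le> eps1" using eps1 \<delta> by (auto simp: eps0_def)
  have epsK: "eps0 * (KE * len) \<le> \<delta> / 2"
    unfolding eps0_def using Klen by (subst pos_le_divide_eq[symmetric]) auto
  obtain J :: nat where J: "B < real J * \<sigma>" using reals_Archimedean3[OF \<sigma>] by blast
  define S where "S = real (Suc J) * (len + 1)"
  have S0: "0 < S" using len by (simp add: S_def)
  have "\<exists>t1\<ge>s. t1 + len \<le> s + S \<and> (\<forall>t\<in>{t1..t1 + len}. \<bar>w t - A\<bar> < eps)"
    if tr: "traj eps0 s (s + S) w x e" and Ls: "L (w s) (x s) \<le> - \<delta>" for s w x e
  proof (rule ccontr)
    assume no: "\<not> ?thesis"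
    define T where "T = (\<lambda>j::nat. s + real j * (len + 1))"
    have T_le: "T j \<le> s + S" "s \<le> T j" if "j \<le> Suc J" for j
    proof -
      have "real j * (len + 1) \<le> real (Suc J) * (len + 1)" using that len by (intro mult_right_mono) auto
      then show "T j \<le> s + S" by (simp add: T_def S_def)
      show "s \<le> T j" using len by (simp add: T_def)
    qed
    have TS: "T (Suc j) = T j + len + 1" for j by (simp add: T_def algebra_simps)
    have "j \<le> Suc J \<longrightarrow> L (w (T j)) (x (T j)) \<le> - \<delta> - real j * \<sigma>" for j
    proof (induction j)
      case 0
      then show ?case using Ls by (simp add: T_def)
    next
      case (Suc j)
      show ?case
      proof
        assume j: "Suc j \<le> Suc J"
        then have IH: "L (w (T j)) (x (T j)) \<le> - \<delta> - real j * \<sigma>" using Suc by simp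
        have le: "s \<le> T j" "T j + len + 1 \<le> s + S" using T_le[of j] T_le[of "Suc j"] TS[of j] j by auto
        then have trj: "traj eps0 (T j) (T j + len + 1) w x e" using traj_subset[OF tr] by auto
        obtain r where r: "r \<in> {T j..T j + len}" "\<not> \<bar>w r - A\<bar> < eps"
          using no le len by force
        have "L (w r) (x r) \<le> L (w (T j)) (x (T j)) + eps0 * KE * (r - T j)"
          by (rule L_growth[OF trj]) (use r in auto)
        also have "eps0 * KE * (r - T j) \<le> eps0 * KE * len"
          using r eps0 H_pos by (intro mult_left_mono) auto
        finally have "L (w r) (x r) \<le> - (\<delta> / 2)" using IH epsK mult_nonneg_nonneg[of "real j" \<sigma>] \<sigma>
          unfolding mult.assoc by linarith
        moreover have "(w r, x r) \<in> phase_box" using traj_box[OF trj] r by auto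
        ultimately have "\<eta> \<le> D (w r) (x r)" using \<eta>(2) r(2) by force
        from dropsD[OF drop eps0(2) trj _ _ this] r
        have "L (w (T (Suc j))) (x (T (Suc j))) \<le> L (w (T j)) (x (T j)) - \<sigma>" by (simp add: TS)
        then show "L (w (T (Suc j))) (x (T (Suc j))) \<le> - \<delta> - real (Suc j) * \<sigma>"
          using IH by (simp add: algebra_simps)
      qed
    qed
    from this[of J] have "L (w (T J)) (x (T J)) \<le> - \<delta> - real J * \<sigma>" by simp
    moreover have "\<bar>L (w (T J)) (x (T J))\<bar> \<le> B"
      by (rule B, rule traj_box[OF tr]) (use T_le[of J] in auto)
    ultimately show False using J \<delta> by linarith
  qed
  then show ?thesis using eps0(1) S0 by blast
qed

text \<open>Going back in time, \<open>L\<close> would rise by \<sigma> per block once it is at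
  least some \<delta> > 0, which its boundedness forbids; with \<open>Lge\<close>, \<open>L\<close>
  tends to 0. Then no drop by \<sigma> can occur, so \<open>D\<close> becomes small, and closeness
  to \<open>A\<close> is excluded because \<open>L\<close> is negative there. The contrapositive
  yields times arbitrarily far back with \<open>L\<close> below a fixed negative number.\<close>

lemma tendsto_0_of_L:
  assumes tr: "\<And>eps. 0 < eps \<Longrightarrow> \<exists>T. \<forall>s t. t \<le> T \<longrightarrow> traj eps s t w x e"
    and Lge: "\<And>\<delta>. 0 < \<delta> \<Longrightarrow> eventually (\<lambda>t. - \<delta> < L (w t) (x t)) at_bot"
  shows "(w \<longlongrightarrow> 0) at_bot"
proof -
  obtain B where B: "\<And>w x. (w, x) \<in> phase_box \<Longrightarrow> \<bar>L w x\<bar> \<le> B" using L_bounded by blast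
  have Llt: "\<exists>T. \<forall>t\<le>T. L (w t) (x t) < \<delta>" if \<delta>: "0 < \<delta>" for \<delta>
  proof -
    obtain \<eta> where \<eta>: "0 < \<eta>" "\<And>w x. (w, x) \<in> phase_box \<Longrightarrow> \<delta> / 2 \<le> L w x \<Longrightarrow> \<eta> \<le> D w x"
      using D_ge_if_L_pos[of "\<delta> / 2"] \<delta> by auto
    from L_drop[OF \<eta>(1)] obtain \<sigma> eps1 where \<sigma>: "0 < \<sigma>" and eps1: "0 < eps1" "eps1 \<le> 1"
      and drop: "drops \<eta> 1 \<sigma> eps1" by (metis zero_less_one)
    define eps0 where "eps0 = min eps1 (\<delta> / 2 / (KE * 2))"
    have K2: "0 < KE * 2" using H_pos by simp
    then have eps0: "0 < eps0" "eps0 \<le> eps1" using eps1 \<delta> by (auto simp: eps0_def)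
    have epsK: "eps0 * (KE * 2) \<le> \<delta> / 2"
      unfolding eps0_def using K2 by (subst pos_le_divide_eq[symmetric]) auto
    obtain T where T: "\<And>s t. t \<le> T \<Longrightarrow> traj eps0 s t w x e" using tr[OF eps0(1)] by blast
    have "L (w t) (x t) < \<delta>" if t: "t \<le> T" for t
    proof (rule ccontr)
      assume "\<not> L (w t) (x t) < \<delta>"
      then have Lt: "\<delta> \<le> L (w t) (x t)" by simp
      have ind: "\<delta> + real j * \<sigma> \<le> L (w (t - real j * 2)) (x (t - real j * 2))" for j
      proof (induction j)
        case (Suc j)
        define s where "s = t - real (Suc j) * 2"
        have s: "s + 1 + 1 = t - real j * 2" by (simp add: s_def)
        then have "s + 1 + 1 \<le> T" using t by (simp add: le_diff_eq add_increasing2)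
        then have trs: "traj eps0 s (s + 1 + 1) w x e" by (rule T)
        have "L (w (s + 1 + 1)) (x (s + 1 + 1)) \<le> L (w s) (x s) + eps0 * KE * ((s + 1 + 1) - s)"
          by (rule L_growth[OF trs]) auto
        moreover have "eps0 * KE * ((s + 1 + 1) - s) = eps0 * (KE * 2)" by simp
        ultimately have "\<delta> / 2 \<le> L (w s) (x s)"
          using Suc[folded s] epsK mult_nonneg_nonneg[of "real j" \<sigma>] \<sigma> by linarith
        moreover have "(w s, x s) \<in> phase_box" using traj_box[OF trs, of s] by simp
        ultimately have "\<eta> \<le> D (w s) (x s)" using \<eta>(2) by blast
        from dropsD[OF drop eps0(2) trs _ _ this]
        have "L (w (s + 1 + 1)) (x (s + 1 + 1)) \<le> L (w s) (x s) - \<sigma>" by simp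
        then have "\<delta> + real (Suc j) * \<sigma> \<le> L (w s) (x s)"
          using Suc unfolding s by (simp add: algebra_simps)
        then show ?case unfolding s_def .
      qed (use Lt in simp)
      obtain J :: nat where J: "B < real J * \<sigma>" using reals_Archimedean3[OF \<sigma>] by blast
      have "t - real J * 2 \<le> T" using t by simp
      then have "(w (t - real J * 2), x (t - real J * 2)) \<in> phase_box"
        using traj_box[OF T, of "t - real J * 2" "t - real J * 2" "t - real J * 2"] by simp
      from B[OF this] ind[of J] J \<delta> show False by linarith
    qed
    then show ?thesis by blast
  qed
  have "\<exists>T. \<forall>t\<le>T. w t < eps" if eps: "0 < eps" for eps
  proof -
    obtain \<eta> where \<eta>: "0 < \<eta>" "\<And>w x. (w, x) \<in> phase_box \<Longrightarrow> eps \<le> w \<Longrightarrow> \<eta> \<le> D w x \<or> L w x \<le> - \<eta>"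
      using D_ge_or_L_neg[OF eps] by blast
    from L_drop[OF \<eta>(1)] obtain \<sigma> eps1 where \<sigma>: "0 < \<sigma>" and eps1: "0 < eps1" "eps1 \<le> 1"
      and drop: "drops \<eta> 1 \<sigma> eps1" by (metis zero_less_one)
    obtain T1 where T1: "\<And>s t. t \<le> T1 \<Longrightarrow> traj eps1 s t w x e" using tr[OF eps1(1)] by blast
    obtain T2 where T2: "\<And>t. t \<le> T2 \<Longrightarrow> L (w t) (x t) < \<sigma> / 2" using Llt[of "\<sigma> / 2"] \<sigma> by auto
    have "0 < min \<eta> (\<sigma> / 2)" using \<eta> \<sigma> by simp
    from Lge[OF this] obtain T3 where T3: "\<And>t. t \<le> T3 \<Longrightarrow> - min \<eta> (\<sigma> / 2) < L (w t) (x t)"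
      unfolding eventually_at_bot_linorder by blast
    define T where "T = min T1 (min T2 T3) - 2"
    have "w t < eps" if t: "t \<le> T" for t
    proof (rule ccontr)
      assume "\<not> w t < eps"
      have tT: "t + 1 + 1 \<le> T1" "t + 1 + 1 \<le> T2" "t + 1 + 1 \<le> T3" using t by (auto simp: T_def)
      have trt: "traj eps1 t (t + 1 + 1) w x e" by (rule T1[OF tT(1)])
      have "(w t, x t) \<in> phase_box" using traj_box[OF trt, of t] by simp
      moreover have "- \<eta> < L (w t) (x t)" using T3[of t] tT by linarith
      ultimately have "\<eta> \<le> D (w t) (x t)" using \<eta>(2)[of "w t" "x t"] \<open>\<not> w t < eps\<close> by force
      from dropsD[OF drop order_refl trt _ _ this]
      have "L (w (t + 1 + 1)) (x (t + 1 + 1)) \<le> L (w t) (x t) - \<sigma>" by simp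
      moreover have "- (\<sigma> / 2) < L (w (t + 1 + 1)) (x (t + 1 + 1))"
        using T3[OF tT(3)] by linarith
      moreover have "L (w t) (x t) < \<sigma> / 2" using T2[of t] tT by linarith
      ultimately show False by linarith
    qed
    then show ?thesis by blast
  qed
  note small = this
  obtain T where T: "\<And>s t. t \<le> T \<Longrightarrow> traj 1 s t w x e" using tr[of 1] by auto
  have wpos: "0 < w t" if "t \<le> T" for t using T[OF that, of t] unfolding traj_def by auto
  show ?thesis
  proof (rule order_tendstoI)
    fix y :: real assume "y < 0"
    then show "\<forall>\<^sub>F t in at_bot. y < w t"
      unfolding eventually_at_bot_linorder using wpos by (meson less_trans)
  next
    fix y :: real assume "0 < y"
    then show "\<forall>\<^sub>F t in at_bot. w t < y"
      unfolding eventually_at_bot_linorder using small by blast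
  qed
qed

end

section \<open>The singular solution\<close>

text \<open>The equation in t = ln r with n = N - 2, \<beta> = 2 + \<alpha> and \<gamma> = 2 +
  \<nu>. In these terms \<open>supercritical\<close> says p > p_S, and it amounts to positive
  damping after the Emden--Fowler change of variables.\<close>

locale radial_problem =
  fixes n p \<beta> \<gamma> k0 C0 :: real and \<kappa> \<phi> :: "real \<Rightarrow> real"
  assumes n: "0 < n" and p: "1 < p" and \<beta>: "0 < \<beta>" and \<gamma>: "0 < \<gamma>" and k0: "0 < k0"
    and cont: "continuous_on UNIV \<kappa>" "continuous_on UNIV \<phi>"
    and \<kappa>_pos: "\<And>t. 0 < \<kappa> t" and \<phi>_nonneg: "\<And>t. 0 \<le> \<phi> t"
    and k_lim: "((\<lambda>t. \<kappa> t / exp (\<beta> * t)) \<longlongrightarrow> k0) at_bot"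
    and \<phi>_bound: "eventually (\<lambda>t. \<phi> t \<le> C0 * exp (\<gamma> * t)) at_bot"
    and supercritical: "2 * \<beta> < n * (p - 1)"
begin

definition "\<theta> = \<beta> / (p - 1)"
definition "a = n - 2 * \<theta>"
definition "b = \<theta> * (n - \<theta>)"
definition "k t = \<kappa> t / exp (\<beta> * t)"

lemma \<kappa>_nonneg: "0 \<le> \<kappa> t"
  using \<kappa>_pos[of t] by simp

lemma \<theta>: "0 < \<theta>" "2 * \<theta> < n" "(p - 1) * \<theta> = \<beta>"
  using p \<beta> supercritical by (auto simp: \<theta>_def field_simps)

lemma ab_pos: "0 < a" "0 < b"
  using \<theta> n by (auto simp: a_def b_def)

lemma \<kappa>_eq: "\<kappa> t = exp (\<beta> * t) * k t"
  by (simp add: k_def)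

text \<open>\<theta> is the exponent with \<theta> + \<beta> = p \<theta>, so the weight exp
  (\<theta> t) absorbs the growth exp (\<beta> t) of the coefficient.\<close>

lemma exp_\<theta>: "exp (\<theta> * t) * exp (\<beta> * t) = exp (\<theta> * t) powr p"
proof -
  have "\<theta> * t + (p - 1) * \<theta> * t = p * (\<theta> * t)" by (simp add: algebra_simps)
  then have "\<theta> * t + \<beta> * t = p * (\<theta> * t)" unfolding \<theta>(3) .
  then show ?thesis unfolding exp_powr_real by (simp add: mult.commute flip: exp_add)
qed

lemma \<phi>_lim: "(\<phi> \<longlongrightarrow> 0) at_bot"
proof (rule tendsto_sandwich[OF _ \<phi>_bound tendsto_const])
  show "((\<lambda>t. C0 * exp (\<gamma> * t)) \<longlongrightarrow> 0) at_bot"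
    using tendsto_mult[OF tendsto_const[of C0] tendsto_exp_at_bot[OF \<gamma>]] by simp
qed (use \<phi>_nonneg in auto)

text \<open>The Emden--Fowler variables \<open>w = e\<^bsup>\<theta>t\<^esup> u\<close> and \<open>x = w'\<close> turn the equation into an autonomous one
  up to the error \<open>(k0 - k) w\<^sup>p - e\<^bsup>\<theta>t\<^esup> \<phi>\<close>.\<close>

lemma emden_variables:
  assumes u: "(u has_real_derivative v t) (at t)"
    and v: "(v has_real_derivative - n * v t - (\<kappa> t * ppow p (u t) + \<phi> t)) (at t)"
  shows "((\<lambda>t. exp (\<theta> * t) * u t) has_real_derivative exp (\<theta> * t) * (\<theta> * u t + v t)) (at t)"
    and "((\<lambda>t. exp (\<theta> * t) * (\<theta> * u t + v t)) has_real_derivative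
      - a * (exp (\<theta> * t) * (\<theta> * u t + v t)) + b * (exp (\<theta> * t) * u t)
      - k t * ppow p (exp (\<theta> * t) * u t) - exp (\<theta> * t) * \<phi> t) (at t)"
proof -
  show "((\<lambda>t. exp (\<theta> * t) * u t) has_real_derivative exp (\<theta> * t) * (\<theta> * u t + v t)) (at t)"
    by (auto intro!: derivative_eq_intros u simp: algebra_simps)
  have "ppow p (exp (\<theta> * t) * u t) = exp (\<theta> * t) powr p * ppow p (u t)"
  proof -
    have "max (exp (\<theta> * t) * u t) 0 = exp (\<theta> * t) * max (u t) 0"
      by (simp add: max_mult_distrib_left)
    then show ?thesis unfolding ppow_def by (simp add: powr_mult)
  qed
  then have 1: "k t * ppow p (exp (\<theta> * t) * u t) = exp (\<theta> * t) * (\<kappa> t * ppow p (u t))"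
    unfolding exp_\<theta>[symmetric] k_def by simp
  show "((\<lambda>t. exp (\<theta> * t) * (\<theta> * u t + v t)) has_real_derivative
      - a * (exp (\<theta> * t) * (\<theta> * u t + v t)) + b * (exp (\<theta> * t) * u t)
      - k t * ppow p (exp (\<theta> * t) * u t) - exp (\<theta> * t) * \<phi> t) (at t)"
    unfolding 1 a_def b_def
    by (auto intro!: derivative_eq_intros u v simp: algebra_simps)
qed

end

locale singular_trajectory = radial_problem +
  fixes U V :: "real \<Rightarrow> real"
  assumes dU: "\<And>t. (U has_real_derivative V t) (at t)"
    and dV: "\<And>t. (V has_real_derivative - n * V t - (\<kappa> t * ppow p (U t) + \<phi> t)) (at t)"
    and U_pos: "\<And>t. 0 < U t" and U_lim: "filterlim U at_top at_bot"
begin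

text \<open>Backwards in time exp (n t) V can only grow, so a positive value of V would make U
  nondecreasing up to t and keep it from blowing up at -infinity.\<close>

lemma V_nonpos: "V t \<le> 0"
proof (rule ccontr)
  assume "\<not> V t \<le> 0"
  then have V0: "0 < V t" by simp
  have Vs: "0 < V s" if "s \<le> t" for s
  proof -
    have le: "exp (n * t) * V t \<le> exp (n * s) * V s"
    proof (rule DERIV_mono_le[OF that, where X = "\<lambda>t. exp (n * t) * V t"])
      show "((\<lambda>t. exp (n * t) * V t) has_real_derivative
          - exp (n * r) * (\<kappa> r * ppow p (U r) + \<phi> r)) (at r)" for r
        by (auto intro!: derivative_eq_intros dV simp: algebra_simps)
      show "- exp (n * r) * (\<kappa> r * ppow p (U r) + \<phi> r) \<le> 0" for r
        using \<kappa>_nonneg[of r] \<phi>_nonneg[of r] by (simp add: mult_nonpos_nonneg)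
    qed
    have "0 < exp (n * s) * V s" using V0 by (intro less_le_trans[OF _ le]) simp
    then show ?thesis by (simp add: zero_less_mult_iff)
  qed
  have "U s \<le> U t" if "s \<le> t" for s
    by (rule DERIV_nonneg_imp_nondecreasing[OF that]) (use dU Vs in \<open>force intro: less_imp_le\<close>)
  note le = this
  have "\<forall>\<^sub>F s in at_bot. U t + 1 \<le> U s" using U_lim unfolding filterlim_at_top by blast
  then obtain T where "\<And>s. s \<le> T \<Longrightarrow> U t + 1 \<le> U s"
    unfolding eventually_at_bot_linorder by blast
  from this[OF min.cobounded2[of t T]] le[OF min.cobounded1[of t T]] show False by linarith
qed

lemma U_antimono: "s \<le> t \<Longrightarrow> U t \<le> U s"
  by (rule DERIV_mono_le[OF _ dU]) (auto intro: V_nonpos)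

lemma dG: "((\<lambda>t. V t + n * U t) has_real_derivative - (\<kappa> t * ppow p (U t) + \<phi> t)) (at t)"
  by (rule DERIV_cong[OF DERIV_add[OF dV DERIV_cmult[OF dU]]]) simp

lemma dG_nonpos: "- (\<kappa> t * ppow p (U t) + \<phi> t) \<le> 0"
proof -
  have "0 \<le> \<kappa> t * ppow p (U t)" using \<kappa>_nonneg[of t] by simp
  then show ?thesis using \<phi>_nonneg[of t] by linarith
qed

text \<open>V + n U is nonincreasing. Were it negative at some time, V would stay below a negative
  constant and U would reach 0 in finite time; here positivity of the singular solution for all
  large t enters.\<close>

lemma V_ge: "0 \<le> V t + n * U t"
proof (rule ccontr)
  assume "\<not> 0 \<le> V t + n * U t"
  define c where "c = - (V t + n * U t)"
  have c: "0 < c" using \<open>\<not> _\<close> by (simp add: c_def)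
  have le: "V s \<le> - c" if "t \<le> s" for s
  proof -
    have "V s + n * U s \<le> V t + n * U t"
      by (rule DERIV_mono_le[OF that dG dG_nonpos])
    moreover have "0 < n * U s" using U_pos[of s] n by simp
    ultimately show ?thesis unfolding c_def by linarith
  qed
  define s where "s = t + U t / c"
  have s: "t \<le> s" using c U_pos[of t] by (simp add: s_def)
  have "U s + c * s \<le> U t + c * t"
    by (rule DERIV_mono_le[OF s, where X' = "\<lambda>t. V t + c"])
      (use le in \<open>force intro!: derivative_eq_intros dU\<close>)+
  then have "U s \<le> 0" using c by (simp add: s_def algebra_simps)
  then show False using U_pos[of s] by simp
qed

lemma exp_U_mono:
  assumes "s \<le> t"
  shows "exp (n * s) * U s \<le> exp (n * t) * U t"
proof (rule DERIV_nonneg_imp_nondecreasing[OF assms, where f = "\<lambda>t. exp (n * t) * U t"])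
  fix r
  have "((\<lambda>t. exp (n * t) * U t) has_real_derivative exp (n * r) * (V r + n * U r)) (at r)"
    by (auto intro!: derivative_eq_intros dU simp: algebra_simps)
  then show "\<exists>y. ((\<lambda>t. exp (n * t) * U t) has_real_derivative y) (at r) \<and> 0 \<le> y"
    using V_ge[of r] by (intro exI[of _ "exp (n * r) * (V r + n * U r)"] conjI) auto
qed

definition "w t = exp (\<theta> * t) * U t"
definition "x t = exp (\<theta> * t) * (\<theta> * U t + V t)"
lemma w_powr: "w t powr (p - 1) = exp (\<beta> * t) * U t powr (p - 1)"
proof -
  have "w t powr (p - 1) = exp ((p - 1) * \<theta> * t) * U t powr (p - 1)"
    unfolding w_def using U_pos[of t] by (simp add: powr_mult exp_powr_real mult_ac)
  then show ?thesis unfolding \<theta>(3) .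
qed

definition "err t = (k0 - k t) * w t powr p - exp (\<theta> * t) * \<phi> t"

lemma w_pos: "0 < w t"
  using U_pos by (simp add: w_def)

lemma x_bound: "\<bar>x t\<bar> \<le> n * w t"
proof -
  have "\<bar>\<theta> * U t + V t\<bar> \<le> n * U t"
  proof -
    have "\<theta> * U t \<le> n * U t" using \<theta> U_pos[of t] by (intro mult_right_mono) auto
    moreover have "0 < \<theta> * U t" using \<theta> U_pos[of t] by simp
    ultimately show ?thesis using V_ge[of t] V_nonpos[of t] by (intro abs_leI; linarith)
  qed
  then have "exp (\<theta> * t) * \<bar>\<theta> * U t + V t\<bar> \<le> exp (\<theta> * t) * (n * U t)" by (intro mult_left_mono) auto
  then show ?thesis by (simp add: x_def w_def abs_mult mult_ac)
qed

text \<open>V + n U is at most n U at time t and still nonnegative at t + 1, so by the mean value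
  theorem the reaction term is at most n U t at some time in between. By \<open>exp_U_mono\<close>,
  U shrinks at most by the factor exp (- n) on the way. Hence exp (\<beta> t) U^p is at most a
  constant times U, which bounds w^(p - 1).\<close>

lemma w_bounded: "\<exists>W. \<forall>\<^sub>F t in at_bot. w t \<le> W"
proof -
  have "eventually (\<lambda>t. k0 / 2 < \<kappa> t / exp (\<beta> * t)) at_bot"
    using k0 by (intro order_tendstoD(1)[OF k_lim]) auto
  then obtain T where T: "\<And>t. t \<le> T \<Longrightarrow> k0 / 2 < k t"
    unfolding eventually_at_bot_linorder k_def by blast
  define M where "M = n * exp (n * p) * 2 / k0"
  have "w t \<le> M powr (1 / (p - 1))" if t: "t \<le> T - 1" for t
  proof -
    obtain z where z: "t < z" "z < t + 1"
      "(V (t + 1) + n * U (t + 1)) - (V t + n * U t) = (t + 1 - t) * - (\<kappa> z * ppow p (U z) + \<phi> z)"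
      using MVT2[of t "t + 1" "\<lambda>t. V t + n * U t" "\<lambda>t. - (\<kappa> t * ppow p (U t) + \<phi> t)"] dG by auto
    have "\<kappa> z * ppow p (U z) \<le> n * U t"
      using z(3) V_ge[of "t + 1"] V_nonpos[of t] \<phi>_nonneg[of z] by simp
    moreover have "exp (\<beta> * t) * (k0 / 2) * (exp (- n) * U t) powr p \<le> \<kappa> z * ppow p (U z)"
    proof (rule mult_mono)
      have "exp (\<beta> * t) * (k0 / 2) \<le> exp (\<beta> * z) * k z"
        using z t \<beta> k0 T[of z] by (intro mult_mono) auto
      then show "exp (\<beta> * t) * (k0 / 2) \<le> \<kappa> z" by (simp add: \<kappa>_eq)
      have "exp (n * t) * U t \<le> exp (n * z) * U z" by (rule exp_U_mono) (use z in auto)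
      also have "\<dots> \<le> exp (n * t + n) * U z"
      proof (rule mult_right_mono)
        have "n * z \<le> n * (t + 1)" using z n by (intro mult_left_mono) auto
        then show "exp (n * z) \<le> exp (n * t + n)" by (simp add: distrib_left)
      qed (use U_pos[of z] in simp)
      finally have "exp (- n) * U t \<le> U z"
        by (simp add: exp_add exp_minus field_simps)
      then show "(exp (- n) * U t) powr p \<le> ppow p (U z)"
        unfolding ppow_eq_powr[OF less_imp_le[OF U_pos]] using p U_pos[of t]
        by (intro powr_mono2) auto
    qed (use \<kappa>_nonneg in auto)
    ultimately have 1: "exp (\<beta> * t) * (k0 / 2) * (exp (- n) * U t) powr p \<le> n * U t" by linarith
    have 2: "(exp (- n) * U t) powr p = exp (- n * p) * U t powr p"
      using U_pos[of t] by (simp add: powr_mult exp_powr_real)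
    have 3: "U t powr p = U t powr (p - 1) * U t"
      using U_pos[of t] powr_add[of "U t" "p - 1" 1] by simp
    note 4 = w_powr[of t]
    have "(k0 / 2 * exp (- n * p) * w t powr (p - 1)) * U t \<le> n * U t"
      using 1 unfolding 2 3 4 by (simp add: mult_ac)
    then have "k0 / 2 * exp (- n * p) * w t powr (p - 1) \<le> n" using U_pos[of t] by simp
    then have "w t powr (p - 1) \<le> M"
      unfolding M_def using k0 by (simp add: exp_minus field_simps)
    then have "(w t powr (p - 1)) powr (1 / (p - 1)) \<le> M powr (1 / (p - 1))"
      using p by (intro powr_mono2) auto
    then show ?thesis using w_pos[of t] p by (simp add: powr_powr)
  qed
  then show ?thesis unfolding eventually_at_bot_linorder by blast
qed

lemma err_lim: "(err \<longlongrightarrow> 0) at_bot"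
proof -
  obtain W where W: "\<forall>\<^sub>F t in at_bot. w t \<le> W" using w_bounded by blast
  have "((\<lambda>t. (k0 - k t) * w t powr p) \<longlongrightarrow> 0) at_bot"
  proof (rule Lim_null_comparison)
    show "\<forall>\<^sub>F t in at_bot. norm ((k0 - k t) * w t powr p) \<le> \<bar>k0 - k t\<bar> * W powr p"
      using W
    proof eventually_elim
      case (elim t)
      have "w t powr p \<le> W powr p" using elim w_pos[of t] p by (intro powr_mono2) auto
      then show ?case by (simp add: abs_mult mult_left_mono)
    qed
    have "((\<lambda>t. \<bar>k0 - k t\<bar> * W powr p) \<longlongrightarrow> \<bar>k0 - k0\<bar> * W powr p) at_bot"
      unfolding k_def by (intro tendsto_intros k_lim)
    then show "((\<lambda>t. \<bar>k0 - k t\<bar> * W powr p) \<longlongrightarrow> 0) at_bot" by simp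
  qed
  moreover have "((\<lambda>t. exp (\<theta> * t) * \<phi> t) \<longlongrightarrow> 0) at_bot"
    using tendsto_mult[OF tendsto_exp_at_bot[OF \<theta>(1)] \<phi>_lim] by simp
  ultimately have "((\<lambda>t. (k0 - k t) * w t powr p - exp (\<theta> * t) * \<phi> t) \<longlongrightarrow> 0 - 0) at_bot"
    by (rule tendsto_diff)
  then show ?thesis unfolding err_def [abs_def] by simp
qed

text \<open>If \<open>w\<close> vanished at \<open>-\<infinity>\<close>, then \<open>- V \<le> eps U\<close> for every \<open>eps\<close>, which improves first to
  \<open>U \<le> C e\<^bsup>-epst\<^esup>\<close>, then to \<open>- V \<le> C e\<^bsup>dt\<^esup>\<close> and finally to boundedness of \<open>U\<close>.\<close>

lemma not_w_lim_0: "\<not> (w \<longlongrightarrow> 0) at_bot"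
proof
  assume w0: "(w \<longlongrightarrow> 0) at_bot"
  \<comment> \<open>If U grows at most like exp (- eps t), then p eps \<le> \<beta> / 2 leaves to
    exp (\<beta> t) U^p a decay like exp (\<beta> t / 2). From eps \<le> n / 2 follows n - eps >
    \<theta>, so exp ((n - eps) t) U vanishes at -infinity.\<close>
  define eps where "eps = min (n / 2) (\<beta> / (2 * p))"
  define d where "d = min (\<beta> / 2) \<gamma>"
  have eps: "0 < eps" "eps \<le> n / 2" "p * eps \<le> \<beta> / 2"
    using n \<beta> p by (auto simp: eps_def min_def field_simps)
  have d: "0 < d" using \<beta> \<gamma> by (simp add: d_def)
  \<comment> \<open>With the weight exp ((n - eps) t), the quantity - V - eps U has the derivative R
    - m U up to that weight, where \<open>R\<close> is the reaction term.\<close>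
  define m where "m = eps * (n - eps)"
  have m: "0 < m" using eps by (auto simp: m_def)
  have lim1: "((\<lambda>t. k t * w t powr (p - 1)) \<longlongrightarrow> 0) at_bot"
  proof -
    have "((\<lambda>t. w t powr (p - 1)) \<longlongrightarrow> 0) at_bot"
      by (rule tendsto_zero_powrI[OF w0 tendsto_const]) (use p in \<open>auto intro!: always_eventually less_imp_le w_pos\<close>)
    from tendsto_mult[OF k_lim this] show ?thesis unfolding k_def by simp
  qed
  have ev1: "\<forall>\<^sub>F t in at_bot. k t * w t powr (p - 1) < m / 2"
    using m by (intro order_tendstoD(2)[OF lim1]) auto
  have ev2: "\<forall>\<^sub>F t in at_bot. \<phi> t < m / 2"
    using m by (intro order_tendstoD(2)[OF \<phi>_lim]) auto
  have ev3: "\<forall>\<^sub>F t in at_bot. 1 \<le> U t"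
    using U_lim unfolding filterlim_at_top by blast
  have ev4: "\<forall>\<^sub>F t in at_bot. k t < 2 * k0"
    unfolding k_def using k0 by (intro order_tendstoD(2)[OF k_lim]) auto
  have "\<forall>\<^sub>F t in at_bot. k t * w t powr (p - 1) < m / 2 \<and> \<phi> t < m / 2 \<and> 1 \<le> U t \<and> k t < 2 * k0
      \<and> \<phi> t \<le> C0 * exp (\<gamma> * t) \<and> t \<le> 0"
    using ev1 ev2 ev3 ev4 \<phi>_bound eventually_le_at_bot[of 0] by eventually_elim auto
  then obtain T where T: "\<And>t. t \<le> T \<Longrightarrow> k t * w t powr (p - 1) < m / 2" "\<And>t. t \<le> T \<Longrightarrow> \<phi> t < m / 2"
    "\<And>t. t \<le> T \<Longrightarrow> 1 \<le> U t" "\<And>t. t \<le> T \<Longrightarrow> k t < 2 * k0"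
    "\<And>t. t \<le> T \<Longrightarrow> \<phi> t \<le> C0 * exp (\<gamma> * t)" "T \<le> 0"
    unfolding eventually_at_bot_linorder by blast
  define R where "R = (\<lambda>t. \<kappa> t * ppow p (U t) + \<phi> t)"
  have R: "R t \<le> m * U t" if t: "t \<le> T" for t
  proof -
    have "U t powr p = U t powr (p - 1) * U t"
      using U_pos[of t] powr_add[of "U t" "p - 1" 1] by simp
    then have "\<kappa> t * ppow p (U t) = (k t * w t powr (p - 1)) * U t"
      using U_pos[of t] by (simp add: ppow_eq_powr \<kappa>_eq w_powr)
    also have "\<dots> \<le> m / 2 * U t" using T(1)[OF t] U_pos[of t] by (intro mult_right_mono) auto
    finally have "\<kappa> t * ppow p (U t) \<le> m / 2 * U t" .
    moreover have "\<phi> t \<le> m / 2 * U t"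
    proof -
      have "m / 2 * 1 \<le> m / 2 * U t" using T(3)[OF t] m by (intro mult_left_mono) auto
      then show ?thesis using T(2)[OF t] by linarith
    qed
    ultimately show ?thesis unfolding R_def by linarith
  qed
  have expU: "((\<lambda>t. n * (exp (q * t) * U t)) \<longlongrightarrow> 0) at_bot" if q: "\<theta> < q" for q
  proof -
    have "((\<lambda>t. n * (exp ((q - \<theta>) * t) * w t)) \<longlongrightarrow> n * (0 * 0)) at_bot"
      by (intro tendsto_intros tendsto_exp_at_bot w0) (use q in auto)
    moreover have "exp ((q - \<theta>) * t) * w t = exp (q * t) * U t" for t
      unfolding w_def by (simp add: left_diff_distrib exp_diff)
    ultimately show ?thesis by simp
  qed
  have V1: "- V t \<le> eps * U t" if t: "t \<le> T" for t
  proof -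
    have "exp ((n - eps) * t) * (- V t - eps * U t) \<le> 0"
    proof (rule decreasing_le_limit[where X = "\<lambda>t. exp ((n - eps) * t) * (- V t - eps * U t)" and t = t
          and X' = "\<lambda>t. exp ((n - eps) * t) * (R t - m * U t)"])
      show "((\<lambda>t. exp ((n - eps) * t) * (- V t - eps * U t)) has_real_derivative
          exp ((n - eps) * r) * (R r - m * U r)) (at r)" for r
        unfolding R_def m_def by (auto intro!: derivative_eq_intros dU dV simp: algebra_simps)
      show "exp ((n - eps) * r) * (R r - m * U r) \<le> 0" if "r \<le> t" for r
        using R[of r] that t by (simp add: mult_nonneg_nonpos)
      show "((\<lambda>t. n * (exp ((n - eps) * t) * U t)) \<longlongrightarrow> 0) at_bot"
        by (rule expU) (use \<theta> eps in auto)
      show "\<forall>\<^sub>F r in at_bot. exp ((n - eps) * r) * (- V r - eps * U r) \<le> n * (exp ((n - eps) * r) * U r)"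
      proof (rule always_eventually, rule allI)
        fix r
        have "- V r - eps * U r \<le> n * U r" using V_ge[of r] eps(1) mult_pos_pos[OF eps(1) U_pos[of r]] by linarith
        then have "exp ((n - eps) * r) * (- V r - eps * U r) \<le> exp ((n - eps) * r) * (n * U r)"
          by (intro mult_left_mono) auto
        then show "exp ((n - eps) * r) * (- V r - eps * U r) \<le> n * (exp ((n - eps) * r) * U r)"
          by (simp add: mult_ac)
      qed
    qed
    then show ?thesis by (simp add: mult_le_0_iff)
  qed
  define C1 where "C1 = exp (eps * T) * U T"
  have U1: "U t \<le> C1 * exp (- eps * t)" if t: "t \<le> T" for t
  proof -
    have "exp (eps * t) * U t \<le> exp (eps * T) * U T"
    proof (rule DERIV_nonneg_imp_nondecreasing[OF t])
      fix r assume "t \<le> r" "r \<le> T"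
      have "((\<lambda>t. exp (eps * t) * U t) has_real_derivative exp (eps * r) * (V r + eps * U r)) (at r)"
        by (auto intro!: derivative_eq_intros dU simp: algebra_simps)
      then show "\<exists>y. ((\<lambda>t. exp (eps * t) * U t) has_real_derivative y) (at r) \<and> 0 \<le> y"
        using V1[OF \<open>r \<le> T\<close>] by (intro exI[of _ "exp (eps * r) * (V r + eps * U r)"] conjI) auto
    qed
    then show ?thesis unfolding C1_def by (simp add: exp_minus field_simps)
  qed
  have C1: "0 \<le> C1" using U_pos[of T] by (simp add: C1_def)
  define C3 where "C3 = 2 * k0 * C1 powr p + \<bar>C0\<bar>"
  have R2: "R t \<le> C3 * exp (d * t)" if t: "t \<le> T" for t
  proof -
    have t0: "t \<le> 0" using t T(6) by simp
    have "ppow p (U t) \<le> (C1 * exp (- eps * t)) powr p"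
      using U1[OF t] U_pos[of t] p by (simp add: ppow_eq_powr powr_mono2)
    also have "\<dots> = C1 powr p * exp (- (p * eps) * t)"
      using C1 by (simp add: powr_mult exp_powr_real mult_ac)
    finally have 1: "ppow p (U t) \<le> C1 powr p * exp (- (p * eps) * t)" .
    have 2: "\<kappa> t \<le> 2 * k0 * exp (\<beta> * t)" using T(4)[OF t] by (simp add: \<kappa>_eq mult.commute)
    have "\<kappa> t * ppow p (U t) \<le> (2 * k0 * exp (\<beta> * t)) * (C1 powr p * exp (- (p * eps) * t))"
      using 1 2 k0 by (intro mult_mono) auto
    also have "\<dots> = 2 * k0 * C1 powr p * exp ((\<beta> - p * eps) * t)"
      by (simp add: left_diff_distrib exp_diff exp_minus field_simps)
    also have "\<dots> \<le> 2 * k0 * C1 powr p * exp (d * t)"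
      using t0 eps k0 by (intro mult_left_mono) (auto intro!: mult_right_mono_neg simp: d_def)
    finally have 3: "\<kappa> t * ppow p (U t) \<le> 2 * k0 * C1 powr p * exp (d * t)" .
    have "\<phi> t \<le> C0 * exp (\<gamma> * t)" by (rule T(5)[OF t])
    also have "\<dots> \<le> \<bar>C0\<bar> * exp (d * t)"
      using t0 by (intro mult_mono) (auto intro!: mult_right_mono_neg simp: d_def)
    finally show ?thesis using 3 unfolding R_def C3_def by (simp add: distrib_right)
  qed
  \<comment> \<open>C4 exp (d t) is the particular solution of y' = - n y + C3 exp (d t), the
    equation that dominates the one for - V.\<close>
  define C4 where "C4 = C3 / (n + d)"
  have V2: "- V t \<le> C4 * exp (d * t)" if t: "t \<le> T" for t
  proof -
    have "exp (n * t) * (- V t - C4 * exp (d * t)) \<le> 0"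
    proof (rule decreasing_le_limit[where X = "\<lambda>t. exp (n * t) * (- V t - C4 * exp (d * t))" and t = t
          and X' = "\<lambda>t. exp (n * t) * (R t - C3 * exp (d * t))"])
      show "((\<lambda>t. exp (n * t) * (- V t - C4 * exp (d * t))) has_real_derivative
          exp (n * r) * (R r - C3 * exp (d * r))) (at r)" for r
      proof -
        have "C4 * (n + d) = C3" using n d by (simp add: C4_def)
        then have C34: "C3 = C4 * n + C4 * d" by (simp add: distrib_left)
        show ?thesis
          unfolding R_def C34 by (auto intro!: derivative_eq_intros dU dV simp: algebra_simps)
      qed
      show "exp (n * r) * (R r - C3 * exp (d * r)) \<le> 0" if "r \<le> t" for r
        using R2[of r] that t by (simp add: mult_nonneg_nonpos)
      show "((\<lambda>t. n * (exp (n * t) * U t) + \<bar>C4\<bar> * exp ((n + d) * t)) \<longlongrightarrow> 0) at_bot"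
        using tendsto_add[OF expU[of n] tendsto_mult[OF tendsto_const[of "\<bar>C4\<bar>"] tendsto_exp_at_bot[of "n + d"]]] \<theta> n d
        by simp
      show "\<forall>\<^sub>F r in at_bot. exp (n * r) * (- V r - C4 * exp (d * r))
          \<le> n * (exp (n * r) * U r) + \<bar>C4\<bar> * exp ((n + d) * r)"
      proof (rule always_eventually, rule allI)
        fix r
        have "- V r - C4 * exp (d * r) \<le> n * U r + \<bar>C4\<bar> * exp (d * r)"
        proof -
          have "- C4 * exp (d * r) \<le> \<bar>C4\<bar> * exp (d * r)" by (intro mult_right_mono) auto
          then show ?thesis using V_ge[of r] by (simp add: algebra_simps)
        qed
        then have "exp (n * r) * (- V r - C4 * exp (d * r)) \<le> exp (n * r) * (n * U r + \<bar>C4\<bar> * exp (d * r))"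
          by (intro mult_left_mono) auto
        then show "exp (n * r) * (- V r - C4 * exp (d * r))
            \<le> n * (exp (n * r) * U r) + \<bar>C4\<bar> * exp ((n + d) * r)"
          by (simp add: algebra_simps exp_add)
      qed
    qed
    then show ?thesis by (simp add: mult_le_0_iff)
  qed
  have "U t \<le> U T + C4 / d * exp (d * T) + \<bar>C4\<bar> / d" if t: "t \<le> T" for t
  proof -
    have "U t + C4 / d * exp (d * t) \<le> U T + C4 / d * exp (d * T)"
    proof (rule DERIV_nonneg_imp_nondecreasing[OF t])
      fix r assume "t \<le> r" "r \<le> T"
      have "((\<lambda>t. U t + C4 / d * exp (d * t)) has_real_derivative V r + C4 * exp (d * r)) (at r)"
        using d by (auto intro!: derivative_eq_intros dU)
      then show "\<exists>y. ((\<lambda>t. U t + C4 / d * exp (d * t)) has_real_derivative y) (at r) \<and> 0 \<le> y"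
        using V2[OF \<open>r \<le> T\<close>] by (intro exI[of _ "V r + C4 * exp (d * r)"] conjI) auto
    qed
    moreover have "- (C4 / d * exp (d * t)) \<le> \<bar>C4\<bar> / d"
    proof -
      have "d * t \<le> 0" using t T(6) d by (intro mult_nonneg_nonpos) auto
      then have "\<bar>C4\<bar> / d * exp (d * t) \<le> \<bar>C4\<bar> / d * 1" using d by (intro mult_left_mono) auto
      moreover have "- (C4 / d * exp (d * t)) \<le> \<bar>C4\<bar> / d * exp (d * t)"
      proof -
        have "- C4 / d * exp (d * t) \<le> \<bar>C4\<bar> / d * exp (d * t)"
          using d by (intro mult_right_mono divide_right_mono) auto
        then show ?thesis by simp
      qed
      ultimately show ?thesis by simp
    qed
    ultimately show ?thesis by linarith
  qed
  note le = this
  have "\<forall>\<^sub>F s in at_bot. U T + C4 / d * exp (d * T) + \<bar>C4\<bar> / d + 1 \<le> U s"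
    using U_lim unfolding filterlim_at_top by blast
  then obtain T' where "\<And>s. s \<le> T' \<Longrightarrow> U T + C4 / d * exp (d * T) + \<bar>C4\<bar> / d + 1 \<le> U s"
    unfolding eventually_at_bot_linorder by blast
  from this[OF min.cobounded2[of T T']] le[OF min.cobounded1[of T T']] show False by linarith
qed

text \<open>As \<open>w\<close> does not tend to 0, \<open>L\<close> lies below some fixed -
  \<delta> arbitrarily far back. A stay near \<open>A\<close> follows within the fixed time
  \<open>S\<close>, so starting early enough makes it end before \<open>T\<close>.\<close>

lemma near_A_far_back:
  assumes eps: "0 < eps" and len: "0 < len"
  shows "\<exists>s. s + len \<le> T \<and> (\<forall>t\<in>{s..s + len}. \<bar>w t - (b / k0) powr (1 / (p - 1))\<bar> < eps)"
proof -
  obtain W where "\<forall>\<^sub>F t in at_bot. w t \<le> W" using w_bounded by blast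
  then obtain T1 where T1: "\<And>t. t \<le> T1 \<Longrightarrow> w t \<le> W" unfolding eventually_at_bot_linorder by blast
  have W: "0 < W" using T1[of T1] w_pos[of T1] by simp
  interpret EF: emden_fowler a b k0 p W "n * W"
    by unfold_locales (use ab_pos k0 p W n in auto)
  have traj: "\<exists>T. \<forall>s t. t \<le> T \<longrightarrow> EF.traj e s t w x err" if e: "0 < e" for e
  proof -
    have "\<forall>\<^sub>F t in at_bot. \<bar>err t\<bar> < e"
      using order_tendstoD(2)[OF tendsto_rabs[OF err_lim], of e] e by simp
    then obtain T2 where T2: "\<And>t. t \<le> T2 \<Longrightarrow> \<bar>err t\<bar> < e" unfolding eventually_at_bot_linorder by blast
    have "EF.traj e s t w x err" if t: "t \<le> min T1 T2" for s t
      unfolding EF.traj_def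
    proof (intro ballI conjI)
      fix r assume "r \<in> {s..t}"
      then have r: "r \<le> T1" "r \<le> T2" using t by auto
      show "(w has_real_derivative x r) (at r)"
        unfolding w_def [abs_def] x_def by (rule emden_variables[OF dU dV])
      have "(x has_real_derivative - a * x r + b * w r - k r * ppow p (w r) - exp (\<theta> * r) * \<phi> r) (at r)"
        using emden_variables(2)[OF dU dV, of r] unfolding w_def x_def [abs_def] .
      moreover have "- a * x r + b * w r - k r * ppow p (w r) - exp (\<theta> * r) * \<phi> r = - a * x r - EF.h (w r) + err r"
        using w_pos[of r] by (simp add: ppow_eq_powr EF.h_def err_def algebra_simps)
      ultimately show "(x has_real_derivative - a * x r - EF.h (w r) + err r) (at r)" by (rule DERIV_cong)
      show "0 < w r" by (rule w_pos)
      show "w r \<le> W" by (rule T1[OF r(1)])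
      show "\<bar>x r\<bar> \<le> n * W"
        using x_bound[of r] mult_left_mono[OF T1[OF r(1)], of n] n by linarith
      show "\<bar>err r\<bar> \<le> e" using T2[OF r(2)] by simp
    qed
    then show ?thesis by blast
  qed
  have "\<not> (\<forall>\<delta>>0. \<forall>\<^sub>F t in at_bot. - \<delta> < EF.L (w t) (x t))"
    using EF.tendsto_0_of_L[of w x err] traj not_w_lim_0 by blast
  then obtain \<delta> where \<delta>: "0 < \<delta>" "\<not> (\<forall>\<^sub>F t in at_bot. - \<delta> < EF.L (w t) (x t))" by blast
  obtain eps0 S where S: "0 < eps0" "0 < S"
    "\<And>s w x e. EF.traj eps0 s (s + S) w x e \<Longrightarrow> EF.L (w s) (x s) \<le> - \<delta> \<Longrightarrow>
     \<exists>t1\<ge>s. t1 + len \<le> s + S \<and> (\<forall>t\<in>{t1..t1 + len}. \<bar>w t - EF.A\<bar> < eps)"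
    using EF.near_A_interval[OF eps len \<delta>(1)] by blast
  obtain T2 where T2: "\<And>s t. t \<le> T2 \<Longrightarrow> EF.traj eps0 s t w x err" using traj[OF S(1)] by blast
  obtain s where s: "s \<le> min T T2 - S" "EF.L (w s) (x s) \<le> - \<delta>"
    using \<delta>(2) unfolding eventually_at_bot_linorder by (meson not_less)
  have "EF.traj eps0 s (s + S) w x err" by (rule T2) (use s(1) in auto)
  from S(3)[OF this s(2)] obtain t1 where t1: "s \<le> t1" "t1 + len \<le> s + S" "\<forall>t\<in>{t1..t1 + len}. \<bar>w t - EF.A\<bar> < eps"
    by blast
  then show ?thesis using s(1) unfolding EF.A_def by (intro exI[of _ t1]) auto
qed

end

section \<open>The limit profile\<close>

context radial_problem
begin

lemma exp_primitive:
  "((\<lambda>t. c / q * exp (q * t)) has_real_derivative c * exp (q * t)) (at t)" if "0 < q"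
  using that by (auto intro!: derivative_eq_intros)

lemma tendsto_exp_primitive: "((\<lambda>t. c / q * exp (q * t)) \<longlongrightarrow> 0) at_bot" if "0 < q" for c q :: real
  using tendsto_mult[OF tendsto_const[of "c / q"] tendsto_exp_at_bot[OF that]] by simp

lemma profile_exists: "\<exists>P Q. regular n p (\<lambda>t. k0 * exp (\<beta> * t)) (\<lambda>_. 0) 1 P Q"
  by (rule regular_exists[where d = \<beta> and C = k0])
    (use n p \<beta> k0 in \<open>auto intro!: continuous_intros\<close>)

text \<open>For the pure power the energy starts from 0 at -infinity and decreases, so the profile
  cannot reach w = 0, where the energy is nonnegative. The same sign of the energy bounds
  \<open>w\<close> and \<open>x\<close>, after which the Lyapunov function applies with zero
  force.\<close>

lemma profile_near_A:
  assumes reg: "regular n p (\<lambda>t. k0 * exp (\<beta> * t)) (\<lambda>_. 0) 1 P Q"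
    and eps: "0 < eps" and len: "0 < len"
  shows "\<exists>s. \<forall>t\<in>{s..s + len}. \<bar>exp (\<theta> * t) * P t - (b / k0) powr (1 / (p - 1))\<bar> < eps"
proof -
  note r = regularD[OF reg]
  define w where "w = (\<lambda>t. exp (\<theta> * t) * P t)"
  define x where "x = (\<lambda>t. exp (\<theta> * t) * (\<theta> * P t + Q t))"
  interpret S: radial_problem n p \<beta> \<gamma> k0 C0 "\<lambda>t. k0 * exp (\<beta> * t)" "\<lambda>_. 0"
  proof
    show "\<forall>\<^sub>F t in at_bot. 0 \<le> C0 * exp (\<gamma> * t)"
      using \<phi>_bound by eventually_elim (use \<phi>_nonneg in \<open>meson order_trans\<close>)
  qed (use n p \<beta> \<gamma> k0 supercritical in \<open>auto intro!: continuous_intros\<close>)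
  have Sk: "S.k t = k0" for t by (simp add: S.k_def)
  have dw: "(w has_real_derivative x t) (at t)" for t
    using S.emden_variables(1)[OF r(1,2), of t] unfolding w_def x_def .
  have dx: "(x has_real_derivative - a * x t + b * w t - k0 * ppow p (w t)) (at t)" for t
    using S.emden_variables(2)[OF r(1,2), of t] unfolding w_def x_def Sk by simp
  have lim_w: "(w \<longlongrightarrow> 0) at_bot"
    unfolding w_def using tendsto_mult[OF tendsto_exp_at_bot[OF \<theta>(1)] r(3)] by simp
  have "((\<lambda>t. exp (\<theta> * t) * (\<theta> * P t + Q t)) \<longlongrightarrow> 0 * (\<theta> * 1 + 0)) at_bot"
    by (intro tendsto_intros tendsto_exp_at_bot \<theta>(1) r(3,4))
  then have lim_x: "(x \<longlongrightarrow> 0) at_bot" by (simp add: x_def)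
  have "((\<lambda>t. \<theta> * P t + Q t) \<longlongrightarrow> \<theta> * 1 + 0) at_bot" by (intro tendsto_intros r(3,4))
  then have "\<forall>\<^sub>F t in at_bot. 0 < \<theta> * P t + Q t" using \<theta>(1) by (intro order_tendstoD(1)) auto
  moreover have "\<forall>\<^sub>F t in at_bot. 0 < P t" by (rule order_tendstoD(1)[OF r(3)]) simp
  ultimately have "\<forall>\<^sub>F t in at_bot. 0 < \<theta> * P t + Q t \<and> 0 < P t" by eventually_elim simp
  then obtain T where T: "\<And>t. t \<le> T \<Longrightarrow> 0 < \<theta> * P t + Q t" "\<And>t. t \<le> T \<Longrightarrow> 0 < P t"
    unfolding eventually_at_bot_linorder by blast
  have xT: "0 < x t" and wT: "0 < w t" if "t \<le> T" for t using T[OF that] by (auto simp: x_def w_def)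
  \<comment> \<open>This is \<open>L\<close> without the cross term. The constant \<open>c\<close>
    of \<open>L\<close> presupposes bounds on w and x, and these come from E.\<close>
  define E where "E = (\<lambda>t. (x t)\<^sup>2 / 2 + k0 * w t powr (p + 1) / (p + 1) - b * (w t)\<^sup>2 / 2)"
  have dE: "(E has_real_derivative - a * (x t)\<^sup>2) (at t)" if wt: "0 < w t" for t
  proof -
    have dp: "((\<lambda>t. w t powr (p + 1)) has_real_derivative (p + 1) * w t powr p * x t) (at t)"
      by (rule DERIV_cong[OF DERIV_fun_powr[OF dw wt]]) simp
    have "(E has_real_derivative x t * (- a * x t + b * w t - k0 * ppow p (w t))
        + k0 * ((p + 1) * w t powr p * x t) / (p + 1) - b * (w t * x t)) (at t)"
      unfolding E_def using p wt by (auto intro!: derivative_eq_intros dw dx dp)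
    moreover have "k0 * ((p + 1) * w t powr p * x t) / (p + 1) = k0 * w t powr p * x t" using p by simp
    ultimately show ?thesis
      by (elim DERIV_cong) (use wt in \<open>simp add: ppow_eq_powr power2_eq_square algebra_simps\<close>)
  qed
  have lim_E: "(E \<longlongrightarrow> 0) at_bot"
  proof -
    have "((\<lambda>t. w t powr (p + 1)) \<longlongrightarrow> 0) at_bot"
    proof (rule tendsto_zero_powrI[OF lim_w tendsto_const])
      show "\<forall>\<^sub>F t in at_bot. 0 \<le> w t"
        unfolding eventually_at_bot_linorder using wT by (meson less_imp_le)
    qed (use p in auto)
    from tendsto_mult[OF tendsto_const[of "k0 / (p + 1)"] this]
    have "((\<lambda>t. k0 * w t powr (p + 1) / (p + 1)) \<longlongrightarrow> 0) at_bot" by simp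
    moreover have "((\<lambda>t. (x t)\<^sup>2 / 2) \<longlongrightarrow> 0\<^sup>2 / 2) at_bot" "((\<lambda>t. b * (w t)\<^sup>2 / 2) \<longlongrightarrow> b * 0\<^sup>2 / 2) at_bot"
      by (intro tendsto_intros lim_x lim_w; simp)+
    ultimately show ?thesis
      unfolding E_def using tendsto_diff[OF tendsto_add] by fastforce
  qed
  have E_le: "E t \<le> 0" if "\<And>s. s \<le> t \<Longrightarrow> 0 < w s" for t
    by (rule decreasing_le_limit[where X = E and Y = E and X' = "\<lambda>t. - a * (x t)\<^sup>2"])
      (use that dE lim_E ab_pos in auto)
  have E_neg: "E T < 0"
  proof -
    have "E T < E (T - 1)"
    proof (rule DERIV_neg_imp_decreasing[where f = E])
      fix s assume "s \<le> T"
      then show "\<exists>y. (E has_real_derivative y) (at s) \<and> y < 0"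
        using dE[OF wT[of s]] xT[of s] ab_pos by (intro exI[of _ "- a * (x s)\<^sup>2"]) auto
    qed simp
    also have "E (T - 1) \<le> 0" by (rule E_le) (use wT in auto)
    finally show ?thesis .
  qed
  have w_pos: "0 < w t" for t
  proof (rule ccontr)
    assume "\<not> 0 < w t"
    then have ge: "0 \<le> - w t" by simp
    have cont_w: "continuous_on UNIV (\<lambda>t. - w t)"
      by (intro continuous_intros continuous_on_of_DERIV[OF dw])
    have neg: "- w r < 0" if "r \<le> T" for r using wT[OF that] by simp
    obtain s where "- w s = 0" "\<And>r. r < s \<Longrightarrow> - w r < 0"
      using first_hit[of "\<lambda>t. - w t" T t, OF cont_w neg ge] by blast
    then have s: "w s = 0" "\<And>r. r < s \<Longrightarrow> 0 < w r" by auto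
    have Ts: "T < s" using s(1) wT[of s] by force
    \<comment> \<open>The formula for the derivative of \<open>E\<close> is available only where w >
      0, so the end point s is reached by continuity.\<close>
    have "E s \<le> E T"
    proof (rule DERIV_nonpos_imp_decreasing_open[where f = E and a = T and b = s])
      show "\<exists>y. (E has_real_derivative y) (at r) \<and> y \<le> 0" if "T < r" "r < s" for r
        using dE[OF s(2)[OF that(2)]] ab_pos by (intro exI[of _ "- a * (x r)\<^sup>2"]) auto
      have "0 \<le> w r" if "r \<in> {T..s}" for r using s that by (cases "r = s") (auto intro: less_imp_le)
      then show "continuous_on {T..s} E"
        unfolding E_def using p
        by (intro continuous_intros continuous_on_powr' continuous_on_of_DERIV[OF dw]
            continuous_on_of_DERIV[OF dx]) auto
    qed (use Ts in auto)
    moreover have "0 \<le> E s" using s(1) p by (simp add: E_def)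
    ultimately show False using E_neg by linarith
  qed
  define W where "W = (b * (p + 1) / (2 * k0)) powr (1 / (p - 1))"
  have W: "0 < W" using ab_pos p k0 by (simp add: W_def)
  have wW: "w t \<le> W" for t
  proof -
    have "E t \<le> 0" by (rule E_le) (rule w_pos)
    moreover have "0 \<le> (x t)\<^sup>2 / 2" by simp
    ultimately have "k0 * w t powr (p + 1) / (p + 1) \<le> b * (w t)\<^sup>2 / 2" unfolding E_def by linarith
    moreover have "w t powr (p + 1) = w t powr (p - 1) * (w t)\<^sup>2"
      using w_pos[of t] powr_add[of "w t" "p - 1" 2] by (simp add: powr_numeral add.commute)
    ultimately have "(k0 * w t powr (p - 1) / (p + 1)) * (w t)\<^sup>2 \<le> (b / 2) * (w t)\<^sup>2" by simp
    then have "k0 * w t powr (p - 1) / (p + 1) \<le> b / 2"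
      by (rule mult_right_le_imp_le) (use w_pos[of t] in simp)
    then have "w t powr (p - 1) \<le> b * (p + 1) / (2 * k0)" using k0 p by (simp add: field_simps)
    then have "(w t powr (p - 1)) powr (1 / (p - 1)) \<le> W" unfolding W_def using p by (intro powr_mono2) auto
    then show ?thesis using w_pos[of t] p by (simp add: powr_powr)
  qed
  define W1 where "W1 = sqrt b * W"
  have W1: "0 < W1" using ab_pos W by (simp add: W1_def)
  have xW: "\<bar>x t\<bar> \<le> W1" for t
  proof -
    have "E t \<le> 0" by (rule E_le) (rule w_pos)
    moreover have "0 \<le> k0 * w t powr (p + 1) / (p + 1)" using k0 p by simp
    ultimately have "(x t)\<^sup>2 \<le> b * (w t)\<^sup>2" unfolding E_def by linarith
    also have "\<dots> \<le> b * W\<^sup>2" using wW[of t] w_pos[of t] ab_pos by (intro mult_left_mono power_mono) auto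
    also have "\<dots> = W1\<^sup>2" using ab_pos by (simp add: W1_def power_mult_distrib)
    finally have "\<bar>x t\<bar> \<le> \<bar>W1\<bar>" by (simp only: abs_le_square_iff)
    then show ?thesis using W1 by simp
  qed
  interpret EF: emden_fowler a b k0 p W W1
    by unfold_locales (use ab_pos k0 p W W1 in auto)
  have traj: "EF.traj 0 s t w x (\<lambda>_. 0)" for s t
    unfolding EF.traj_def
  proof (intro ballI conjI)
    fix r
    show "(x has_real_derivative - a * x r - EF.h (w r) + 0) (at r)"
      by (rule DERIV_cong[OF dx]) (use w_pos[of r] in \<open>simp add: ppow_eq_powr EF.h_def\<close>)
  qed (use dw w_pos wW xW in auto)
  have L_le: "EF.L (w t) (x t) \<le> 0" for t
  proof -
    have "((\<lambda>t. w t powr p) \<longlongrightarrow> 0) at_bot"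
      by (rule tendsto_zero_powrI[OF lim_w tendsto_const])
        (use p in \<open>auto intro!: always_eventually less_imp_le w_pos\<close>)
    then have "((\<lambda>t. EF.h (w t)) \<longlongrightarrow> k0 * 0 - b * 0) at_bot"
      unfolding EF.h_def by (intro tendsto_intros lim_w)
    then have "((\<lambda>t. E t + EF.c * x t * EF.h (w t)) \<longlongrightarrow> 0 + EF.c * 0 * (k0 * 0 - b * 0)) at_bot"
      by (intro tendsto_intros lim_x lim_E)
    then have "((\<lambda>t. EF.L (w t) (x t)) \<longlongrightarrow> 0) at_bot"
      unfolding EF.L_def EF.V_def E_def by (simp add: algebra_simps)
    moreover have "\<forall>\<^sub>F s in at_bot. EF.L (w t) (x t) \<le> EF.L (w s) (x s)"
      using eventually_le_at_bot[of t]
      by eventually_elim (use EF.L_growth[OF traj] in fastforce)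
    ultimately show ?thesis by (intro tendsto_lowerbound[of "\<lambda>t. EF.L (w t) (x t)"]) auto
  qed
  \<comment> \<open>\<open>L\<close> is at most 0 everywhere, having the limit 0 at -infinity. A
    single instant with D > 0 therefore pushes it below a negative number.\<close>
  have "0 < EF.D (w T) (x T)" using xT[of T] by (simp add: EF.D_def add_pos_nonneg)
  from EF.L_drop[OF this] obtain \<sigma> eps1 where \<sigma>: "0 < \<sigma>" and eps1: "0 < eps1"
    and drop: "EF.drops (EF.D (w T) (x T)) 1 \<sigma> eps1" by (metis zero_less_one)
  have "EF.L (w (T + 1 + 1)) (x (T + 1 + 1)) \<le> EF.L (w T) (x T) - \<sigma>"
    by (rule EF.dropsD[OF drop less_imp_le[OF eps1] traj, of T T]) auto
  then have L\<sigma>: "EF.L (w (T + 1 + 1)) (x (T + 1 + 1)) \<le> - \<sigma>" using L_le[of T] by linarith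
  obtain eps0 S where S: "0 < eps0" "0 < S"
    "\<And>s w x e. EF.traj eps0 s (s + S) w x e \<Longrightarrow> EF.L (w s) (x s) \<le> - \<sigma> \<Longrightarrow>
     \<exists>t1\<ge>s. t1 + len \<le> s + S \<and> (\<forall>t\<in>{t1..t1 + len}. \<bar>w t - EF.A\<bar> < eps)"
    using EF.near_A_interval[OF eps len \<sigma>] by blast
  have "EF.traj eps0 s t w x (\<lambda>_. 0)" for s t
    by (rule EF.traj_subset[OF traj]) (use S in auto)
  from S(3)[OF this L\<sigma>] show ?thesis unfolding EF.A_def w_def by blast
qed

text \<open>The pure power equation is invariant under \<open>u(t) \<mapsto> \<zeta> u(t + ln \<zeta> / \<theta>)\<close>, so regular solutions with large
  value \<open>\<zeta>\<close> at \<open>-\<infinity>\<close> follow the rescaled profile.\<close>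

lemma rescaled_converges:
  fixes u v :: "real \<Rightarrow> real \<Rightarrow> real"
  assumes reg: "\<And>\<zeta>. 0 < \<zeta> \<Longrightarrow> regular n p \<kappa> \<phi> \<zeta> (u \<zeta>) (v \<zeta>)"
    and prof: "regular n p (\<lambda>t. k0 * exp (\<beta> * t)) (\<lambda>_. 0) 1 P Q"
    and e: "0 < e"
  shows "\<exists>Z>0. \<forall>\<zeta>\<ge>Z. \<forall>t\<le>S. \<bar>u \<zeta> (t - ln \<zeta> / \<theta>) / \<zeta> - P t\<bar> < e"
proof -
  define \<Phi> where "\<Phi> = (\<lambda>t. (k0 + 1) / \<beta> * exp (\<beta> * t))"
  \<comment> \<open>With this value the bound of \<open>gronwall\<close> at time \<open>S\<close> is
    exactly e.\<close>
  define c where "c = e / exp (2 * p / n * \<Phi> S)"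
  have c: "0 < c" using e by (simp add: c_def)
  define m where "m = 2 / n * (exp (\<beta> * S) / \<beta> + exp (\<gamma> * S) / \<gamma>)"
  have m: "0 < m" unfolding m_def by (intro mult_pos_pos add_pos_pos divide_pos_pos) (use n \<beta> \<gamma> in auto)
  define \<delta> where "\<delta> = min 1 (c / (2 * m))"
  have \<delta>: "0 < \<delta>" "\<delta> \<le> 1" "\<delta> * m < c"
  proof -
    show "0 < \<delta>" "\<delta> \<le> 1" using c m by (auto simp: \<delta>_def)
    have "\<delta> * m \<le> c / (2 * m) * m" using m by (intro mult_right_mono) (auto simp: \<delta>_def)
    then show "\<delta> * m < c" using m c by simp
  qed
  have "((\<lambda>t. \<bar>\<kappa> t / exp (\<beta> * t) - k0\<bar>) \<longlongrightarrow> \<bar>k0 - k0\<bar>) at_bot"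
    by (intro tendsto_intros k_lim)
  then have "\<forall>\<^sub>F t in at_bot. \<bar>k t - k0\<bar> < \<delta>"
    unfolding k_def using \<delta>(1) by (intro order_tendstoD(2)) auto
  then have "\<forall>\<^sub>F t in at_bot. \<bar>k t - k0\<bar> < \<delta> \<and> \<phi> t \<le> C0 * exp (\<gamma> * t)"
    using \<phi>_bound by eventually_elim auto
  then obtain T where T: "\<And>t. t \<le> T \<Longrightarrow> \<bar>k t - k0\<bar> < \<delta>" "\<And>t. t \<le> T \<Longrightarrow> \<phi> t \<le> C0 * exp (\<gamma> * t)"
    unfolding eventually_at_bot_linorder by blast
  have "((\<lambda>t. C0 * exp (\<gamma> * t)) \<longlongrightarrow> 0) at_bot"
    using tendsto_mult[OF tendsto_const[of C0] tendsto_exp_at_bot[OF \<gamma>]] by simp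
  then have "\<forall>\<^sub>F t in at_bot. C0 * exp (\<gamma> * t) < \<delta>" using \<delta>(1) by (intro order_tendstoD(2)) auto
  then obtain T1 where T1: "\<And>t. t \<le> T1 \<Longrightarrow> C0 * exp (\<gamma> * t) < \<delta>"
    unfolding eventually_at_bot_linorder by blast
  \<comment> \<open>A shift by at least \<tau>0 moves all times up to \<open>S\<close> below
    \<open>T\<close>, where k is within \<delta> of k0, and makes C0 exp (- \<gamma> \<tau>) smaller
    than \<delta>.\<close>
  define \<tau>0 where "\<tau>0 = max 0 (max (S - T) (- T1))"
  define Z where "Z = exp (\<theta> * \<tau>0)"
  have Z: "1 \<le> Z" using \<theta>(1) by (simp add: Z_def \<tau>0_def)
  have "\<bar>u \<zeta> (t - ln \<zeta> / \<theta>) / \<zeta> - P t\<bar> < e" if \<zeta>: "Z \<le> \<zeta>" and t: "t \<le> S" for \<zeta> t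
  proof -
    define \<tau> where "\<tau> = ln \<zeta> / \<theta>"
    have \<zeta>1: "1 \<le> \<zeta>" using \<zeta> Z by simp
    have "\<theta> * \<tau>0 \<le> ln \<zeta>" using \<zeta> \<zeta>1 unfolding Z_def by (metis exp_gt_zero less_le_trans ln_exp ln_mono)
    then have \<tau>: "\<tau>0 \<le> \<tau>" using \<theta>(1) by (simp add: \<tau>_def field_simps)
    have exp\<tau>: "exp (\<theta> * \<tau>) = \<zeta>" using \<theta>(1) \<zeta>1 by (simp add: \<tau>_def)
    have \<zeta>p: "\<zeta> powr (p - 1) = exp (\<beta> * \<tau>)"
    proof -
      have "\<zeta> powr (p - 1) = exp ((p - 1) * \<theta> * \<tau>)"
        unfolding exp\<tau>[symmetric] exp_powr_real by (simp add: mult_ac)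
      then show ?thesis unfolding \<theta>(3) .
    qed
    have reg1: "regular n p \<kappa> \<phi> \<zeta> (u \<zeta>) (v \<zeta>)" using reg \<zeta>1 by simp
    note r1 = regularD[OF reg1] and le1 = regular_nonincreasing(2)[OF reg1 n \<kappa>_nonneg \<phi>_nonneg]
    note r2 = regularD[OF prof]
    have le2: "P t \<le> 1" for t
      by (rule regular_nonincreasing(2)[OF prof n]) (use k0 in auto)
    define y where "y = (\<lambda>t. u \<zeta> (t - \<tau>) / \<zeta>)"
    define z where "z = (\<lambda>t. v \<zeta> (t - \<tau>) / \<zeta>)"
    \<comment> \<open>The rescaled coefficient \<kappa> (t - \<tau>) \<zeta>^(p - 1), simplified by
      means of \<zeta> = exp (\<theta> \<tau>) and (p - 1) \<theta> = \<beta>.\<close>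
    define K where "K = (\<lambda>t. exp (\<beta> * t) * k (t - \<tau>))"
    have y1: "y t \<le> 1" for t using le1[of "t - \<tau>"] \<zeta>1 by (simp add: y_def)
    have dy: "(y has_real_derivative z t) (at t)" for t
      unfolding y_def z_def
      by (rule DERIV_cdivide, rule DERIV_cong[OF DERIV_chain2[OF r1(1)]]) (auto intro!: derivative_eq_intros)
    have dz: "(z has_real_derivative - n * z t - (K t * ppow p (y t) + \<phi> (t - \<tau>) / \<zeta>)) (at t)" for t
    proof -
      have "((\<lambda>t. v \<zeta> (t - \<tau>)) has_real_derivative
          (- n * v \<zeta> (t - \<tau>) - (\<kappa> (t - \<tau>) * ppow p (u \<zeta> (t - \<tau>)) + \<phi> (t - \<tau>))) * 1) (at t)"
        by (rule DERIV_chain2[OF r1(2)]) (auto intro!: derivative_eq_intros)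
      from DERIV_cdivide[OF this, of \<zeta>]
      have "(z has_real_derivative (- n * v \<zeta> (t - \<tau>) - (\<kappa> (t - \<tau>) * ppow p (u \<zeta> (t - \<tau>)) + \<phi> (t - \<tau>))) * 1 / \<zeta>) (at t)"
        unfolding z_def .
      moreover have "\<kappa> (t - \<tau>) * ppow p (u \<zeta> (t - \<tau>)) = \<zeta> * (K t * ppow p (y t))"
      proof -
        have "max (u \<zeta> (t - \<tau>)) 0 = \<zeta> * max (y t) 0"
          using \<zeta>1 unfolding y_def by (simp add: max_mult_distrib_left)
        then have "ppow p (u \<zeta> (t - \<tau>)) = \<zeta> powr p * ppow p (y t)"
          using \<zeta>1 by (simp add: ppow_def powr_mult)
        moreover have "\<zeta> powr p = \<zeta> * exp (\<beta> * \<tau>)"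
          using \<zeta>1 powr_add[of \<zeta> "p - 1" 1] by (simp add: \<zeta>p)
        moreover have "\<kappa> (t - \<tau>) * exp (\<beta> * \<tau>) = K t"
          unfolding K_def \<kappa>_eq[of "t - \<tau>"] by (simp add: right_diff_distrib exp_diff)
        ultimately show ?thesis by (simp add: mult_ac)
      qed
      ultimately show ?thesis
        by (elim DERIV_cong) (use \<zeta>1 in \<open>simp add: z_def field_simps\<close>)
    qed
    have shift: "filterlim (\<lambda>t. t - \<tau>) at_bot at_bot"
      by (simp add: filterlim_at_bot eventually_at_bot_linorder) (metis diff_le_eq)
    have lim_y: "(y \<longlongrightarrow> 1) at_bot"
      using tendsto_divide[OF filterlim_compose[OF r1(3) shift] tendsto_const[of \<zeta>]] \<zeta>1 by (simp add: y_def)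
    have lim_z: "(z \<longlongrightarrow> 0) at_bot"
      using tendsto_divide[OF filterlim_compose[OF r1(4) shift] tendsto_const[of \<zeta>]] \<zeta>1 by (simp add: z_def)
    define j where "j = (\<lambda>t. K t * ppow p (y t) + \<phi> (t - \<tau>) / \<zeta> - k0 * exp (\<beta> * t) * ppow p (P t))"
    define R where "R = (\<lambda>t. \<delta> / \<beta> * exp (\<beta> * t) + \<delta> / \<gamma> * exp (\<gamma> * t))"
    have j: "\<bar>j s\<bar> \<le> p * ((k0 + 1) * exp (\<beta> * s)) * \<bar>y s - P s\<bar> + (\<delta> * exp (\<beta> * s) + \<delta> * exp (\<gamma> * s))"
      if s: "s \<le> S" for s
    proof -
      have sT: "s - \<tau> \<le> T" "- \<tau> \<le> T1" using s \<tau> by (auto simp: \<tau>0_def)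
      have kk: "\<bar>k (s - \<tau>) - k0\<bar> < \<delta>" by (rule T(1)[OF sT(1)])
      have k_nonneg: "0 \<le> k (s - \<tau>)" using \<kappa>_nonneg[of "s - \<tau>"] by (simp add: k_def)
      have "\<bar>K s * (ppow p (y s) - ppow p (P s))\<bar> \<le> ((k0 + 1) * exp (\<beta> * s)) * (p * 1 powr (p - 1) * \<bar>y s - P s\<bar>)"
        unfolding abs_mult
      proof (rule mult_mono)
        have "exp (\<beta> * s) * k (s - \<tau>) \<le> exp (\<beta> * s) * (k0 + 1)"
          using kk \<delta>(2) by (intro mult_left_mono) auto
        then show "\<bar>K s\<bar> \<le> (k0 + 1) * exp (\<beta> * s)" using k_nonneg by (simp add: K_def mult.commute)
        show "\<bar>ppow p (y s) - ppow p (P s)\<bar> \<le> p * 1 powr (p - 1) * \<bar>y s - P s\<bar>"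
          by (rule ppow_lipschitz[OF p y1 le2]) simp
      qed (use k0 in auto)
      moreover have "\<bar>(k (s - \<tau>) - k0) * exp (\<beta> * s) * ppow p (P s)\<bar> \<le> \<delta> * exp (\<beta> * s) * 1"
        unfolding abs_mult
      proof (intro mult_mono)
        show "\<bar>ppow p (P s)\<bar> \<le> 1" using ppow_mono[of p "P s" 1] le2[of s] p by (simp add: ppow_eq_powr)
      qed (use kk \<delta> in auto)
      moreover have "\<bar>\<phi> (s - \<tau>) / \<zeta>\<bar> \<le> \<delta> * exp (\<gamma> * s)"
      proof -
        have "\<phi> (s - \<tau>) / \<zeta> \<le> \<phi> (s - \<tau>) / 1"
          using \<phi>_nonneg[of "s - \<tau>"] \<zeta>1 by (intro divide_left_mono) auto
        also have "\<dots> \<le> C0 * exp (\<gamma> * (s - \<tau>))" using T(2)[OF sT(1)] by simp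
        also have "\<dots> = (C0 * exp (\<gamma> * - \<tau>)) * exp (\<gamma> * s)"
          by (simp add: right_diff_distrib exp_diff exp_minus divide_inverse)
        also have "\<dots> \<le> \<delta> * exp (\<gamma> * s)"
          using T1[OF sT(2)] by (intro mult_right_mono) auto
        finally show ?thesis using \<phi>_nonneg[of "s - \<tau>"] \<zeta>1 by simp
      qed
      moreover have "j s = K s * (ppow p (y s) - ppow p (P s)) + (k (s - \<tau>) - k0) * exp (\<beta> * s) * ppow p (P s) + \<phi> (s - \<tau>) / \<zeta>"
        unfolding j_def K_def by (simp add: algebra_simps)
      moreover have "((k0 + 1) * exp (\<beta> * s)) * (p * 1 powr (p - 1) * \<bar>y s - P s\<bar>)
          = p * ((k0 + 1) * exp (\<beta> * s)) * \<bar>y s - P s\<bar>" by simp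
      ultimately show ?thesis by linarith
    qed
    have d: "((\<lambda>t. y t - P t) has_real_derivative z t - Q t) (at t)" for t
      by (intro derivative_intros dy r2)
    have v: "((\<lambda>t. z t - Q t) has_real_derivative - n * (z t - Q t) - j t) (at t)" for t
      by (rule DERIV_cong[OF DERIV_diff[OF dz r2(2)]]) (simp add: j_def algebra_simps)
    have "\<bar>y t - P t\<bar> < c * exp (2 * p / n * \<Phi> t)"
    proof (rule gronwall(1)[where L = p and ?d0.0 = "1 - 1" and \<Phi> = \<Phi> and R = R and S = S, OF n _ d v j])
      show "(\<Phi> has_real_derivative (k0 + 1) * exp (\<beta> * t)) (at t)" for t
        unfolding \<Phi>_def by (rule exp_primitive[OF \<beta>])
      show "(\<Phi> \<longlongrightarrow> 0) at_bot" unfolding \<Phi>_def by (rule tendsto_exp_primitive[OF \<beta>])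
      show "(R has_real_derivative \<delta> * exp (\<beta> * t) + \<delta> * exp (\<gamma> * t)) (at t)" for t
        unfolding R_def by (intro derivative_intros exp_primitive \<beta> \<gamma>)
      show "(R \<longlongrightarrow> 0) at_bot"
        unfolding R_def using tendsto_add[OF tendsto_exp_primitive[OF \<beta>] tendsto_exp_primitive[OF \<gamma>]] by simp
      show "((\<lambda>t. y t - P t) \<longlongrightarrow> 1 - 1) at_bot" by (rule tendsto_diff[OF lim_y r2(3)])
      show "((\<lambda>t. z t - Q t) \<longlongrightarrow> 0) at_bot" using tendsto_diff[OF lim_z r2(4)] by simp
      have "2 / n * R S = \<delta> * m" unfolding R_def m_def by (simp add: algebra_simps)
      then show "\<bar>1 - 1\<bar> + 2 / n * R S < c" using \<delta>(3) by simp
    qed (use p k0 \<delta> t in auto)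
    also have "\<dots> \<le> c * exp (2 * p / n * \<Phi> S)"
    proof -
      have "\<Phi> t \<le> \<Phi> S" unfolding \<Phi>_def using t \<beta> k0 by (intro mult_left_mono) auto
      then show ?thesis using c p n by (intro mult_left_mono) (auto intro!: mult_left_mono divide_right_mono)
    qed
    also have "\<dots> = e" by (simp add: c_def)
    finally show ?thesis by (simp add: y_def \<tau>_def)
  qed
  then show ?thesis using Z by (intro exI[of _ Z]) auto
qed

end

section \<open>Intersections with the singular solution\<close>

context radial_problem
begin

text \<open>Near -infinity u is positive, so exp (n t) v decreases strictly from its limit 0, and it
  never increases afterwards. Strictness matters because a nonpositive u becomes negative at any
  later time, and negativity at a point survives small changes of \<zeta>.\<close>

lemma regular_flux_neg:
  assumes reg: "regular n p \<kappa> \<phi> \<zeta> u v" and \<zeta>: "0 < \<zeta>"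
  shows "v t < 0"
proof -
  note r = regularD[OF reg]
  have dF: "((\<lambda>t. exp (n * t) * v t) has_real_derivative
      - exp (n * t) * (\<kappa> t * ppow p (u t) + \<phi> t)) (at t)" for t
    by (auto intro!: derivative_eq_intros r simp: algebra_simps)
  have "\<forall>\<^sub>F t in at_bot. 0 < u t" by (rule order_tendstoD(1)[OF r(3) \<zeta>])
  then obtain T where T: "\<And>t. t \<le> T \<Longrightarrow> 0 < u t" unfolding eventually_at_bot_linorder by blast
  define s where "s = min t T"
  have "exp (n * s) * v s < exp (n * (s - 1)) * v (s - 1)"
  proof (rule DERIV_neg_imp_decreasing[where f = "\<lambda>t. exp (n * t) * v t"])
    fix q assume "q \<le> s"
    then have "0 < ppow p (u q)" using T[of q] by (simp add: ppow_def s_def)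
    then have "0 < \<kappa> q * ppow p (u q) + \<phi> q"
      using \<kappa>_pos[of q] \<phi>_nonneg[of q] by (intro add_pos_nonneg mult_pos_pos) auto
    then show "\<exists>y. ((\<lambda>t. exp (n * t) * v t) has_real_derivative y) (at q) \<and> y < 0"
      by (intro exI[of _ "- exp (n * q) * (\<kappa> q * ppow p (u q) + \<phi> q)"] conjI dF)
        (simp add: mult_neg_pos)
  qed simp
  also have "\<dots> \<le> 0"
    using regular_nonincreasing(1)[OF reg n \<kappa>_nonneg \<phi>_nonneg, of "s - 1"] by (simp add: mult_nonneg_nonpos)
  finally have "exp (n * s) * v s < 0" .
  moreover have "exp (n * t) * v t \<le> exp (n * s) * v s"
  proof (rule DERIV_mono_le[OF _ dF])
    show "- exp (n * q) * (\<kappa> q * ppow p (u q) + \<phi> q) \<le> 0" for q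
      using \<kappa>_nonneg[of q] \<phi>_nonneg[of q] by (simp add: mult_nonpos_nonneg)
  qed (simp add: s_def)
  ultimately have "exp (n * t) * v t < 0" by linarith
  then show ?thesis by (simp add: mult_less_0_iff)
qed

end

context singular_trajectory
begin

text \<open>By backward uniqueness the two solutions would still agree at a time s so early that U
  exceeds \<zeta>, although u never does.\<close>

lemma no_double_zero:
  assumes reg: "regular n p \<kappa> \<phi> \<zeta> u v" and \<zeta>: "0 < \<zeta>" and z: "u t0 = U t0"
  shows "v t0 \<noteq> V t0"
proof
  assume v: "v t0 = V t0"
  note r = regularD[OF reg]
  have "\<forall>\<^sub>F t in at_bot. \<zeta> + 1 \<le> U t" using U_lim unfolding filterlim_at_top by blast
  then obtain T where T: "\<And>t. t \<le> T \<Longrightarrow> \<zeta> + 1 \<le> U t" unfolding eventually_at_bot_linorder by blast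
  define s where "s = min t0 T"
  have st: "s \<le> t0" by (simp add: s_def)
  define M where "M = max (U s) \<zeta>"
  have M: "0 \<le> M" using \<zeta> by (simp add: M_def)
  obtain B where B: "\<And>t. t \<in> {s..t0} \<Longrightarrow> \<kappa> t \<le> B" "0 \<le> B"
  proof -
    have "continuous_on {s..t0} \<kappa>" using cont(1) by (rule continuous_on_subset) auto
    then obtain y where "y \<in> {s..t0}" "\<And>t. t \<in> {s..t0} \<Longrightarrow> \<kappa> t \<le> \<kappa> y"
      using continuous_attains_sup[of "{s..t0}" \<kappa>] st by auto
    then show ?thesis using that[of "\<kappa> y"] \<kappa>_nonneg by auto
  qed
  define L where "L = p * M powr (p - 1)"
  have L: "0 \<le> L" using p by (simp add: L_def)
  \<comment> \<open>The summands make exp (C t) q nondecreasing: 1 pays for 2 z y, 2 n for the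
    damping and B L for the difference of the reaction terms.\<close>
  define C where "C = 1 + 2 * n + B * L"
  define z where "z = (\<lambda>t. u t - U t)"
  define y where "y = (\<lambda>t. v t - V t)"
  define j where "j = (\<lambda>t. \<kappa> t * (ppow p (u t) - ppow p (U t)))"
  define q where "q = (\<lambda>t. (z t)\<^sup>2 + (y t)\<^sup>2)"
  have dz: "(z has_real_derivative y t) (at t)" for t
    unfolding z_def y_def by (intro derivative_intros r dU)
  have dy: "(y has_real_derivative - n * y t - j t) (at t)" for t
    unfolding y_def j_def by (rule DERIV_cong[OF DERIV_diff[OF r(2) dV]]) (simp add: algebra_simps)
  have dq: "(q has_real_derivative 2 * z t * y t + 2 * y t * (- n * y t - j t)) (at t)" for t
    unfolding q_def by (auto intro!: derivative_eq_intros dz dy)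
  have j: "\<bar>j t\<bar> \<le> B * L * \<bar>z t\<bar>" if t: "t \<in> {s..t0}" for t
  proof -
    have "u t \<le> M" using regular_nonincreasing(2)[OF reg n \<kappa>_nonneg \<phi>_nonneg, of t] by (simp add: M_def)
    moreover have "U t \<le> M" using U_antimono[of s t] t by (simp add: M_def)
    ultimately have "\<bar>ppow p (u t) - ppow p (U t)\<bar> \<le> L * \<bar>z t\<bar>"
      unfolding L_def z_def by (rule ppow_lipschitz[OF p _ _ M])
    then have "\<kappa> t * \<bar>ppow p (u t) - ppow p (U t)\<bar> \<le> B * (L * \<bar>z t\<bar>)"
      using B(1)[OF t] B(2) by (intro mult_mono) auto
    then show ?thesis using \<kappa>_nonneg[of t] by (simp add: j_def abs_mult mult.assoc)
  qed
  have "exp (C * s) * q s \<le> exp (C * t0) * q t0"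
  proof (rule DERIV_nonneg_imp_nondecreasing[OF st, where f = "\<lambda>t. exp (C * t) * q t"])
    fix t assume t: "s \<le> t" "t \<le> t0"
    define Y where "Y = exp (C * t) * (C * q t + (2 * z t * y t + 2 * y t * (- n * y t - j t)))"
    have "((\<lambda>t. exp (C * t) * q t) has_real_derivative Y) (at t)"
      unfolding Y_def by (auto intro!: derivative_eq_intros dq simp: algebra_simps)
    moreover have "0 \<le> C * q t + (2 * z t * y t + 2 * y t * (- n * y t - j t))"
    proof -
      have "\<bar>2 * z t * y t\<bar> \<le> q t"
        unfolding q_def using sum_squares_bound[of "\<bar>z t\<bar>" "\<bar>y t\<bar>"] by (simp add: abs_mult)
      moreover have "2 * y t * (n * y t) \<le> 2 * n * q t"
        unfolding q_def using n by (simp add: power2_eq_square algebra_simps)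
      moreover have "\<bar>2 * y t * j t\<bar> \<le> B * L * q t"
      proof -
        have "\<bar>2 * y t * j t\<bar> \<le> 2 * \<bar>y t\<bar> * (B * L * \<bar>z t\<bar>)"
          using mult_left_mono[OF j[of t], of "2 * \<bar>y t\<bar>"] t by (simp add: abs_mult)
        also have "\<dots> = B * L * \<bar>2 * z t * y t\<bar>" by (simp add: abs_mult)
        also have "\<dots> \<le> B * L * q t" using \<open>\<bar>2 * z t * y t\<bar> \<le> q t\<close> B L by (intro mult_left_mono) auto
        finally show ?thesis .
      qed
      moreover have "C * q t = q t + 2 * n * q t + B * L * q t" unfolding C_def by (simp add: distrib_right)
      moreover have "2 * y t * (- n * y t - j t) = - (2 * y t * (n * y t)) - 2 * y t * j t"
        by (simp add: algebra_simps)
      ultimately show ?thesis by linarith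
    qed
    then have "0 \<le> Y" unfolding Y_def by simp
    ultimately show "\<exists>y. ((\<lambda>t. exp (C * t) * q t) has_real_derivative y) (at t) \<and> 0 \<le> y" by blast
  qed
  also have "q t0 = 0" using z v by (simp add: q_def z_def y_def)
  finally have "q s \<le> 0" by (simp add: mult_le_0_iff)
  then have "z s = 0" unfolding q_def by (simp add: sum_power2_le_zero_iff)
  then have "u s = U s" by (simp add: z_def)
  moreover have "u s \<le> \<zeta>" by (rule regular_nonincreasing(2)[OF reg n \<kappa>_nonneg \<phi>_nonneg])
  moreover have "\<zeta> + 1 \<le> U s" using T[of s] by (simp add: s_def)
  ultimately show False by simp
qed

text \<open>Near \<open>A\<close> the difference of two solutions in Emden--Fowler variables satisfies a linear equation whose
  potential exceeds \<open>\<omega>\<^sup>2 + a\<^sup>2 / 4\<close>.\<close>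

lemma zero_in_interval:
  fixes u v :: "real \<Rightarrow> real"
  assumes reg: "regular n p \<kappa> \<phi> \<zeta> u v"
    and w: "0 < \<omega>" and m: "0 < m" and q: "\<omega>\<^sup>2 + a\<^sup>2 / 4 + b \<le> p * K0 * m powr (p - 1)"
    and K: "0 < K0" "\<And>t. t \<in> {s..s + pi / \<omega>} \<Longrightarrow> K0 \<le> k t"
    and near: "\<And>t. t \<in> {s..s + pi / \<omega>} \<Longrightarrow> m \<le> exp (\<theta> * t) * u t \<and> m \<le> w t"
  shows "\<exists>t\<in>{s..s + pi / \<omega>}. u t - U t = 0"
proof -
  note r = regularD[OF reg]
  define y where "y = (\<lambda>t. exp (\<theta> * t) * u t)"
  define y1 where "y1 = (\<lambda>t. exp (\<theta> * t) * (\<theta> * u t + v t))"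
  have dy: "(y has_real_derivative y1 t) (at t)" "(y1 has_real_derivative
      - a * y1 t + b * y t - k t * ppow p (y t) - exp (\<theta> * t) * \<phi> t) (at t)" for t
    using emden_variables[OF r(1,2), of t] unfolding y_def y1_def .
  have dw: "(w has_real_derivative x t) (at t)" "(x has_real_derivative
      - a * x t + b * w t - k t * ppow p (w t) - exp (\<theta> * t) * \<phi> t) (at t)" for t
    using emden_variables[OF dU dV, of t] unfolding w_def [abs_def] x_def [abs_def] by auto
  have pw: "0 < pi / \<omega>" using w by simp
  \<comment> \<open>Since p > 1, the slope of the power on [m, infinity) is smallest at m.\<close>
  have grow: "p * m powr (p - 1) * (Y - X) \<le> Y powr p - X powr p" if XY: "m \<le> X" "X < Y" for X Y
  proof -
    have "((\<lambda>x. x powr p) has_real_derivative p * x powr (p - 1)) (at x)" if "X \<le> x" for x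
      using that XY m by (auto intro!: derivative_eq_intros)
    then obtain z where z: "X < z" "z < Y" "Y powr p - X powr p = (Y - X) * (p * z powr (p - 1))"
      using MVT2[OF XY(2), of "\<lambda>x. x powr p" "\<lambda>x. p * x powr (p - 1)"]
      by blast
    have "m powr (p - 1) \<le> z powr (p - 1)" using z XY m p by (intro powr_mono2) auto
    then have "(Y - X) * (p * m powr (p - 1)) \<le> (Y - X) * (p * z powr (p - 1))"
      using XY p by (intro mult_left_mono) auto
    then show ?thesis using z by (simp add: mult.commute)
  qed
  have key: "b * (Y - X) - k t * (Y powr p - X powr p) \<le> - (\<omega>\<^sup>2 + a\<^sup>2 / 4) * (Y - X)"
    if t: "t \<in> {s..s + pi / \<omega>}" and XY: "m \<le> X" "X < Y" for X Y t
  proof -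
    have "(\<omega>\<^sup>2 + a\<^sup>2 / 4 + b) * (Y - X) \<le> (p * K0 * m powr (p - 1)) * (Y - X)"
      using q XY by (intro mult_right_mono) auto
    also have "\<dots> = K0 * (p * m powr (p - 1) * (Y - X))" by simp
    also have "\<dots> \<le> k t * (Y powr p - X powr p)"
      using K(1) K(2)[OF t] grow[OF XY] p XY m by (intro mult_mono) auto
    finally show ?thesis by (simp add: algebra_simps)
  qed
  \<comment> \<open>Formulated for an ordered pair of solutions and used both ways: neither
    difference stays positive, so the intermediate value theorem applies.\<close>
  have le: "\<exists>t\<in>{s..s + pi / \<omega>}. Y t - X t \<le> 0"
    if d: "\<And>t. (Y has_real_derivative Y1 t) (at t)" "\<And>t. (X has_real_derivative X1 t) (at t)"
      and d2: "\<And>t. (Y1 has_real_derivative - a * Y1 t + b * Y t - k t * ppow p (Y t) - exp (\<theta> * t) * \<phi> t) (at t)"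
        "\<And>t. (X1 has_real_derivative - a * X1 t + b * X t - k t * ppow p (X t) - exp (\<theta> * t) * \<phi> t) (at t)"
      and ge: "\<And>t. t \<in> {s..s + pi / \<omega>} \<Longrightarrow> m \<le> Y t \<and> m \<le> X t" for X Y X1 Y1
  proof -
    have "\<exists>t. s \<le> t \<and> t \<le> s + pi / \<omega> \<and> Y t - X t \<le> 0"
    proof (rule sturm_oscillation[OF w DERIV_diff[OF d] DERIV_diff[OF d2], where a = a])
      fix t assume t: "s \<le> t" "t \<le> s + pi / \<omega>" "0 < Y t - X t"
      then have XY: "m \<le> Y t" "m \<le> X t" using ge[of t] by auto
      have "b * (Y t - X t) - k t * (Y t powr p - X t powr p) \<le> - (\<omega>\<^sup>2 + a\<^sup>2 / 4) * (Y t - X t)"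
        by (rule key) (use t XY in auto)
      moreover have "ppow p (Y t) = Y t powr p" "ppow p (X t) = X t powr p"
        using XY m by (auto simp: ppow_eq_powr)
      ultimately show "- a * Y1 t + b * Y t - k t * ppow p (Y t) - exp (\<theta> * t) * \<phi> t
          - (- a * X1 t + b * X t - k t * ppow p (X t) - exp (\<theta> * t) * \<phi> t)
          \<le> - a * (Y1 t - X1 t) - (\<omega>\<^sup>2 + a\<^sup>2 / 4) * (Y t - X t)"
        by (simp add: algebra_simps)
    qed
    then show ?thesis by auto
  qed
  have ge: "m \<le> y t \<and> m \<le> w t" if "t \<in> {s..s + pi / \<omega>}" for t using near[OF that] by (simp add: y_def)
  obtain t1 where t1: "t1 \<in> {s..s + pi / \<omega>}" "y t1 - w t1 \<le> 0"
    using le[OF dy(1) dw(1) dy(2) dw(2) ge] by blast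
  obtain t2 where t2: "t2 \<in> {s..s + pi / \<omega>}" "0 \<le> y t2 - w t2"
    using le[OF dw(1) dy(1) dw(2) dy(2)] ge by force
  have conn: "connected ((\<lambda>t. y t - w t) ` {s..s + pi / \<omega>})"
    by (intro connected_continuous_image continuous_intros continuous_on_of_DERIV[OF dy(1)]
        continuous_on_of_DERIV[OF dw(1)]) auto
  have "0 \<in> (\<lambda>t. y t - w t) ` {s..s + pi / \<omega>}"
    by (rule connectedD_interval[OF conn imageI[OF t1(1)] imageI[OF t2(1)] t1(2) t2(2)])
  then obtain t where "t \<in> {s..s + pi / \<omega>}" "y t - w t = 0" by auto
  then show ?thesis by (intro bexI[of _ t]) (auto simp: y_def w_def)
qed

end

locale oscillating_singular_trajectory = singular_trajectory +
  assumes osc: "(n - 2 * \<theta>)\<^sup>2 < 4 * \<beta> * (n - \<theta>)"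
begin

text \<open>The profile stays near \<open>A\<close> on one long window, the singular solution on
  equally long windows arbitrarily far back. Changing \<zeta> only shifts the rescaled profile in
  time, so the two windows can be made to coincide.\<close>

lemma many_zeros:
  fixes u v :: "real \<Rightarrow> real \<Rightarrow> real" and N :: nat
  assumes reg: "\<And>\<zeta>. 0 < \<zeta> \<Longrightarrow> regular n p \<kappa> \<phi> \<zeta> (u \<zeta>) (v \<zeta>)"
  shows "\<exists>\<zeta>>\<zeta>0. \<exists>Z. finite Z \<and> card Z = N \<and> Z \<subseteq> {t. u \<zeta> t - U t = 0}"
proof -
  define A where "A = (b / k0) powr (1 / (p - 1))"
  have A: "0 < A" "k0 * A powr (p - 1) = b" using ab_pos k0 p by (auto simp: A_def powr_powr)
  define h where "h = (p - 1) * b - a\<^sup>2 / 4"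
  have h: "0 < h"
  proof -
    have "(p - 1) * b = \<beta> * (n - \<theta>)" unfolding b_def using \<theta>(3) by (simp add: mult.assoc[symmetric])
    then show ?thesis using osc unfolding h_def a_def by simp
  qed
  \<comment> \<open>Only half of the excess \<open>h\<close> is spent on the frequency; the other
    half leaves room for replacing k0 and A by k0 - d and A - d.\<close>
  define \<omega> where "\<omega> = sqrt (h / 2)"
  have \<omega>: "0 < \<omega>" "\<omega>\<^sup>2 = h / 2" using h by (auto simp: \<omega>_def)
  have "((\<lambda>d. p * (k0 - d) * (A - d) powr (p - 1)) \<longlongrightarrow> p * (k0 - 0) * (A - 0) powr (p - 1)) (at_right 0)"
    using A by (intro tendsto_intros) auto
  moreover have "p * (k0 - 0) * (A - 0) powr (p - 1) = \<omega>\<^sup>2 + a\<^sup>2 / 4 + b + h / 2"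
  proof -
    have "p * (k0 - 0) * (A - 0) powr (p - 1) = p * (k0 * A powr (p - 1))" by simp
    also have "\<dots> = p * b" by (simp only: A(2))
    also have "p * b = \<omega>\<^sup>2 + a\<^sup>2 / 4 + b + h / 2"
      unfolding \<omega>(2) h_def by (simp add: field_simps)
    finally show ?thesis .
  qed
  ultimately have "\<forall>\<^sub>F d in at_right 0. \<omega>\<^sup>2 + a\<^sup>2 / 4 + b < p * (k0 - d) * (A - d) powr (p - 1)"
    using h by (intro order_tendstoD(1)) auto
  moreover have "\<forall>\<^sub>F d in at_right 0. d < min k0 A"
    using eventually_at_right_real[of 0 "min k0 A"] A k0 by (auto elim: eventually_mono)
  moreover have "\<forall>\<^sub>F d in at_right (0::real). 0 < d" by (simp add: eventually_at_filter)
  ultimately have "\<forall>\<^sub>F d in at_right 0. \<omega>\<^sup>2 + a\<^sup>2 / 4 + b < p * (k0 - d) * (A - d) powr (p - 1) \<and> d < min k0 A \<and> 0 < d"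
    by eventually_elim auto
  then obtain d where d: "\<omega>\<^sup>2 + a\<^sup>2 / 4 + b < p * (k0 - d) * (A - d) powr (p - 1)" "d < k0" "d < A" "0 < d"
    using eventually_happens[of _ "at_right (0::real)"] by auto
  define g where "g = pi / \<omega>"
  have g: "0 < g" using \<omega> by (simp add: g_def)
  \<comment> \<open>Room for N intervals of length g with gaps of length g between them, so that
    zeros from different intervals are distinct.\<close>
  define len where "len = (2 * real N + 1) * g"
  have len: "0 < len" using g by (simp add: len_def add_pos_pos)
  obtain P Q where prof: "regular n p (\<lambda>t. k0 * exp (\<beta> * t)) (\<lambda>_. 0) 1 P Q"
    using profile_exists by blast
  have d2: "0 < d / 2" using d by simp
  obtain t1 where t1: "\<forall>t\<in>{t1..t1 + len}. \<bar>exp (\<theta> * t) * P t - A\<bar> < d / 2"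
    using profile_near_A[OF prof d2 len] unfolding A_def by blast
  \<comment> \<open>After multiplication by the weight exp (\<theta> r), r \<le> t1 + len, the error
    is at most d / 2; the other d / 2 is the distance of the profile from \<open>A\<close>.\<close>
  define e where "e = d / 2 / exp (\<theta> * (t1 + len))"
  have e: "0 < e" using d by (simp add: e_def)
  obtain Z0 where Z0: "0 < Z0" "\<And>\<zeta> t. Z0 \<le> \<zeta> \<Longrightarrow> t \<le> t1 + len \<Longrightarrow> \<bar>u \<zeta> (t - ln \<zeta> / \<theta>) / \<zeta> - P t\<bar> < e"
    using rescaled_converges[OF reg prof e] by blast
  define Z1 where "Z1 = max Z0 (max \<zeta>0 1) + 1"
  have "\<forall>\<^sub>F t in at_bot. k0 - d < k t"
    unfolding k_def using d by (intro order_tendstoD(1)[OF k_lim]) auto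
  then obtain T where T: "\<And>t. t \<le> T \<Longrightarrow> k0 - d < k t" unfolding eventually_at_bot_linorder by blast
  obtain s where s1: "s + len \<le> min T (t1 - ln Z1 / \<theta>)" "\<forall>t\<in>{s..s + len}. \<bar>w t - A\<bar> < d / 2"
    using near_A_far_back[OF d2 len] unfolding A_def by blast
  note s = s1(1) bspec[OF s1(2)]
  \<comment> \<open>The shift ln \<zeta> / \<theta> equals t1 - s, which carries the window
    [t1, t1 + len] of the profile to the window [s, s + len] of the singular solution. As s was
    chosen far back after Z1 was fixed, \<zeta> \<ge> Z1.\<close>
  define \<zeta> where "\<zeta> = exp (\<theta> * (t1 - s))"
  have \<zeta>0: "0 < \<zeta>" by (simp add: \<zeta>_def)
  have ln\<zeta>: "ln \<zeta> / \<theta> = t1 - s" using \<theta>(1) by (simp add: \<zeta>_def)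
  have "Z1 \<le> \<zeta>"
  proof -
    have "ln Z1 / \<theta> \<le> t1 - s" using s(1) len by simp
    then have "ln Z1 \<le> \<theta> * (t1 - s)" using \<theta>(1) by (simp add: field_simps)
    then have "exp (ln Z1) \<le> \<zeta>" unfolding \<zeta>_def by simp
    then show ?thesis by (simp add: Z1_def add_pos_pos)
  qed
  then have \<zeta>: "Z0 \<le> \<zeta>" "\<zeta>0 < \<zeta>" by (auto simp: Z1_def)
  have near: "\<bar>exp (\<theta> * t) * u \<zeta> t - A\<bar> < d" if t: "t \<in> {s..s + len}" for t
  proof -
    define r where "r = t + (t1 - s)"
    have r: "r \<in> {t1..t1 + len}" using t by (auto simp: r_def)
    have "\<bar>u \<zeta> t / \<zeta> - P r\<bar> < e" using Z0(2)[OF \<zeta>(1), of r] r ln\<zeta> by (simp add: r_def)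
    then have "exp (\<theta> * r) * \<bar>u \<zeta> t / \<zeta> - P r\<bar> < exp (\<theta> * r) * e" by simp
    also have "\<dots> \<le> exp (\<theta> * (t1 + len)) * e" using r \<theta>(1) e by simp
    also have "\<dots> = d / 2" by (simp add: e_def)
    finally have "\<bar>exp (\<theta> * r) * (u \<zeta> t / \<zeta>) - exp (\<theta> * r) * P r\<bar> < d / 2"
      by (simp only: right_diff_distrib[symmetric] abs_mult abs_exp_cancel)
    moreover have "exp (\<theta> * r) = exp (\<theta> * t) * \<zeta>"
      by (simp add: r_def \<zeta>_def distrib_left exp_add)
    then have "exp (\<theta> * r) * (u \<zeta> t / \<zeta>) = exp (\<theta> * t) * u \<zeta> t" using \<zeta>0 by simp
    ultimately show ?thesis using bspec[OF t1 r] by linarith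
  qed
  define S where "S = (\<lambda>i::nat. s + 2 * real i * g)"
  have S: "t \<in> {s..s + len}" if "i < N" "t \<in> {S i..S i + g}" for i t
  proof -
    have "2 * real i * g \<le> 2 * real N * g" using that(1) g by simp
    moreover have "0 \<le> 2 * real i * g" using g by simp
    moreover have "s + 2 * real i * g \<le> t" "t \<le> s + 2 * real i * g + g"
      using that(2) by (auto simp: S_def)
    moreover have "len = 2 * real N * g + g" by (simp add: len_def distrib_right)
    ultimately show ?thesis unfolding atLeastAtMost_iff by (intro conjI; linarith)
  qed
  have "\<exists>t\<in>{S i..S i + g}. u \<zeta> t - U t = 0" if i: "i < N" for i
    unfolding g_def
  proof (rule zero_in_interval[OF reg[OF \<zeta>0] \<omega>(1)])
    show "0 < A - d" "0 < k0 - d" using d by auto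
    show "\<omega>\<^sup>2 + a\<^sup>2 / 4 + b \<le> p * (k0 - d) * (A - d) powr (p - 1)" using d by simp
    fix t assume "t \<in> {S i..S i + pi / \<omega>}"
    then have t: "t \<in> {s..s + len}" using S[OF i] by (simp add: g_def)
    show "k0 - d \<le> k t" using T[of t] t s(1) by auto
    show "A - d \<le> exp (\<theta> * t) * u \<zeta> t \<and> A - d \<le> w t"
      using near[OF t] s(2)[OF t] d(4) by (intro conjI; linarith)
  qed
  then obtain \<tau> where \<tau>: "\<And>i. i < N \<Longrightarrow> \<tau> i \<in> {S i..S i + g} \<and> u \<zeta> (\<tau> i) - U (\<tau> i) = 0" by metis
  have inj: "inj_on \<tau> {..<N}"
  proof (rule linorder_inj_onI)
    fix i j assume ij: "i < j" "i \<in> {..<N}" "j \<in> {..<N}"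
    have "real i + 1 \<le> real j" using ij(1) by simp
    then have "(2 * (real i + 1)) * g \<le> (2 * real j) * g" using g by (intro mult_right_mono) auto
    then have "S i + g < S j" unfolding S_def using g by (simp add: algebra_simps)
    then show "\<tau> i \<noteq> \<tau> j" using \<tau>[of i] \<tau>[of j] ij by auto
  qed auto
  show ?thesis
    by (intro exI[of _ \<zeta>] exI[of _ "\<tau> ` {..<N}"] conjI \<zeta>)
      (use \<tau> card_image[OF inj] in auto)
qed

lemma unbounded_positive_solutions:
  fixes u v :: "real \<Rightarrow> real \<Rightarrow> real"
  assumes reg: "\<And>\<zeta>. 0 < \<zeta> \<Longrightarrow> regular n p \<kappa> \<phi> \<zeta> (u \<zeta>) (v \<zeta>)"
    and \<Phi>: "\<And>t. (\<Phi> has_real_derivative \<kappa> t) (at t)" "(\<Phi> \<longlongrightarrow> 0) at_bot"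
    and \<zeta>0: "0 < \<zeta>0"
  shows "\<exists>\<zeta>\<ge>\<zeta>0. \<forall>t. 0 < u \<zeta> t"
proof (rule ccontr)
  assume no: "\<not> ?thesis"
  define Z where "Z = (\<lambda>\<zeta> t. u \<zeta> t - U t)"
  define Z' where "Z' = (\<lambda>\<zeta> t. v \<zeta> t - V t)"
  define I where "I = {\<zeta>0..}"
  have pos: "0 < \<zeta>" if "\<zeta> \<in> I" for \<zeta> using that \<zeta>0 by (auto simp: I_def)
  have c1: "connected I" by (simp add: I_def)
  have dZ: "(Z \<zeta> has_real_derivative Z' \<zeta> t) (at t)" if "\<zeta> \<in> I" for \<zeta> t
    unfolding Z_def Z'_def by (intro derivative_intros dU regularD(1)[OF reg[OF pos[OF that]]])
  have cZ': "continuous_on UNIV (Z' \<zeta>)" if "\<zeta> \<in> I" for \<zeta>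
    unfolding Z'_def
    by (intro continuous_intros continuous_on_of_DERIV[OF dV]
        continuous_on_of_DERIV[OF regularD(2)[OF reg[OF pos[OF that]]]])
  have simple: "Z' \<zeta> t \<noteq> 0" if "\<zeta> \<in> I" "Z \<zeta> t = 0" for \<zeta> t
    using no_double_zero[OF reg[OF pos[OF that(1)]] pos[OF that(1)], of t] that(2)
    by (simp add: Z_def Z'_def)
  have dep: "\<exists>\<delta>>0. \<forall>\<zeta>>0. \<bar>\<zeta> - \<eta>\<bar> < \<delta> \<longrightarrow> (\<forall>t\<le>S. \<bar>u \<zeta> t - u \<eta> t\<bar> < e \<and> \<bar>v \<zeta> t - v \<eta> t\<bar> < e)"
    if "0 < \<eta>" "0 < e" for \<eta> e S
    by (rule regular_C1_dependence[OF n p \<kappa>_nonneg \<phi>_nonneg \<Phi> reg that])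
  have C1: "\<exists>\<delta>>0. \<forall>\<zeta>\<in>I. \<bar>\<zeta> - \<eta>\<bar> < \<delta> \<longrightarrow>
      (\<forall>t\<le>S. \<bar>Z \<zeta> t - Z \<eta> t\<bar> < e \<and> \<bar>Z' \<zeta> t - Z' \<eta> t\<bar> < e)" if \<eta>: "\<eta> \<in> I" and e: "0 < e" for \<eta> S e
  proof -
    obtain \<delta> where "0 < \<delta>" "\<And>\<zeta> t. 0 < \<zeta> \<Longrightarrow> \<bar>\<zeta> - \<eta>\<bar> < \<delta> \<Longrightarrow> t \<le> S \<Longrightarrow>
        \<bar>u \<zeta> t - u \<eta> t\<bar> < e \<and> \<bar>v \<zeta> t - v \<eta> t\<bar> < e"
      using dep[OF pos[OF \<eta>] e, of S] by blast
    then show ?thesis unfolding Z_def Z'_def using pos by (intro exI[of _ \<delta>]) auto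
  qed
  have bd: "\<exists>a b. \<exists>\<delta>>0. \<forall>\<zeta>\<in>I. \<bar>\<zeta> - \<eta>\<bar> < \<delta> \<longrightarrow> {t. Z \<zeta> t = 0} \<subseteq> {a..b}" if \<eta>: "\<eta> \<in> I" for \<eta>
  proof -
    have "\<forall>\<^sub>F t in at_bot. \<eta> + 1 \<le> U t" using U_lim unfolding filterlim_at_top by blast
    then obtain T where T: "\<And>t. t \<le> T \<Longrightarrow> \<eta> + 1 \<le> U t" unfolding eventually_at_bot_linorder by blast
    obtain t0 where t0: "u \<eta> t0 \<le> 0" using no \<eta> unfolding I_def by (meson atLeast_iff not_less)
    \<comment> \<open>One unit to the right of a nonpositive value, u \<eta> is strictly negative.
      So are its neighbours u \<zeta> at b, and by monotonicity beyond b, where they cannot meet the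
      positive U.\<close>
    define b where "b = t0 + 1"
    have "u \<eta> b < u \<eta> t0"
    proof (rule DERIV_neg_imp_decreasing[where f = "u \<eta>"])
      show "\<exists>y. (u \<eta> has_real_derivative y) (at t) \<and> y < 0" for t
        using regularD(1)[OF reg[OF pos[OF \<eta>]]] regular_flux_neg[OF reg[OF pos[OF \<eta>]] pos[OF \<eta>]] by blast
    qed (simp add: b_def)
    then have "0 < - u \<eta> b" using t0 by simp
    from dep[OF pos[OF \<eta>] this, of b] obtain \<delta> where \<delta>: "0 < \<delta>"
      "\<And>\<zeta>. 0 < \<zeta> \<Longrightarrow> \<bar>\<zeta> - \<eta>\<bar> < \<delta> \<Longrightarrow> \<bar>u \<zeta> b - u \<eta> b\<bar> < - u \<eta> b" by blast
    have "{t. Z \<zeta> t = 0} \<subseteq> {T..b}" if \<zeta>: "\<zeta> \<in> I" "\<bar>\<zeta> - \<eta>\<bar> < min \<delta> 1" for \<zeta>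
    proof
      note mono = regular_nonincreasing[OF reg[OF pos[OF \<zeta>(1)]] n \<kappa>_nonneg \<phi>_nonneg]
      fix t assume "t \<in> {t. Z \<zeta> t = 0}"
      then have eq: "u \<zeta> t = U t" by (simp add: Z_def)
      have "T \<le> t"
      proof (rule ccontr)
        assume "\<not> T \<le> t"
        then have "\<eta> + 1 \<le> U t" using T by simp
        then show False using mono(2)[of t] eq \<zeta>(2) by linarith
      qed
      moreover have "t \<le> b"
      proof (rule ccontr)
        assume "\<not> t \<le> b"
        then have "u \<zeta> t \<le> u \<zeta> b" using mono(3)[of b t] by simp
        moreover have "u \<zeta> b < 0" using \<delta>(2)[OF pos[OF \<zeta>(1)]] \<zeta>(2) by force
        ultimately show False using U_pos[of t] eq by linarith
      qed
      ultimately show "t \<in> {T..b}" by simp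
    qed
    then show ?thesis using \<delta>(1) by (intro exI[of _ T] exI[of _ b] exI[of _ "min \<delta> 1"]) auto
  qed
  note zc = zero_count_constant[OF c1 dZ cZ' simple C1 bd]
  define m where "m = card {t. Z \<zeta>0 t = 0}"
  obtain \<zeta> Y where Y: "\<zeta>0 < \<zeta>" "card Y = Suc m" "Y \<subseteq> {t. Z \<zeta> t = 0}"
    using many_zeros[OF reg, of \<zeta>0 "Suc m"] unfolding Z_def by blast
  have I: "\<zeta> \<in> I" "\<zeta>0 \<in> I" using Y(1) by (auto simp: I_def)
  have "finite {t. Z \<zeta> t = 0}" "card {t. Z \<zeta> t = 0} = m"
    unfolding m_def using zc I by blast+
  then show False using card_mono[OF _ Y(3)] Y(2) by simp
qed

end

section \<open>The equation in the radial variable\<close>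

text \<open>Lowering the exponent only weakens the bound for t \<le> 0, and compactness covers the
  times between the region of the given bound and 0. This provides one common exponent for \<kappa>
  and \<phi>.\<close>

lemma exp_decay_bound:
  fixes h :: "real \<Rightarrow> real"
  assumes cont: "continuous_on UNIV h" and nonneg: "\<And>t. 0 \<le> h t"
    and ev: "\<forall>\<^sub>F t in at_bot. h t \<le> C * exp (q * t)" and d: "d \<le> q"
  shows "\<exists>C'. \<forall>t\<le>0. h t \<le> C' * exp (d * t)"
proof -
  obtain T where T: "\<And>t. t \<le> T \<Longrightarrow> h t \<le> C * exp (q * t)"
    using ev unfolding eventually_at_bot_linorder by blast
  have "continuous_on {min T 0..0} (\<lambda>t. h t / exp (d * t))"
    by (intro continuous_intros continuous_on_subset[OF cont]) auto
  then obtain y where y: "\<forall>t\<in>{min T 0..0}. h t / exp (d * t) \<le> h y / exp (d * y)"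
    using continuous_attains_sup[of "{min T 0..0}" "\<lambda>t. h t / exp (d * t)"] by auto
  define C' where "C' = max \<bar>C\<bar> (h y / exp (d * y))"
  have "h t \<le> C' * exp (d * t)" if t: "t \<le> 0" for t
  proof (cases "t \<le> T")
    case True
    have "h t \<le> C * exp (q * t)" by (rule T[OF True])
    also have "\<dots> \<le> C' * exp (d * t)"
    proof (rule mult_mono)
      show "exp (q * t) \<le> exp (d * t)" using d t by (simp add: mult_right_mono_neg)
    qed (auto simp: C'_def)
    finally show ?thesis .
  next
    case False
    then have "h t / exp (d * t) \<le> C'" using bspec[OF y, of t] t by (auto simp: C'_def)
    then show ?thesis by (simp add: pos_divide_le_eq)
  qed
  then show ?thesis by blast
qed

lemma filterlim_exp_at_right: "filterlim (exp :: real \<Rightarrow> real) (at_right 0) at_bot"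
  by (rule tendsto_imp_filterlim_at_right[OF exp_at_bot]) simp

text \<open>Write \<theta> = \<beta> / (p - 1) and D^2 = \<beta> (2 n + \<beta>). The last
  inequality is |2 \<theta> - (n - \<beta>)| < D. Its upper half follows from 2 \<theta> < n and
  \<beta> \<le> D. Its lower half n - \<beta> - D < 2 \<theta> is p < p_JL if n > 4 \<beta>, and
  otherwise holds because the left side is nonpositive.\<close>

lemma oscillation_condition:
  assumes N: "N \<ge> 3" and \<alpha>: "- 2 < \<alpha>" and pS: "p_S N \<alpha> < p" and pJL: "ereal p < p_JL N \<alpha>"
  defines "n \<equiv> real N - 2" and "\<beta> \<equiv> 2 + \<alpha>"
  shows "1 < p" "2 * \<beta> < n * (p - 1)"
    "(n - 2 * (\<beta> / (p - 1)))\<^sup>2 < 4 * \<beta> * (n - \<beta> / (p - 1))"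
proof -
  have n: "0 < n" using N by (simp add: n_def)
  have \<beta>: "0 < \<beta>" using \<alpha> by (simp add: \<beta>_def)
  have "p_S N \<alpha> = (n + 2 * \<beta>) / n" by (simp add: p_S_def n_def \<beta>_def)
  then have "(n + 2 * \<beta>) / n < p" using pS by simp
  then have np: "n + 2 * \<beta> < n * p" using n by (simp add: pos_divide_less_eq mult.commute)
  then have "n * 1 < n * p" using \<beta> by linarith
  then show p: "1 < p" using n by (simp only: mult_less_cancel_left_pos)
  show sup: "2 * \<beta> < n * (p - 1)" using np by (simp add: right_diff_distrib)
  define \<theta> where "\<theta> = \<beta> / (p - 1)"
  have \<theta>: "0 < \<theta>" "2 * \<theta> < n" using p \<beta> sup by (auto simp: \<theta>_def field_simps)
  define D where "D = sqrt (\<beta> * (2 * n + \<beta>))"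
  have D2: "D\<^sup>2 = \<beta> * (2 * n + \<beta>)" using \<beta> n by (simp add: D_def)
  have D0: "0 \<le> D" using \<beta> n by (simp add: D_def)
  have D\<beta>: "\<beta> \<le> D" unfolding D_def using \<beta> n by (intro real_le_rsqrt) (simp add: power2_eq_square)
  have lower: "n - \<beta> - D < 2 * \<theta>"
  proof (cases "4 * \<beta> < n")
    case True
    then have "real N > 10 + 4 * \<alpha>" by (simp add: n_def \<beta>_def)
    moreover have "(2 + \<alpha>) * (2 * real N - 2 + \<alpha>) = \<beta> * (2 * n + \<beta>)" "real N - 4 - \<alpha> = n - \<beta>"
      by (simp_all add: n_def \<beta>_def)
    ultimately have "p_JL N \<alpha> = ereal (1 + 2 * \<beta> / (n - \<beta> - D))"
      by (simp add: p_JL_def D_def \<beta>_def)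
    then have p': "p - 1 < 2 * \<beta> / (n - \<beta> - D)" using pJL by simp
    have "D < n - \<beta>"
      unfolding D_def
    proof (rule real_less_lsqrt)
      have "0 < n * (n - 4 * \<beta>)" using True n by simp
      then show "\<beta> * (2 * n + \<beta>) < (n - \<beta>)\<^sup>2" by (simp add: power2_eq_square algebra_simps)
    qed (use True \<beta> in auto)
    then have "(p - 1) * (n - \<beta> - D) < 2 * \<beta>" using p' by (simp add: pos_less_divide_eq)
    then have "(n - \<beta> - D) < 2 * \<beta> / (p - 1)" using p by (simp add: pos_less_divide_eq mult.commute)
    then show ?thesis by (simp add: \<theta>_def)
  next
    case False
    have "n - \<beta> \<le> D"
      unfolding D_def
    proof (rule real_le_rsqrt)
      have "0 \<le> n * (4 * \<beta> - n)" using False n by simp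
      then show "(n - \<beta>)\<^sup>2 \<le> \<beta> * (2 * n + \<beta>)" by (simp add: power2_eq_square algebra_simps)
    qed
    then show ?thesis using \<theta> by simp
  qed
  have "\<bar>2 * \<theta> - (n - \<beta>)\<bar> < D" using lower \<theta>(2) D\<beta> by (simp add: abs_less_iff)
  then have "\<bar>2 * \<theta> - (n - \<beta>)\<bar>\<^sup>2 < D\<^sup>2" by (intro power_strict_mono) auto
  then show "(n - 2 * (\<beta> / (p - 1)))\<^sup>2 < 4 * \<beta> * (n - \<beta> / (p - 1))"
    unfolding D2 power2_abs \<theta>_def[symmetric] by (simp add: power2_eq_square algebra_simps)
qed

text \<open>With r = exp t and V = r u'(r), the Euler operator r^2 u'' + (N - 1) r u' becomes V' +
  (N - 2) V.\<close>

lemma solves_E_exp: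
  assumes sol: "solves_E N K f p \<mu> u"
  obtains V where
    "\<And>t. ((\<lambda>t. u (exp t)) has_real_derivative V t) (at t)"
    "\<And>t. (V has_real_derivative - (real N - 2) * V t
        - (exp (2 * t) * K (exp t) * ppow p (u (exp t)) + \<mu> * exp (2 * t) * f (exp t))) (at t)"
    "\<And>t. 0 < u (exp t)"
proof -
  obtain u' u'' where u: "\<And>r. r > 0 \<Longrightarrow> (u has_real_derivative u' r) (at r)"
    "\<And>r. r > 0 \<Longrightarrow> (u' has_real_derivative u'' r) (at r)" "\<And>r. r > 0 \<Longrightarrow> u r > 0"
    "\<And>r. r > 0 \<Longrightarrow> u'' r + (real N - 1) / r * u' r + K r * u r powr p + \<mu> * f r = 0"
    using sol unfolding solves_E_def by blast
  show ?thesis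
  proof (rule that[of "\<lambda>t. u' (exp t) * exp t"])
    fix t :: real
    show "((\<lambda>t. u (exp t)) has_real_derivative u' (exp t) * exp t) (at t)"
      by (rule DERIV_chain2[OF u(1) DERIV_exp]) simp
    show "0 < u (exp t)" by (rule u(3)) simp
    have "((\<lambda>t. u' (exp t)) has_real_derivative u'' (exp t) * exp t) (at t)"
      by (rule DERIV_chain2[OF u(2) DERIV_exp]) simp
    from DERIV_mult[OF this DERIV_exp]
    have "((\<lambda>t. u' (exp t) * exp t) has_real_derivative
        (exp t)\<^sup>2 * u'' (exp t) + exp t * u' (exp t)) (at t)"
      by (rule DERIV_cong) (simp add: power2_eq_square algebra_simps)
    moreover have "(exp t)\<^sup>2 * u'' (exp t) + exp t * u' (exp t) =
      - (real N - 2) * (u' (exp t) * exp t)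
        - (exp (2 * t) * K (exp t) * ppow p (u (exp t)) + \<mu> * exp (2 * t) * f (exp t))"
    proof -
      have e2: "exp (2 * t) = (exp t)\<^sup>2" by (simp add: exp_double)
      have "(exp t)\<^sup>2 * (u'' (exp t) + (real N - 1) / exp t * u' (exp t)
          + K (exp t) * u (exp t) powr p + \<mu> * f (exp t)) = 0"
        using u(4)[of "exp t"] by simp
      moreover have "(exp t)\<^sup>2 * ((real N - 1) / exp t * u' (exp t)) = (real N - 1) * (exp t * u' (exp t))"
        by (simp add: power2_eq_square)
      ultimately show ?thesis
        unfolding e2 distrib_left using u(3)[of "exp t"] by (simp add: ppow_eq_powr algebra_simps)
    qed
    ultimately show "((\<lambda>t. u' (exp t) * exp t) has_real_derivative - (real N - 2) * (u' (exp t) * exp t)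
        - (exp (2 * t) * K (exp t) * ppow p (u (exp t)) + \<mu> * exp (2 * t) * f (exp t))) (at t)"
      by simp
  qed
qed

lemma regular_bounded_solution:
  assumes reg: "regular (real N - 2) p (\<lambda>t. exp (2 * t) * K (exp t)) (\<lambda>t. \<mu> * exp (2 * t) * f (exp t)) \<zeta> u v"
    and pos: "\<And>t. 0 < u t" and cont: "continuous_on {0<..} K" "continuous_on {0<..} f" and p: "0 < p"
  shows "bounded_solution N K f p \<mu> (\<lambda>r. u (ln r))"
    and "((\<lambda>r. u (ln r)) \<longlongrightarrow> \<zeta>) (at_right 0)"
proof -
  note r = regularD[OF reg]
  show lim: "((\<lambda>r. u (ln r)) \<longlongrightarrow> \<zeta>) (at_right 0)"
    by (rule filterlim_compose[OF r(3) ln_at_0])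
  \<comment> \<open>The second derivative of u (ln s) is (v' - v) / s^2 at ln s; the extra - v turns
    the coefficient N - 2 of the equation for v into N - 1.\<close>
  define w where "w = (\<lambda>s. (- (real N - 1) * v (ln s)) / s\<^sup>2 - K s * u (ln s) powr p - \<mu> * f s)"
  have ln_cont: "continuous_on {0<..} (\<lambda>s. g (ln s))" if "\<And>t. (g has_real_derivative g' t) (at t)"
    for g g' :: "real \<Rightarrow> real"
    by (rule continuous_on_compose2[OF continuous_on_of_DERIV[OF that, of UNIV]])
      (auto intro!: continuous_intros)
  have "solves_E N K f p \<mu> (\<lambda>r. u (ln r))"
    unfolding solves_E_def
  proof (rule exI[of _ "\<lambda>s. v (ln s) / s"], rule exI[of _ w], intro conjI allI impI)
    show "continuous_on {0<..} w"
      unfolding w_def using p pos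
      by (intro continuous_intros continuous_on_powr' cont ln_cont[OF r(1)] ln_cont[OF r(2)])
        (auto intro: less_imp_le)
    fix s :: real assume s: "0 < s"
    have dln: "(ln has_real_derivative 1 / s) (at s)" using s by (auto intro!: derivative_eq_intros)
    show "((\<lambda>r. u (ln r)) has_real_derivative v (ln s) / s) (at s)"
      using DERIV_chain2[OF r(1) dln] by simp
    have e: "exp (ln s) = s" "exp (2 * ln s) = s\<^sup>2" using s by (simp_all add: exp_double)
    have "((\<lambda>s. v (ln s) / s) has_real_derivative
        ((- (real N - 2) * v (ln s) - (exp (2 * ln s) * K (exp (ln s)) * ppow p (u (ln s))
          + \<mu> * exp (2 * ln s) * f (exp (ln s)))) * (1 / s) * s - v (ln s) * 1) / (s * s)) (at s)"
      by (rule DERIV_divide[OF DERIV_chain2[OF r(2) dln] DERIV_ident]) (use s in simp)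
    moreover have "((- (real N - 2) * v (ln s) - (s\<^sup>2 * K s * u (ln s) powr p + \<mu> * s\<^sup>2 * f s)) * (1 / s) * s
        - v (ln s) * 1) / (s * s) = w s"
      unfolding w_def using s by (simp add: power2_eq_square field_simps)
    ultimately show "((\<lambda>s. v (ln s) / s) has_real_derivative w s) (at s)"
      unfolding e using pos[of "ln s"] by (simp add: ppow_eq_powr)
    show "0 < u (ln s)" by (rule pos)
    show "w s + (real N - 1) / s * (v (ln s) / s) + K s * u (ln s) powr p + \<mu> * f s = 0"
      unfolding w_def using s by (simp add: power2_eq_square field_simps)
  qed
  then show "bounded_solution N K f p \<mu> (\<lambda>r. u (ln r))"
    unfolding bounded_solution_def using lim by blast
qed

lemma Linf_norm_ge_limit:
  assumes "(u \<longlongrightarrow> L) (at_right 0)"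
  shows "ereal \<bar>L\<bar> \<le> Linf_norm u"
proof (rule tendsto_upperbound)
  show "((\<lambda>r. ereal \<bar>u r\<bar>) \<longlongrightarrow> ereal \<bar>L\<bar>) (at_right 0)"
    by (intro tendsto_intros assms)
  have "\<forall>\<^sub>F r in at_right (0::real). 0 < r" by (simp add: eventually_at_filter)
  then show "\<forall>\<^sub>F r in at_right 0. ereal \<bar>u r\<bar> \<le> Linf_norm u"
    by eventually_elim (auto simp: Linf_norm_def intro: SUP_upper)
qed simp

theorem theorem1p3:
  fixes N :: nat and K f :: "real \<Rightarrow> real" and \<alpha> k0 \<nu> p \<mu> :: real
    and ustar :: "real \<Rightarrow> real"
  assumes "N \<ge> 3" and "\<mu> \<ge> 0"
    and "continuous_on {0<..} K" and "\<forall>r>0. K r > 0" and "cond_K0 K \<alpha> k0"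
    and "continuous_on {0<..} f" and "\<forall>r>0. f r \<ge> 0" and "\<exists>r>0. f r \<noteq> 0"
    and "cond_F0 f \<nu>"
    and "p_S N \<alpha> < p" and "ereal p < p_JL N \<alpha>"
    and "singular_solution N K f p \<mu> ustar"
  shows "\<exists>u :: nat \<Rightarrow> real \<Rightarrow> real. inj u \<and>
           (\<forall>j. bounded_solution N K f p \<mu> (u j)) \<and>
           ((\<lambda>j. Linf_norm (u j)) \<longlonglongrightarrow> \<infinity>)"
proof -
  define \<kappa> where "\<kappa> = (\<lambda>t. exp (2 * t) * K (exp t))"
  define \<phi> where "\<phi> = (\<lambda>t. \<mu> * exp (2 * t) * f (exp t))"
  define U where "U = (\<lambda>t. ustar (exp t))"
  have \<alpha>: "- 2 < \<alpha>" and k0: "0 < k0" and Klim: "((\<lambda>r. K r / r powr \<alpha>) \<longlongrightarrow> k0) (at_right 0)"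
    using \<open>cond_K0 K \<alpha> k0\<close> by (auto simp: cond_K0_def)
  have \<nu>: "- 2 < \<nu>" and fO: "f \<in> O[at_right 0](\<lambda>r. r powr \<nu>)"
    using \<open>cond_F0 f \<nu>\<close> by (auto simp: cond_F0_def)
  note osc = oscillation_condition[OF \<open>N \<ge> 3\<close> \<alpha> \<open>p_S N \<alpha> < p\<close> \<open>ereal p < p_JL N \<alpha>\<close>]
  obtain c where c: "\<forall>\<^sub>F r in at_right 0. norm (f r) \<le> c * norm (r powr \<nu>)"
    using landau_o.bigE[OF fO] by blast
  have cont_exp: "continuous_on UNIV (\<lambda>t. g (exp t))" if "continuous_on {0<..} g" for g :: "real \<Rightarrow> real"
    by (rule continuous_on_compose2[OF that]) (auto intro!: continuous_intros)
  obtain V where dU: "\<And>t. (U has_real_derivative V t) (at t)"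
    and dV: "\<And>t. (V has_real_derivative - (real N - 2) * V t - (\<kappa> t * ppow p (U t) + \<phi> t)) (at t)"
    and U_pos: "\<And>t. 0 < U t"
    using solves_E_exp[of N K f p \<mu> ustar] \<open>singular_solution N K f p \<mu> ustar\<close>
    unfolding singular_solution_def U_def \<kappa>_def \<phi>_def by blast
  have U_lim: "filterlim U at_top at_bot"
    unfolding U_def using \<open>singular_solution N K f p \<mu> ustar\<close> filterlim_exp_at_right
    unfolding singular_solution_def by (blast intro: filterlim_compose)
  have k_eq: "\<kappa> t / exp ((2 + \<alpha>) * t) = K (exp t) / exp t powr \<alpha>" for t
    by (simp add: \<kappa>_def exp_powr_real distrib_right exp_add)
  interpret radial_problem "real N - 2" p "2 + \<alpha>" "2 + \<nu>" k0 "\<mu> * c" \<kappa> \<phi>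
  proof
    show "continuous_on UNIV \<kappa>" "continuous_on UNIV \<phi>"
      unfolding \<kappa>_def \<phi>_def using assms(3,6) by (auto intro!: continuous_intros cont_exp)
    show "0 < \<kappa> t" "0 \<le> \<phi> t" for t
      unfolding \<kappa>_def \<phi>_def using assms(2,4,7) by auto
    show "((\<lambda>t. \<kappa> t / exp ((2 + \<alpha>) * t)) \<longlongrightarrow> k0) at_bot"
      unfolding k_eq by (rule filterlim_compose[OF Klim filterlim_exp_at_right])
    have "\<forall>\<^sub>F t in at_bot. norm (f (exp t)) \<le> c * norm (exp t powr \<nu>)"
      by (rule eventually_compose_filterlim[OF c filterlim_exp_at_right])
    then show "\<forall>\<^sub>F t in at_bot. \<phi> t \<le> \<mu> * c * exp ((2 + \<nu>) * t)"
    proof eventually_elim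
      case (elim t)
      have "(\<mu> * exp (2 * t)) * f (exp t) \<le> (\<mu> * exp (2 * t)) * (c * exp (\<nu> * t))"
        using elim \<open>\<mu> \<ge> 0\<close> by (intro mult_left_mono) (auto simp: exp_powr_real mult.commute)
      moreover have "exp ((2 + \<nu>) * t) = exp (2 * t) * exp (\<nu> * t)"
        by (simp add: distrib_right exp_add)
      ultimately show ?case by (simp add: \<phi>_def mult_ac)
    qed
  qed (use osc \<open>N \<ge> 3\<close> \<alpha> \<nu> k0 in auto)
  interpret oscillating_singular_trajectory "real N - 2" p "2 + \<alpha>" "2 + \<nu>" k0 "\<mu> * c" \<kappa> \<phi> U V
    by unfold_locales (use dU dV U_pos U_lim osc(3) in \<open>auto simp: \<theta>_def\<close>)
  \<comment> \<open>\<open>regular_exists\<close> asks for a single exponent and a single constant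
    for both coefficients.\<close>
  define d where "d = min (2 + \<alpha>) (2 + \<nu>)"
  have d: "0 < d" using \<alpha> \<nu> by (simp add: d_def)
  have "\<forall>\<^sub>F t in at_bot. \<kappa> t / exp ((2 + \<alpha>) * t) < k0 + 1"
    by (rule order_tendstoD(2)[OF k_lim]) simp
  then have "\<forall>\<^sub>F t in at_bot. \<kappa> t \<le> (k0 + 1) * exp ((2 + \<alpha>) * t)"
    by eventually_elim (simp add: pos_divide_less_eq)
  then obtain C1 where C1: "\<And>t. t \<le> 0 \<Longrightarrow> \<kappa> t \<le> C1 * exp (d * t)"
    using exp_decay_bound[OF cont(1) \<kappa>_nonneg, of "k0 + 1" "2 + \<alpha>" d] by (auto simp: d_def)
  obtain C2 where C2: "\<And>t. t \<le> 0 \<Longrightarrow> \<phi> t \<le> C2 * exp (d * t)"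
    using exp_decay_bound[OF cont(2) \<phi>_nonneg \<phi>_bound, of d] by (auto simp: d_def)
  define C where "C = max C1 C2"
  have C: "\<kappa> t \<le> C * exp (d * t)" "\<phi> t \<le> C * exp (d * t)" if "t \<le> 0" for t
  proof -
    have "C1 * exp (d * t) \<le> C * exp (d * t)" "C2 * exp (d * t) \<le> C * exp (d * t)"
      by (auto intro!: mult_right_mono simp: C_def)
    then show "\<kappa> t \<le> C * exp (d * t)" "\<phi> t \<le> C * exp (d * t)"
      using C1[OF that] C2[OF that] by linarith+
  qed
  have "\<exists>u v. regular (real N - 2) p \<kappa> \<phi> \<zeta> u v" if "0 < \<zeta>" for \<zeta>
    by (rule regular_exists[OF n p that d cont \<kappa>_nonneg \<phi>_nonneg C])
  then obtain u v where reg: "\<And>\<zeta>. 0 < \<zeta> \<Longrightarrow> regular (real N - 2) p \<kappa> \<phi> \<zeta> (u \<zeta>) (v \<zeta>)"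
    by metis
  have "\<exists>\<Phi>. (\<forall>t. (\<Phi> has_real_derivative \<kappa> t) (at t)) \<and> (\<Phi> \<longlongrightarrow> 0) at_bot"
    by (rule primitive_exists[OF cont(1) d, of C]) (use C \<kappa>_nonneg in auto)
  then obtain \<Phi> where \<Phi>: "\<And>t. (\<Phi> has_real_derivative \<kappa> t) (at t)" "(\<Phi> \<longlongrightarrow> 0) at_bot" by blast
  have ex: "\<exists>\<zeta>\<ge>\<zeta>0. \<forall>t. 0 < u \<zeta> t" if "0 < \<zeta>0" for \<zeta>0
    by (rule unbounded_positive_solutions[OF reg \<Phi> that])
  \<comment> \<open>Values at -infinity that are at least 1 apart make the solutions pairwise
    distinct, and their limits at r = 0, which bound the norms from below, tend to infinity.\<close>
  have "\<exists>z :: nat \<Rightarrow> real. \<forall>j. (1 \<le> z j \<and> (\<forall>t. 0 < u (z j) t)) \<and> z j + 1 \<le> z (Suc j)"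
  proof (rule dependent_nat_choice)
    show "\<exists>\<zeta>. 1 \<le> \<zeta> \<and> (\<forall>t. 0 < u \<zeta> t)" using ex[of 1] by auto
    show "\<exists>\<eta>. (1 \<le> \<eta> \<and> (\<forall>t. 0 < u \<eta> t)) \<and> \<zeta> + 1 \<le> \<eta>" if "1 \<le> \<zeta> \<and> (\<forall>t. 0 < u \<zeta> t)" for \<zeta> and j :: nat
    proof -
      have "0 < \<zeta> + 1" using that by simp
      from ex[OF this] obtain \<eta> where "\<zeta> + 1 \<le> \<eta>" "\<forall>t. 0 < u \<eta> t" by blast
      then show ?thesis using that by (intro exI[of _ \<eta>]) auto
    qed
  qed
  then obtain z :: "nat \<Rightarrow> real" where z: "\<And>j. 1 \<le> z j" "\<And>j t. 0 < u (z j) t" "\<And>j. z j + 1 \<le> z (Suc j)"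
    by blast
  have z_ge: "real j \<le> z j" for j
  proof (induction j)
    case 0
    then show ?case using z(1)[of 0] by simp
  next
    case (Suc j)
    then show ?case using z(3)[of j] by simp
  qed
  have z_mono: "strict_mono z"
    unfolding strict_mono_Suc_iff using z(3) by (meson less_add_one less_le_trans)
  define uu where "uu = (\<lambda>j r. u (z j) (ln r))"
  have z0: "0 < z j" for j using z(1)[of j] by simp
  have p0: "0 < p" using p by simp
  note bs = regular_bounded_solution[OF reg[OF z0, unfolded \<kappa>_def \<phi>_def] z(2) \<open>continuous_on {0<..} K\<close>
      \<open>continuous_on {0<..} f\<close> p0]
  have lim: "(uu j \<longlongrightarrow> z j) (at_right 0)" for j
    unfolding uu_def by (rule bs(2))
  have "inj uu"
  proof (rule injI)
    fix i j assume "uu i = uu j"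
    then have "z i = z j" using lim[of i] lim[of j] tendsto_unique[of "at_right (0::real)"] by auto
    then show "i = j" using z_mono by (simp add: strict_mono_eq)
  qed
  moreover have "bounded_solution N K f p \<mu> (uu j)" for j
    unfolding uu_def by (rule bs(1))
  moreover have "(\<lambda>j. Linf_norm (uu j)) \<longlonglongrightarrow> \<infinity>"
    unfolding tendsto_PInfty
  proof
    fix B
    obtain J :: nat where J: "B < real J" using reals_Archimedean2 by blast
    have "ereal B < Linf_norm (uu j)" if "J \<le> j" for j
    proof -
      have "B < z j" using J that z_ge[of j] by (simp add: less_le_trans order_trans)
      then have "ereal B < ereal \<bar>z j\<bar>" using z0[of j] by simp
      then show ?thesis by (rule less_le_trans[OF _ Linf_norm_ge_limit[OF lim]])
    qed
    then show "\<forall>\<^sub>F j in sequentially. ereal B < Linf_norm (uu j)"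
      unfolding eventually_sequentially by blast
  qed
  ultimately show ?thesis by blast
qed

end
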